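(* Let $\mathcal R$ be an admissible system for a finite poset with greatest element $m$, let $\Lambda=\Lambda(\mathcal R)$ (finite-dimensional over $K$), and let $E$ be the injective envelope of the right $\Lambda$-module $e_m\Lambda$. Then the algebra $$\widetilde\Lambda=\begin{pmatrix}\mathcal R_m&E\\0&\Lambda\end{pmatrix}$$ is a right peak and a left peak algebra.
   Context: Let $K$ be a field, $A$ a $K$-algebra and $(P,\le)$ a finite poset with greatest element $m$. A $P$-multiplicative system is a family $\mathcal R=\{\mathcal R_{i,j}\subseteq A\mid i\le j\}$ of $K$-subspaces such that (M.1) $\mathcal R_{i,j}\mathcal R_{j,l}\subseteq\mathcal R_{i,l}$ for $i\le j\le l$; (M.2) each $\mathcal R_i=\mathcal R_{i,i}$ is a $K$-algebra with unit $1_i$ such that $1_ir=r=r1_j$ for all $r\in\mathcal R_{i,j}$. It is admissible if (A.1) each $\mathcal R_i$ is a division ring; (A.2) if $j<m$ and $0\ne x\in\mathcal R_{i,j}$, there is $y\in\mathcal R_{j,l}$ with $l\ne j$ and $xy\ne0$. $\Lambda(\mathcal R)=\bigoplus_{i\le j}e_{i,j}\mathcal R_{i,j}$ ($e_{i,j}$ matrix units, matrix operations), $e_i=e_{i,i}1_i$. $E$ is realized as $E=D(\Lambda e_m)$, $D=\mathrm{Hom}_K(-,K)$, which is an $\mathcal R_m$-$\Lambda$-bimodule, the left $\mathcal R_m$-action being induced by the right action of $\mathcal R_m\cong e_m\Lambda e_m$ on $\Lambda e_m$. An algebra is right (left) peak if its right (left) socle is a direct sum of finitely many copies of a simple projective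 right (left) module. *)

theory Defs
  imports "HOL-Algebra.Module" "HOL-Algebra.Generated_Groups"
begin

section \<open>Modules over rings that need not be commutative\<close>

text \<open>
  The library locale \<open>module\<close> requires a commutative ring of scalars. Its record type and its
  \<open>submodule\<close> locale do not, and are reused here. Right modules over a ring are left modules over
  the opposite ring, so there the scalar product of \<open>a\<close> and \<open>x\<close> stands for \<open>x a\<close>.
\<close>

locale left_module = R: ring R + M: abelian_group M
  for R :: "('r, 'c) ring_scheme" (structure) and M :: "('r, 'm, 'd) module_scheme" (structure) +
  assumes smult_closed: "\<lbrakk>a \<in> carrier R; x \<in> carrier M\<rbrakk> \<Longrightarrow> a \<odot>\<^bsub>M\<^esub> x \<in> carrier M"
    and smult_l_distr: "\<lbrakk>a \<in> carrier R; b \<in> carrier R; x \<in> carrier M\<rbrakk>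
      \<Longrightarrow> (a \<oplus>\<^bsub>R\<^esub> b) \<odot>\<^bsub>M\<^esub> x = a \<odot>\<^bsub>M\<^esub> x \<oplus>\<^bsub>M\<^esub> b \<odot>\<^bsub>M\<^esub> x"
    and smult_r_distr: "\<lbrakk>a \<in> carrier R; x \<in> carrier M; y \<in> carrier M\<rbrakk>
      \<Longrightarrow> a \<odot>\<^bsub>M\<^esub> (x \<oplus>\<^bsub>M\<^esub> y) = a \<odot>\<^bsub>M\<^esub> x \<oplus>\<^bsub>M\<^esub> a \<odot>\<^bsub>M\<^esub> y"
    and smult_assoc: "\<lbrakk>a \<in> carrier R; b \<in> carrier R; x \<in> carrier M\<rbrakk>
      \<Longrightarrow> (a \<otimes>\<^bsub>R\<^esub> b) \<odot>\<^bsub>M\<^esub> x = a \<odot>\<^bsub>M\<^esub> (b \<odot>\<^bsub>M\<^esub> x)"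
    and smult_one: "x \<in> carrier M \<Longrightarrow> \<one>\<^bsub>R\<^esub> \<odot>\<^bsub>M\<^esub> x = x"

definition opposite :: "('r, 'c) ring_scheme \<Rightarrow> ('r, 'c) ring_scheme" where
  "opposite R = R\<lparr>mult := (\<lambda>x y. y \<otimes>\<^bsub>R\<^esub> x)\<rparr>"

definition with_scalars :: "('m, 'd) ring_scheme \<Rightarrow> ('r \<Rightarrow> 'm \<Rightarrow> 'm) \<Rightarrow> ('r, 'm) module" where
  "with_scalars M s = \<lparr>carrier = carrier M, mult = mult M, one = one M,
     zero = zero M, add = add M, smult = s\<rparr>"

definition regular_module :: "('r, 'c) ring_scheme \<Rightarrow> ('r, 'r) module" where
  "regular_module R = with_scalars R (mult R)"

definition linear_maps ::
  "('r, 'c) ring_scheme \<Rightarrow> ('r, 'm, 'd) module_scheme \<Rightarrow> ('r, 'n, 'e) module_scheme \<Rightarrow> ('m \<Rightarrow> 'n) set"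
where
  "linear_maps R M N = {h \<in> carrier M \<rightarrow> carrier N.
     (\<forall>x\<in>carrier M. \<forall>y\<in>carrier M. h (x \<oplus>\<^bsub>M\<^esub> y) = h x \<oplus>\<^bsub>N\<^esub> h y) \<and>
     (\<forall>a\<in>carrier R. \<forall>x\<in>carrier M. h (a \<odot>\<^bsub>M\<^esub> x) = a \<odot>\<^bsub>N\<^esub> h x)}"

definition module_iso ::
  "('r, 'c) ring_scheme \<Rightarrow> ('r, 'm, 'd) module_scheme \<Rightarrow> ('r, 'n, 'e) module_scheme \<Rightarrow> bool"
where
  "module_iso R M N \<longleftrightarrow> (\<exists>h\<in>linear_maps R M N. bij_betw h (carrier M) (carrier N))"

definition direct_power :: "nat \<Rightarrow> ('r, 'm) module \<Rightarrow> ('r, nat \<Rightarrow> 'm) module" where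
  "direct_power n M = \<lparr>carrier = {..<n} \<rightarrow>\<^sub>E carrier M, mult = undefined, one = undefined,
     zero = (\<lambda>i\<in>{..<n}. \<zero>\<^bsub>M\<^esub>), add = (\<lambda>f g. \<lambda>i\<in>{..<n}. f i \<oplus>\<^bsub>M\<^esub> g i),
     smult = (\<lambda>a f. \<lambda>i\<in>{..<n}. a \<odot>\<^bsub>M\<^esub> f i)\<rparr>"

definition simple_module :: "('r, 'c) ring_scheme \<Rightarrow> ('r, 'm) module \<Rightarrow> bool" where
  "simple_module R S \<longleftrightarrow> left_module R S \<and> carrier S \<noteq> {\<zero>\<^bsub>S\<^esub>} \<and>
     (\<forall>N. submodule N R S \<longrightarrow> N = {\<zero>\<^bsub>S\<^esub>} \<or> N = carrier S)"

text \<open>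
  The sum of all simple submodules.
\<close>

definition socle :: "('r, 'c) ring_scheme \<Rightarrow> ('r, 'm) module \<Rightarrow> 'm set" where
  "socle R M = generate (add_monoid M)
     (\<Union>{N. submodule N R M \<and> simple_module R (M\<lparr>carrier := N\<rparr>)})"

text \<open>
  A definition cannot quantify over all types, so the lifting property is required for test modules
  on two fixed types. They are large enough: taking for \<open>N\<close> the module \<open>P\<close> and for \<open>M\<close> the free
  module on the set \<open>carrier P\<close>, whose elements are functions of type \<open>'m \<Rightarrow> 'r\<close>, the property shows
  that \<open>P\<close> is a direct summand of a free module, and then it holds for test modules on all types.
\<close>

definition projective_module :: "('r, 'c) ring_scheme \<Rightarrow> ('r, 'm) module \<Rightarrow> bool" where
  "projective_module R P \<longleftrightarrow> left_module R P \<and>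
     (\<forall>(M :: ('r, 'm \<Rightarrow> 'r) module) (N :: ('r, 'm) module) g f.
        left_module R M \<and> left_module R N \<and>
        g \<in> linear_maps R M N \<and> g ` carrier M = carrier N \<and> f \<in> linear_maps R P N \<longrightarrow>
        (\<exists>h\<in>linear_maps R P M. \<forall>x\<in>carrier P. g (h x) = f x))"

text \<open>
  Test modules on the type of the ring suffice by Baer's criterion.
\<close>

definition injective_module :: "('r, 'c) ring_scheme \<Rightarrow> ('r, 'm) module \<Rightarrow> bool" where
  "injective_module R E \<longleftrightarrow> left_module R E \<and>
     (\<forall>(M :: ('r, 'r) module) N f.
        left_module R M \<and> submodule N R M \<and> f \<in> linear_maps R (M\<lparr>carrier := N\<rparr>) E \<longrightarrow>
        (\<exists>g\<in>linear_maps R M E. \<forall>x\<in>N. g x = f x))"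

definition injective_envelope ::
  "('r, 'c) ring_scheme \<Rightarrow> ('r, 'm) module \<Rightarrow> ('r, 'n) module \<Rightarrow> bool"
where
  "injective_envelope R M E \<longleftrightarrow> left_module R M \<and> injective_module R E \<and>
     (\<exists>h\<in>linear_maps R M E. inj_on h (carrier M) \<and>
        (\<forall>N. submodule N R E \<and> N \<inter> h ` carrier M = {\<zero>\<^bsub>E\<^esub>} \<longrightarrow> N = {\<zero>\<^bsub>E\<^esub>}))"


section \<open>Algebras over a field\<close>

locale K_algebra = K: field K + module K A + A: ring A
  for K :: "'k ring" (structure) and A :: "('k, 'a) module" (structure) +
  assumes smult_mult_l:
      "\<lbrakk>c \<in> carrier K; x \<in> carrier A; y \<in> carrier A\<rbrakk>
        \<Longrightarrow> (c \<odot>\<^bsub>A\<^esub> x) \<otimes>\<^bsub>A\<^esub> y = c \<odot>\<^bsub>A\<^esub> (x \<otimes>\<^bsub>A\<^esub> y)"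
    and smult_mult_r:
      "\<lbrakk>c \<in> carrier K; x \<in> carrier A; y \<in> carrier A\<rbrakk>
        \<Longrightarrow> x \<otimes>\<^bsub>A\<^esub> (c \<odot>\<^bsub>A\<^esub> y) = c \<odot>\<^bsub>A\<^esub> (x \<otimes>\<^bsub>A\<^esub> y)"

definition finite_dimensional :: "'k ring \<Rightarrow> ('k, 'm) module \<Rightarrow> bool" where
  "finite_dimensional K M \<longleftrightarrow> (\<exists>B. finite B \<and> B \<subseteq> carrier M \<and>
     (\<forall>x\<in>carrier M. \<exists>c\<in>B \<rightarrow> carrier K. x = (\<Oplus>\<^bsub>M\<^esub>b\<in>B. c b \<odot>\<^bsub>M\<^esub> b)))"

definition dual_space :: "'k ring \<Rightarrow> ('k, 'm) module \<Rightarrow> ('k, 'm \<Rightarrow> 'k) module" where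
  "dual_space K M = \<lparr>carrier = linear_maps K M (regular_module K) \<inter> extensional (carrier M),
     mult = undefined, one = undefined,
     zero = (\<lambda>x\<in>carrier M. \<zero>\<^bsub>K\<^esub>), add = (\<lambda>f g. \<lambda>x\<in>carrier M. f x \<oplus>\<^bsub>K\<^esub> g x),
     smult = (\<lambda>c f. \<lambda>x\<in>carrier M. c \<otimes>\<^bsub>K\<^esub> f x)\<rparr>"

definition division_ring :: "('r, 'c) ring_scheme \<Rightarrow> bool" where
  "division_ring R \<longleftrightarrow> ring R \<and> \<one>\<^bsub>R\<^esub> \<noteq> \<zero>\<^bsub>R\<^esub> \<and> Units R = carrier R - {\<zero>\<^bsub>R\<^esub>}"

text \<open>
  The left socle is a direct sum of finitely many copies of a simple projective left module. There
  is no loss in taking the simple projective module \<open>S\<close> on the type of the ring: such a module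
  is isomorphic to a left ideal.
\<close>

definition peak_socle :: "('r, 'c) ring_scheme \<Rightarrow> bool" where
  "peak_socle R \<longleftrightarrow> (\<exists>(S :: ('r, 'r) module) n.
     simple_module R S \<and> projective_module R S \<and>
     module_iso R ((regular_module R)\<lparr>carrier := socle R (regular_module R)\<rparr>) (direct_power n S))"

definition left_peak_algebra :: "'k ring \<Rightarrow> ('k, 'r) module \<Rightarrow> bool" where
  "left_peak_algebra K R \<longleftrightarrow> K_algebra K R \<and> peak_socle R"

definition right_peak_algebra :: "'k ring \<Rightarrow> ('k, 'r) module \<Rightarrow> bool" where
  "right_peak_algebra K R \<longleftrightarrow> K_algebra K R \<and> peak_socle (opposite R)"

text \<open>
  The algebra of upper triangular matrices with diagonal entries in \<open>S\<close> and \<open>T\<close> and upper right entry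
  in \<open>E\<close>; \<open>la\<close> and \<open>ra\<close> are the left \<open>S\<close>-action and the right \<open>T\<close>-action on \<open>E\<close>.
\<close>

definition triangular_algebra ::
  "('k, 's) module \<Rightarrow> ('k, 'e) module \<Rightarrow> ('k, 't) module \<Rightarrow> ('s \<Rightarrow> 'e \<Rightarrow> 'e) \<Rightarrow> ('e \<Rightarrow> 't \<Rightarrow> 'e)
    \<Rightarrow> ('k, 's \<times> 'e \<times> 't) module"
where
  "triangular_algebra S E T la ra = \<lparr>carrier = carrier S \<times> carrier E \<times> carrier T,
     mult = (\<lambda>(s, e, t) (s', e', t'). (s \<otimes>\<^bsub>S\<^esub> s', la s e' \<oplus>\<^bsub>E\<^esub> ra e t', t \<otimes>\<^bsub>T\<^esub> t')),
     one = (\<one>\<^bsub>S\<^esub>, \<zero>\<^bsub>E\<^esub>, \<one>\<^bsub>T\<^esub>),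
     zero = (\<zero>\<^bsub>S\<^esub>, \<zero>\<^bsub>E\<^esub>, \<zero>\<^bsub>T\<^esub>),
     add = (\<lambda>(s, e, t) (s', e', t'). (s \<oplus>\<^bsub>S\<^esub> s', e \<oplus>\<^bsub>E\<^esub> e', t \<oplus>\<^bsub>T\<^esub> t')),
     smult = (\<lambda>c (s, e, t). (c \<odot>\<^bsub>S\<^esub> s, c \<odot>\<^bsub>E\<^esub> e, c \<odot>\<^bsub>T\<^esub> t))\<rparr>"


section \<open>Multiplicative systems\<close>

text \<open>
  The poset is the whole type \<open>'p\<close>. Only the values \<open>R i j\<close> with \<open>i \<le> j\<close> matter. The unit of \<open>R i i\<close>,
  which need not be the unit of \<open>A\<close>, is the parameter \<open>u i\<close>; the axioms determine it.
\<close>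

locale multiplicative_system = K_algebra K A
  for K :: "'k ring" (structure) and A :: "('k, 'a) module" (structure) +
  fixes R :: "'p::{finite, order} \<Rightarrow> 'p \<Rightarrow> 'a set" and u :: "'p \<Rightarrow> 'a"
  assumes subspace: "i \<le> j \<Longrightarrow> submodule (R i j) K A"
    and mult_closed: "\<lbrakk>i \<le> j; j \<le> l; x \<in> R i j; y \<in> R j l\<rbrakk> \<Longrightarrow> x \<otimes>\<^bsub>A\<^esub> y \<in> R i l"
    and unit_closed: "u i \<in> R i i"
    and unit_l: "\<lbrakk>i \<le> j; r \<in> R i j\<rbrakk> \<Longrightarrow> u i \<otimes>\<^bsub>A\<^esub> r = r"
    and unit_r: "\<lbrakk>i \<le> j; r \<in> R i j\<rbrakk> \<Longrightarrow> r \<otimes>\<^bsub>A\<^esub> u j = r"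

definition diagonal_algebra ::
  "('k, 'a) module \<Rightarrow> ('p \<Rightarrow> 'p \<Rightarrow> 'a set) \<Rightarrow> ('p \<Rightarrow> 'a) \<Rightarrow> 'p \<Rightarrow> ('k, 'a) module"
where
  "diagonal_algebra A R u i = A\<lparr>carrier := R i i, one := u i\<rparr>"

locale admissible_system = multiplicative_system K A R u
  for K :: "'k ring" (structure) and A :: "('k, 'a) module" (structure)
    and R :: "'p::{finite, order} \<Rightarrow> 'p \<Rightarrow> 'a set" and u :: "'p \<Rightarrow> 'a" and m :: 'p +
  assumes greatest: "i \<le> m"
    and division: "division_ring (diagonal_algebra A R u i)"
    and extend: "\<lbrakk>i \<le> j; j < m; x \<in> R i j; x \<noteq> \<zero>\<^bsub>A\<^esub>\<rbrakk>
      \<Longrightarrow> \<exists>l y. j \<le> l \<and> l \<noteq> j \<and> y \<in> R j l \<and> x \<otimes>\<^bsub>A\<^esub> y \<noteq> \<zero>\<^bsub>A\<^esub>"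

definition matrix_unit :: "('k, 'a) module \<Rightarrow> 'p \<Rightarrow> 'p \<Rightarrow> 'a \<Rightarrow> ('p \<Rightarrow> 'p \<Rightarrow> 'a)" where
  "matrix_unit A i j r = (\<lambda>k l. if k = i \<and> l = j then r else \<zero>\<^bsub>A\<^esub>)"

definition Lambda ::
  "('k, 'a) module \<Rightarrow> ('p::{finite, order} \<Rightarrow> 'p \<Rightarrow> 'a set) \<Rightarrow> ('p \<Rightarrow> 'a)
    \<Rightarrow> ('k, 'p \<Rightarrow> 'p \<Rightarrow> 'a) module"
where
  "Lambda A R u = \<lparr>carrier = {x. \<forall>i j. x i j \<in> (if i \<le> j then R i j else {\<zero>\<^bsub>A\<^esub>})},
     mult = (\<lambda>x y i l. \<Oplus>\<^bsub>A\<^esub>j\<in>UNIV. x i j \<otimes>\<^bsub>A\<^esub> y j l),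
     one = (\<lambda>i j. if i = j then u i else \<zero>\<^bsub>A\<^esub>),
     zero = (\<lambda>i j. \<zero>\<^bsub>A\<^esub>),
     add = (\<lambda>x y i j. x i j \<oplus>\<^bsub>A\<^esub> y i j),
     smult = (\<lambda>c x i j. c \<odot>\<^bsub>A\<^esub> x i j)\<rparr>"

definition idem ::
  "('k, 'a) module \<Rightarrow> ('p \<Rightarrow> 'a) \<Rightarrow> 'p \<Rightarrow> ('p \<Rightarrow> 'p \<Rightarrow> 'a)"
where
  "idem A u i = matrix_unit A i i (u i)"

text \<open>
  The right module \<open>e\<^sub>i \<Lambda>\<close>, and the \<open>K\<close>-space underlying the left module \<open>\<Lambda> e\<^sub>i\<close>.
\<close>

definition idem_Lambda ::
  "('k, 'a) module \<Rightarrow> ('p::{finite, order} \<Rightarrow> 'p \<Rightarrow> 'a set) \<Rightarrow> ('p \<Rightarrow> 'a) \<Rightarrow> 'p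
    \<Rightarrow> ('p \<Rightarrow> 'p \<Rightarrow> 'a, 'p \<Rightarrow> 'p \<Rightarrow> 'a) module"
where
  "idem_Lambda A R u i = (regular_module (opposite (Lambda A R u)))
     \<lparr>carrier := (\<lambda>x. idem A u i \<otimes>\<^bsub>Lambda A R u\<^esub> x) ` carrier (Lambda A R u)\<rparr>"

definition Lambda_idem ::
  "('k, 'a) module \<Rightarrow> ('p::{finite, order} \<Rightarrow> 'p \<Rightarrow> 'a set) \<Rightarrow> ('p \<Rightarrow> 'a) \<Rightarrow> 'p
    \<Rightarrow> ('k, 'p \<Rightarrow> 'p \<Rightarrow> 'a) module"
where
  "Lambda_idem A R u i = (Lambda A R u)
     \<lparr>carrier := (\<lambda>x. x \<otimes>\<^bsub>Lambda A R u\<^esub> idem A u i) ` carrier (Lambda A R u)\<rparr>"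

definition E_space ::
  "'k ring \<Rightarrow> ('k, 'a) module \<Rightarrow> ('p::{finite, order} \<Rightarrow> 'p \<Rightarrow> 'a set) \<Rightarrow> ('p \<Rightarrow> 'a) \<Rightarrow> 'p
    \<Rightarrow> ('k, ('p \<Rightarrow> 'p \<Rightarrow> 'a) \<Rightarrow> 'k) module"
where
  "E_space K A R u m = dual_space K (Lambda_idem A R u m)"

text \<open>
  The left action is dual to right multiplication on \<open>\<Lambda> e\<^sub>m\<close>, where \<open>r\<close> in \<open>R m m\<close> is identified with
  the element of \<open>e\<^sub>m \<Lambda> e\<^sub>m\<close> whose only nonzero entry is \<open>r\<close>. The right action is dual to left
  multiplication.
\<close>

definition E_left_action ::
  "('k, 'a) module \<Rightarrow> ('p::{finite, order} \<Rightarrow> 'p \<Rightarrow> 'a set) \<Rightarrow> ('p \<Rightarrow> 'a) \<Rightarrow> 'p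
    \<Rightarrow> 'a \<Rightarrow> (('p \<Rightarrow> 'p \<Rightarrow> 'a) \<Rightarrow> 'k) \<Rightarrow> (('p \<Rightarrow> 'p \<Rightarrow> 'a) \<Rightarrow> 'k)"
where
  "E_left_action A R u m r f =
     (\<lambda>x\<in>carrier (Lambda_idem A R u m). f (x \<otimes>\<^bsub>Lambda A R u\<^esub> matrix_unit A m m r))"

definition E_right_action ::
  "('k, 'a) module \<Rightarrow> ('p::{finite, order} \<Rightarrow> 'p \<Rightarrow> 'a set) \<Rightarrow> ('p \<Rightarrow> 'a) \<Rightarrow> 'p
    \<Rightarrow> (('p \<Rightarrow> 'p \<Rightarrow> 'a) \<Rightarrow> 'k) \<Rightarrow> ('p \<Rightarrow> 'p \<Rightarrow> 'a) \<Rightarrow> (('p \<Rightarrow> 'p \<Rightarrow> 'a) \<Rightarrow> 'k)"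
where
  "E_right_action A R u m f a =
     (\<lambda>x\<in>carrier (Lambda_idem A R u m). f (a \<otimes>\<^bsub>Lambda A R u\<^esub> x))"

definition E_right_module ::
  "'k ring \<Rightarrow> ('k, 'a) module \<Rightarrow> ('p::{finite, order} \<Rightarrow> 'p \<Rightarrow> 'a set) \<Rightarrow> ('p \<Rightarrow> 'a) \<Rightarrow> 'p
    \<Rightarrow> ('p \<Rightarrow> 'p \<Rightarrow> 'a, ('p \<Rightarrow> 'p \<Rightarrow> 'a) \<Rightarrow> 'k) module"
where
  "E_right_module K A R u m =
     with_scalars (E_space K A R u m) (\<lambda>a f. E_right_action A R u m f a)"

definition Lambda_tilde ::
  "'k ring \<Rightarrow> ('k, 'a) module \<Rightarrow> ('p::{finite, order} \<Rightarrow> 'p \<Rightarrow> 'a set) \<Rightarrow> ('p \<Rightarrow> 'a) \<Rightarrow> 'p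
    \<Rightarrow> ('k, 'a \<times> (('p \<Rightarrow> 'p \<Rightarrow> 'a) \<Rightarrow> 'k) \<times> ('p \<Rightarrow> 'p \<Rightarrow> 'a)) module"
where
  "Lambda_tilde K A R u m =
     triangular_algebra (diagonal_algebra A R u m) (E_space K A R u m) (Lambda A R u)
       (E_left_action A R u m) (E_right_action A R u m)"

end

theory Submission
  imports Defs
begin

text \<open>
  Both socles come from an idempotent \<open>e\<close> of a ring \<open>R\<close> such that \<open>R e = e R e\<close> is a division ring and
  every nonzero \<open>z\<close> has a nonzero multiple \<open>e w z\<close>. Each nonzero \<open>x\<close> in \<open>e R\<close> then generates a simple
  left ideal \<open>R x = (e R e) x\<close> and every nonzero left ideal meets \<open>e R\<close>, so the left socle is
  \<open>e R\<close>; a finite basis of \<open>e R\<close> over \<open>e R e\<close> identifies it with a power of the projective module \<open>R e\<close>.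
  For the left socle of the triangular algebra, \<open>e\<close> is the idempotent of the corner \<open>R m m\<close>;
  for the right one, \<open>e = e\<^sub>m\<close> in the opposite ring. The nonvanishing condition follows from (A.2), which
  yields by induction along the poset that no nonzero element of \<open>\<Lambda>\<close> annihilates \<open>\<Lambda> e\<^sub>m\<close>, and from the
  fact that functionals separate points.

  The module \<open>E\<close> is injective because \<open>Hom (M, E)\<close> is the dual of \<open>M e\<^sub>m\<close> and functionals extend from
  subspaces. The embedding of \<open>e\<^sub>m \<Lambda>\<close> sends \<open>r\<close> to \<open>x \<mapsto> t (r x\<^sub>m\<^sub>m)\<close> for a nonzero functional \<open>t\<close> on
  \<open>R m m\<close>.
\<close>

section \<open>Modules and dual spaces\<close>

text \<open>The two sides are not symmetric: (A.2) multiplies from the right only, and nothing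
  comparable is known about multiplication of \<Lambda> from the left. Adjoining \<open>E\<close>
  repairs this. A nonzero \<open>t\<close> in \<Lambda> has some \<open>t y\<close> nonzero in
  \<open>\<Lambda> e\<^sub>m\<close>, a functional detects \<open>t y\<close>, and so every nonzero
  matrix can be pushed into the first row \<open>(R m m, E, 0)\<close>, which becomes the left
  socle. The right socle consists of the matrices \<open>x e\<^sub>m\<close>. There the condition
  \<open>R e = e R e\<close> is due to \<open>m\<close> being greatest: row \<open>m\<close> of an
  element of \<Lambda> has a single entry, so \<open>e\<^sub>m \<Lambda>\<close> is a copy of
  \<open>R m m\<close>.

  Finite dimension is used without dimension counts, in the form of a finite set that lies in no
  proper submodule. It makes the socles finite powers, and it is decisive for essentiality of the
  embedding into \<open>E\<close>: a subspace of a dual space that separates points is the whole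
  dual in finite dimension, but can be proper otherwise.\<close>

lemma left_moduleI:
  fixes R (structure) and M (structure)
  assumes "ring R"
    and "\<And>x y. \<lbrakk>x \<in> carrier M; y \<in> carrier M\<rbrakk> \<Longrightarrow> x \<oplus>\<^bsub>M\<^esub> y \<in> carrier M"
    and "\<zero>\<^bsub>M\<^esub> \<in> carrier M"
    and "\<And>x y z. \<lbrakk>x \<in> carrier M; y \<in> carrier M; z \<in> carrier M\<rbrakk>
      \<Longrightarrow> (x \<oplus>\<^bsub>M\<^esub> y) \<oplus>\<^bsub>M\<^esub> z = x \<oplus>\<^bsub>M\<^esub> (y \<oplus>\<^bsub>M\<^esub> z)"
    and "\<And>x y. \<lbrakk>x \<in> carrier M; y \<in> carrier M\<rbrakk> \<Longrightarrow> x \<oplus>\<^bsub>M\<^esub> y = y \<oplus>\<^bsub>M\<^esub> x"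
    and "\<And>x. x \<in> carrier M \<Longrightarrow> \<zero>\<^bsub>M\<^esub> \<oplus>\<^bsub>M\<^esub> x = x"
    and "\<And>a x. \<lbrakk>a \<in> carrier R; x \<in> carrier M\<rbrakk> \<Longrightarrow> a \<odot>\<^bsub>M\<^esub> x \<in> carrier M"
    and "\<And>a b x. \<lbrakk>a \<in> carrier R; b \<in> carrier R; x \<in> carrier M\<rbrakk>
      \<Longrightarrow> (a \<oplus> b) \<odot>\<^bsub>M\<^esub> x = a \<odot>\<^bsub>M\<^esub> x \<oplus>\<^bsub>M\<^esub> b \<odot>\<^bsub>M\<^esub> x"
    and "\<And>a x y. \<lbrakk>a \<in> carrier R; x \<in> carrier M; y \<in> carrier M\<rbrakk>
      \<Longrightarrow> a \<odot>\<^bsub>M\<^esub> (x \<oplus>\<^bsub>M\<^esub> y) = a \<odot>\<^bsub>M\<^esub> x \<oplus>\<^bsub>M\<^esub> a \<odot>\<^bsub>M\<^esub> y"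
    and "\<And>a b x. \<lbrakk>a \<in> carrier R; b \<in> carrier R; x \<in> carrier M\<rbrakk>
      \<Longrightarrow> (a \<otimes> b) \<odot>\<^bsub>M\<^esub> x = a \<odot>\<^bsub>M\<^esub> (b \<odot>\<^bsub>M\<^esub> x)"
    and "\<And>x. x \<in> carrier M \<Longrightarrow> \<one> \<odot>\<^bsub>M\<^esub> x = x"
    and "\<And>x. x \<in> carrier M \<Longrightarrow> \<zero> \<odot>\<^bsub>M\<^esub> x = \<zero>\<^bsub>M\<^esub>"
  shows "left_module R M"
proof -
  interpret ring R by fact
  have "abelian_group M"
  proof (rule abelian_groupI)
    fix x assume x: "x \<in> carrier M"
    \<comment> \<open>The additive inverse of \<open>x\<close> is \<open>(-1) x\<close>. That is why
      the rule asks for \<open>0 x = 0\<close> and not for inverses.\<close>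
    have "(\<ominus> \<one>) \<odot>\<^bsub>M\<^esub> x \<oplus>\<^bsub>M\<^esub> x = (\<ominus> \<one> \<oplus> \<one>) \<odot>\<^bsub>M\<^esub> x"
      using assms(8)[of "\<ominus> \<one>" \<one> x] assms(11) x by simp
    then have "(\<ominus> \<one>) \<odot>\<^bsub>M\<^esub> x \<oplus>\<^bsub>M\<^esub> x = \<zero>\<^bsub>M\<^esub>"
      using assms(12) x by (simp add: l_neg)
    then show "\<exists>y\<in>carrier M. y \<oplus>\<^bsub>M\<^esub> x = \<zero>\<^bsub>M\<^esub>"
      using assms(7) x by blast
  qed (use assms in auto)
  then show ?thesis
    using assms by (intro left_module.intro left_module_axioms.intro) auto
qed

lemma (in abelian_group) minus_eq_zero_iff:
  assumes "x \<in> carrier G" "y \<in> carrier G"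
  shows "x \<ominus> y = \<zero> \<longleftrightarrow> x = y"
  using assms minus_equality[of x "\<ominus> y"] by (auto simp: a_minus_def r_neg)

lemma (in abelian_group) minus_minus_cancel:
  assumes "x \<in> carrier G" "a \<in> carrier G" "b \<in> carrier G"
  shows "(x \<ominus> b) \<ominus> (x \<ominus> a) = a \<ominus> b"
proof -
  have "(x \<ominus> b) \<ominus> (x \<ominus> a) = (x \<oplus> \<ominus> x) \<oplus> (a \<oplus> \<ominus> b)"
    using assms by (simp add: a_minus_def minus_add a_ac)
  then show ?thesis
    using assms by (simp add: a_minus_def r_neg)
qed

lemma (in abelian_group) minus_eq_minus_of_add_eq:
  assumes "x \<in> carrier G" "x' \<in> carrier G" "y \<in> carrier G" "y' \<in> carrier G" "y \<oplus> x = y' \<oplus> x'"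
  shows "x \<ominus> x' = y' \<ominus> y"
proof -
  have "x \<ominus> x' = \<ominus> y \<oplus> (y' \<oplus> x') \<ominus> x'"
    using assms r_neg1[of y x] by simp
  also have "\<dots> = (y' \<oplus> \<ominus> y) \<oplus> (x' \<oplus> \<ominus> x')"
    using assms(1-4) by (simp add: a_minus_def a_ac)
  finally show ?thesis using assms(1-4) by (simp add: a_minus_def r_neg)
qed

context left_module
begin

lemma smult_l_null [simp]:
  assumes "x \<in> carrier M" shows "\<zero> \<odot>\<^bsub>M\<^esub> x = \<zero>\<^bsub>M\<^esub>"
proof -
  have "\<zero> \<odot>\<^bsub>M\<^esub> x \<oplus>\<^bsub>M\<^esub> \<zero> \<odot>\<^bsub>M\<^esub> x = \<zero> \<odot>\<^bsub>M\<^esub> x"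
    using smult_l_distr[of \<zero> \<zero> x] assms by simp
  then show ?thesis
    using M.add.r_cancel_one smult_closed assms by blast
qed

lemma smult_r_null [simp]:
  assumes "a \<in> carrier R" shows "a \<odot>\<^bsub>M\<^esub> \<zero>\<^bsub>M\<^esub> = \<zero>\<^bsub>M\<^esub>"
proof -
  have "a \<odot>\<^bsub>M\<^esub> \<zero>\<^bsub>M\<^esub> \<oplus>\<^bsub>M\<^esub> a \<odot>\<^bsub>M\<^esub> \<zero>\<^bsub>M\<^esub> = a \<odot>\<^bsub>M\<^esub> \<zero>\<^bsub>M\<^esub>"
    using smult_r_distr[of a "\<zero>\<^bsub>M\<^esub>" "\<zero>\<^bsub>M\<^esub>"] assms by simp
  then show ?thesis
    using M.add.r_cancel_one smult_closed assms by blast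
qed

lemma a_inv_zero [simp]: "\<ominus>\<^bsub>M\<^esub> \<zero>\<^bsub>M\<^esub> = \<zero>\<^bsub>M\<^esub>"
  using M.minus_equality[of "\<zero>\<^bsub>M\<^esub>" "\<zero>\<^bsub>M\<^esub>"] by simp

lemma smult_l_minus:
  assumes "a \<in> carrier R" "x \<in> carrier M" shows "(\<ominus> a) \<odot>\<^bsub>M\<^esub> x = \<ominus>\<^bsub>M\<^esub> (a \<odot>\<^bsub>M\<^esub> x)"
proof -
  have "(\<ominus> a) \<odot>\<^bsub>M\<^esub> x \<oplus>\<^bsub>M\<^esub> a \<odot>\<^bsub>M\<^esub> x = \<zero>\<^bsub>M\<^esub>"
    using smult_l_distr[of "\<ominus> a" a x] assms by (simp add: R.l_neg)
  then show ?thesis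
    using M.minus_equality smult_closed assms by auto
qed

lemma smult_r_minus:
  assumes "a \<in> carrier R" "x \<in> carrier M" shows "a \<odot>\<^bsub>M\<^esub> (\<ominus>\<^bsub>M\<^esub> x) = \<ominus>\<^bsub>M\<^esub> (a \<odot>\<^bsub>M\<^esub> x)"
proof -
  have "a \<odot>\<^bsub>M\<^esub> (\<ominus>\<^bsub>M\<^esub> x) \<oplus>\<^bsub>M\<^esub> a \<odot>\<^bsub>M\<^esub> x = \<zero>\<^bsub>M\<^esub>"
    using smult_r_distr[of a "\<ominus>\<^bsub>M\<^esub> x" x] assms by (simp add: M.l_neg)
  then show ?thesis
    using M.minus_equality smult_closed assms by auto
qed

text \<open>Closure under negation, which \<open>submodule\<close> demands through
  \<open>subgroup\<close>, comes from the scalar -1.\<close>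

lemma submodule_iff:
  "submodule N R M \<longleftrightarrow> N \<subseteq> carrier M \<and> \<zero>\<^bsub>M\<^esub> \<in> N \<and> (\<forall>x\<in>N. \<forall>y\<in>N. x \<oplus>\<^bsub>M\<^esub> y \<in> N) \<and>
     (\<forall>a\<in>carrier R. \<forall>x\<in>N. a \<odot>\<^bsub>M\<^esub> x \<in> N)" (is "_ = ?r")
proof
  assume N: "submodule N R M"
  interpret submodule N R M by fact
  show ?r
    using subset one_closed m_closed smult_closed by auto
next
  assume r: ?r
  have "(\<ominus> \<one>) \<odot>\<^bsub>M\<^esub> x = inv\<^bsub>add_monoid M\<^esub> x" if "x \<in> N" for x
    using that r smult_l_minus[of \<one> x] smult_one[of x] by (auto simp: a_inv_def)
  then have "inv\<^bsub>add_monoid M\<^esub> x \<in> N" if "x \<in> N" for x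
    using that r by (metis R.a_inv_closed R.one_closed)
  then show "submodule N R M"
    using r by (intro submodule.intro subgroup.intro submodule_axioms.intro) auto
qed

lemma submoduleD:
  assumes "submodule N R M"
  shows "x \<in> N \<Longrightarrow> x \<in> carrier M" "\<zero>\<^bsub>M\<^esub> \<in> N" "\<lbrakk>x \<in> N; y \<in> N\<rbrakk> \<Longrightarrow> x \<oplus>\<^bsub>M\<^esub> y \<in> N"
    "\<lbrakk>a \<in> carrier R; x \<in> N\<rbrakk> \<Longrightarrow> a \<odot>\<^bsub>M\<^esub> x \<in> N" "x \<in> N \<Longrightarrow> \<ominus>\<^bsub>M\<^esub> x \<in> N"
    "\<lbrakk>x \<in> N; y \<in> N\<rbrakk> \<Longrightarrow> x \<ominus>\<^bsub>M\<^esub> y \<in> N"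
proof -
  note r = assms[unfolded submodule_iff]
  show *: "\<ominus>\<^bsub>M\<^esub> x \<in> N" if "x \<in> N" for x
    using that r smult_l_minus[of \<one> x] smult_one[of x] R.a_inv_closed[OF R.one_closed]
    by (metis R.one_closed subsetD)
  show "x \<in> N \<Longrightarrow> x \<in> carrier M" "\<zero>\<^bsub>M\<^esub> \<in> N" "\<lbrakk>x \<in> N; y \<in> N\<rbrakk> \<Longrightarrow> x \<oplus>\<^bsub>M\<^esub> y \<in> N"
    "\<lbrakk>a \<in> carrier R; x \<in> N\<rbrakk> \<Longrightarrow> a \<odot>\<^bsub>M\<^esub> x \<in> N" "\<lbrakk>x \<in> N; y \<in> N\<rbrakk> \<Longrightarrow> x \<ominus>\<^bsub>M\<^esub> y \<in> N"
    using r * by (auto simp: a_minus_def)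
qed

lemma left_module_submodule:
  assumes "submodule N R M" shows "left_module R (M\<lparr>carrier := N\<rparr>)"
proof (rule left_moduleI)
  show "ring R" by (rule R.ring_axioms)
qed (use submoduleD[OF assms] in \<open>auto simp: M.a_ac smult_l_distr smult_r_distr
       smult_assoc smult_one\<close>)

lemma left_module_cong:
  assumes "carrier M' = carrier M" "add M' = add M" "zero M' = zero M" "smult M' = smult M"
  shows "left_module R M'"
  by (rule left_moduleI)
    (simp_all add: assms R.ring_axioms M.a_ac smult_closed smult_l_distr smult_r_distr smult_assoc smult_one)

lemma submodule_submodule_iff:
  assumes "submodule N R M"
  shows "submodule L R (M\<lparr>carrier := N\<rparr>) \<longleftrightarrow> submodule L R M \<and> L \<subseteq> N"
  using left_module.submodule_iff[OF left_module_submodule[OF assms]] submoduleD(1)[OF assms]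
  unfolding submodule_iff by (simp add: subset_iff) blast

lemma submodule_carrier: "submodule (carrier M) R M"
  by (auto simp: submodule_iff smult_closed)

lemma linear_mapsD:
  assumes "h \<in> linear_maps R M N" "left_module R N"
  shows "x \<in> carrier M \<Longrightarrow> h x \<in> carrier N"
    "\<lbrakk>x \<in> carrier M; y \<in> carrier M\<rbrakk> \<Longrightarrow> h (x \<oplus>\<^bsub>M\<^esub> y) = h x \<oplus>\<^bsub>N\<^esub> h y"
    "\<lbrakk>a \<in> carrier R; x \<in> carrier M\<rbrakk> \<Longrightarrow> h (a \<odot>\<^bsub>M\<^esub> x) = a \<odot>\<^bsub>N\<^esub> h x"
    "h \<zero>\<^bsub>M\<^esub> = \<zero>\<^bsub>N\<^esub>" "x \<in> carrier M \<Longrightarrow> h (\<ominus>\<^bsub>M\<^esub> x) = \<ominus>\<^bsub>N\<^esub> h x"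
    "\<lbrakk>x \<in> carrier M; y \<in> carrier M\<rbrakk> \<Longrightarrow> h (x \<ominus>\<^bsub>M\<^esub> y) = h x \<ominus>\<^bsub>N\<^esub> h y"
proof -
  interpret N: left_module R N by fact
  have h: "h x \<in> carrier N" "y \<in> carrier M \<Longrightarrow> h (x \<oplus>\<^bsub>M\<^esub> y) = h x \<oplus>\<^bsub>N\<^esub> h y"
    "a \<in> carrier R \<Longrightarrow> h (a \<odot>\<^bsub>M\<^esub> x) = a \<odot>\<^bsub>N\<^esub> h x" if "x \<in> carrier M" for x y a
    using assms(1) that by (auto simp: linear_maps_def)
  have "h (\<zero> \<odot>\<^bsub>M\<^esub> \<zero>\<^bsub>M\<^esub>) = \<zero> \<odot>\<^bsub>N\<^esub> h \<zero>\<^bsub>M\<^esub>"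
    using h by blast
  then show 0: "h \<zero>\<^bsub>M\<^esub> = \<zero>\<^bsub>N\<^esub>"
    using h by auto
  show m: "h (\<ominus>\<^bsub>M\<^esub> x) = \<ominus>\<^bsub>N\<^esub> h x" if "x \<in> carrier M" for x
    using h(2)[of "\<ominus>\<^bsub>M\<^esub> x" x] 0 that N.M.minus_equality[of "h (\<ominus>\<^bsub>M\<^esub> x)" "h x"] h(1)
    by (simp add: M.l_neg)
  show "\<lbrakk>x \<in> carrier M; y \<in> carrier M\<rbrakk> \<Longrightarrow> h (x \<ominus>\<^bsub>M\<^esub> y) = h x \<ominus>\<^bsub>N\<^esub> h y"
    using h(2)[of x "\<ominus>\<^bsub>M\<^esub> y"] m by (simp add: a_minus_def)
  show "x \<in> carrier M \<Longrightarrow> h x \<in> carrier N"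
    "\<lbrakk>x \<in> carrier M; y \<in> carrier M\<rbrakk> \<Longrightarrow> h (x \<oplus>\<^bsub>M\<^esub> y) = h x \<oplus>\<^bsub>N\<^esub> h y"
    "\<lbrakk>a \<in> carrier R; x \<in> carrier M\<rbrakk> \<Longrightarrow> h (a \<odot>\<^bsub>M\<^esub> x) = a \<odot>\<^bsub>N\<^esub> h x"
    using h by auto
qed

end

lemma linear_mapsI:
  assumes "\<And>x. x \<in> carrier M \<Longrightarrow> h x \<in> carrier N"
    and "\<And>x y. \<lbrakk>x \<in> carrier M; y \<in> carrier M\<rbrakk> \<Longrightarrow> h (x \<oplus>\<^bsub>M\<^esub> y) = h x \<oplus>\<^bsub>N\<^esub> h y"
    and "\<And>a x. \<lbrakk>a \<in> carrier R; x \<in> carrier M\<rbrakk> \<Longrightarrow> h (a \<odot>\<^bsub>M\<^esub> x) = a \<odot>\<^bsub>N\<^esub> h x"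
  shows "h \<in> linear_maps R M N"
  using assms by (auto simp: linear_maps_def)

lemma with_scalars_simps [simp]:
  "carrier (with_scalars M s) = carrier M" "add (with_scalars M s) = add M"
  "zero (with_scalars M s) = zero M" "smult (with_scalars M s) = s"
  by (auto simp: with_scalars_def)

lemma regular_module_simps [simp]:
  "carrier (regular_module R) = carrier R" "add (regular_module R) = add R"
  "zero (regular_module R) = zero R" "smult (regular_module R) = mult R"
  by (auto simp: regular_module_def)

text \<open>Records such as \<open>regular_module K\<close> and \<open>K\<close> share their
  additive group but are different terms, so negation and subtraction have to be carried from one to
  the other.\<close>

lemma a_inv_cong:
  assumes "carrier M = carrier N" "add M = add N" "zero M = zero N"
  shows "a_inv M = a_inv N" "a_minus M = a_minus N"
  using assms by (auto simp: a_inv_def a_minus_def m_inv_def fun_eq_iff)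

lemma (in ring) left_module_regular: "left_module R (regular_module R)"
  by (rule left_moduleI) (auto simp: ring_axioms a_ac l_distr r_distr m_assoc)

text \<open>Generation is phrased through submodules and not through linear combinations. One notion
  then serves for \<open>K\<close> and for noncommutative rings, and it moves along linear maps by
  taking preimages of submodules.\<close>

definition finitely_generated ::
  "('r, 'c) ring_scheme \<Rightarrow> ('r, 'm, 'd) module_scheme \<Rightarrow> bool"
where
  "finitely_generated R M \<longleftrightarrow> (\<exists>B. finite B \<and> B \<subseteq> carrier M \<and>
     (\<forall>N. submodule N R M \<and> B \<subseteq> N \<longrightarrow> N = carrier M))"

lemma finitely_generatedE:
  assumes "finitely_generated R M"
  obtains B where "finite B" "B \<subseteq> carrier M" "\<And>N. \<lbrakk>submodule N R M; B \<subseteq> N\<rbrakk> \<Longrightarrow> N = carrier M"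
  using assms unfolding finitely_generated_def by (elim exE conjE) simp

lemma (in left_module) submodule_finsum:
  assumes "submodule N R M" "finite B" "f \<in> B \<rightarrow> N"
  shows "finsum M f B \<in> N"
  using assms(2,3)
proof (induction B)
  case (insert b B)
  then show ?case
    using submoduleD(1,3)[OF assms(1)] by (subst M.finsum_insert) (auto simp: Pi_iff)
qed (use submoduleD[OF assms(1)] in auto)

lemma finite_dimensional_imp_finitely_generated:
  assumes "left_module K M" "finite_dimensional K M"
  shows "finitely_generated K M"
proof -
  interpret left_module K M by fact
  obtain B where B: "finite B" "B \<subseteq> carrier M"
    and *: "\<And>x. x \<in> carrier M \<Longrightarrow> \<exists>c\<in>B \<rightarrow> carrier K. x = (\<Oplus>\<^bsub>M\<^esub>b\<in>B. c b \<odot>\<^bsub>M\<^esub> b)"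
    using assms(2) by (auto simp: finite_dimensional_def)
  have "x \<in> N" if N: "submodule N K M" "B \<subseteq> N" and x: "x \<in> carrier M" for N x
  proof -
    obtain c where c: "c \<in> B \<rightarrow> carrier K" and x: "x = (\<Oplus>\<^bsub>M\<^esub>b\<in>B. c b \<odot>\<^bsub>M\<^esub> b)"
      using *[OF x] by blast
    show ?thesis unfolding x
      by (rule submodule_finsum[OF N(1) B(1)]) (use c N submoduleD(4)[OF N(1)] in \<open>auto simp: Pi_iff subset_iff\<close>)
  qed
  then have "N = carrier M" if "submodule N K M" "B \<subseteq> N" for N
    using that submoduleD(1)[OF that(1)] by blast
  then show ?thesis
    using B unfolding finitely_generated_def by (intro exI[of _ B]) simp
qed

text \<open>Generation is transported this way: a submodule of the target that contains the images
  of generators has a preimage that contains the generators, hence everything. Both surjective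
  images and the three blocks of a triangular algebra are treated so.\<close>

lemma (in left_module) submodule_vimage:
  assumes "left_module R M'" "h \<in> linear_maps R M M'" "submodule N R M'"
  shows "submodule {x \<in> carrier M. h x \<in> N} R M"
  using linear_mapsD[OF assms(2,1)] left_module.submoduleD[OF assms(1,3)]
  by (auto simp: submodule_iff smult_closed)

lemma finitely_generated_image:
  assumes "left_module R M" "left_module R M'" "h \<in> linear_maps R M M'"
    and "carrier M' \<subseteq> h ` carrier M" "finitely_generated R M"
  shows "finitely_generated R M'"
proof -
  interpret left_module R M by fact
  interpret M': left_module R M' by fact
  obtain B where B: "finite B" "B \<subseteq> carrier M"
    and *: "\<And>N. \<lbrakk>submodule N R M; B \<subseteq> N\<rbrakk> \<Longrightarrow> N = carrier M"
    by (rule finitely_generatedE[OF assms(5)]) (rule that)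
  have "N = carrier M'" if N: "submodule N R M'" "h ` B \<subseteq> N" for N
  proof -
    have "{x \<in> carrier M. h x \<in> N} = carrier M"
      by (rule *[OF submodule_vimage[OF assms(2,3) N(1)]]) (use B N in auto)
    then show ?thesis
      using assms(4) M'.submoduleD(1)[OF N(1)] by blast
  qed
  moreover have "h ` B \<subseteq> carrier M'"
    using B linear_mapsD(1)[OF assms(3,2)] by blast
  ultimately show ?thesis
    using B(1) unfolding finitely_generated_def by (intro exI[of _ "h ` B"]) simp
qed

section \<open>Functionals on a vector space and its dual\<close>

locale vector_space_over = left_module K V + K: field K
  for K :: "'k ring" (structure) and V :: "('k, 'v) module" (structure)
begin

lemma left_module_K: "left_module K (regular_module K)"
  by (rule R.left_module_regular)

lemmas functionalD = linear_mapsD[OF _ left_module_K, simplified]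

lemma smult_cancel_mem:
  assumes "submodule N K V" "c \<in> carrier K" "c \<noteq> \<zero>\<^bsub>K\<^esub>" "x \<in> carrier V" "c \<odot>\<^bsub>V\<^esub> x \<in> N"
  shows "x \<in> N"
proof -
  have "inv\<^bsub>K\<^esub> c \<in> carrier K" "inv\<^bsub>K\<^esub> c \<otimes>\<^bsub>K\<^esub> c = \<one>\<^bsub>K\<^esub>"
    using assms K.field_Units by auto
  then show ?thesis
    using submoduleD(4)[OF assms(1) _ assms(5), of "inv\<^bsub>K\<^esub> c"] assms
    by (simp add: smult_assoc[symmetric] smult_one)
qed

text \<open>A functional \<open>\<phi>\<close> with \<open>\<phi> x\<^sub>0 = \<one>\<close> is extended by making its kernel maximal among the subspaces
  that avoid \<open>x\<^sub>0\<close>; this is a complement of the line through \<open>x\<^sub>0\<close>.\<close>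

lemma functional_extension:
  assumes N: "submodule N K V" and \<phi>: "\<phi> \<in> linear_maps K (V\<lparr>carrier := N\<rparr>) (regular_module K)"
  shows "\<exists>\<psi>\<in>linear_maps K V (regular_module K). \<forall>x\<in>N. \<psi> x = \<phi> x"
proof (cases "\<forall>x\<in>N. \<phi> x = \<zero>\<^bsub>K\<^esub>")
  case True
  have "(\<lambda>x. \<zero>\<^bsub>K\<^esub>) \<in> linear_maps K V (regular_module K)"
    by (rule linear_mapsI) auto
  with True show ?thesis by (intro bexI[where x = "\<lambda>x. \<zero>\<^bsub>K\<^esub>"]) auto
next
  case False
  note ND = submoduleD[OF N]
  interpret N: vector_space_over K "V\<lparr>carrier := N\<rparr>"
    by (intro vector_space_over.intro left_module_submodule N K.field_axioms)
  note \<phi>D = N.functionalD[OF \<phi>, simplified]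
  obtain y where y: "y \<in> N" "\<phi> y \<noteq> \<zero>\<^bsub>K\<^esub>" using False by auto
  define x0 where "x0 = inv\<^bsub>K\<^esub> (\<phi> y) \<odot>\<^bsub>V\<^esub> y"
  have iy: "inv\<^bsub>K\<^esub> (\<phi> y) \<in> carrier K" "inv\<^bsub>K\<^esub> (\<phi> y) \<otimes>\<^bsub>K\<^esub> \<phi> y = \<one>\<^bsub>K\<^esub>"
    using y \<phi>D(1) K.field_Units by auto
  have x0: "x0 \<in> N" "\<phi> x0 = \<one>\<^bsub>K\<^esub>"
    using iy y ND \<phi>D unfolding x0_def by auto
  have x0V: "x0 \<in> carrier V" using x0 ND by auto
  define Z where "Z = {x \<in> N. \<phi> x = \<zero>\<^bsub>K\<^esub>}"
  have Z: "submodule Z K V"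
    using ND \<phi>D unfolding Z_def submodule_iff by auto
  let ?A = "{W. submodule W K V \<and> Z \<subseteq> W \<and> x0 \<notin> W}"
  have "\<exists>W\<in>?A. \<forall>X\<in>?A. W \<subseteq> X \<longrightarrow> X = W"
  proof (rule subset_Zorn_nonempty)
    have "Z \<in> ?A" using Z x0(2) by (simp add: Z_def)
    then show "?A \<noteq> {}" by blast
    fix C assume C: "C \<noteq> {}" "subset.chain ?A C"
    then have sub: "\<And>W. W \<in> C \<Longrightarrow> submodule W K V" "\<And>W. W \<in> C \<Longrightarrow> Z \<subseteq> W" "\<And>W. W \<in> C \<Longrightarrow> x0 \<notin> W"
      and ch: "\<And>W W'. \<lbrakk>W \<in> C; W' \<in> C\<rbrakk> \<Longrightarrow> W \<subseteq> W' \<or> W' \<subseteq> W"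
      by (auto simp: subset_chain_def)
    have "x \<oplus>\<^bsub>V\<^esub> y \<in> \<Union>C" if "x \<in> \<Union>C" "y \<in> \<Union>C" for x y
    proof -
      obtain W W' where W: "W \<in> C" "W' \<in> C" "x \<in> W" "y \<in> W'" using \<open>x \<in> \<Union>C\<close> \<open>y \<in> \<Union>C\<close> by blast
      then have "x \<in> W \<and> y \<in> W \<or> x \<in> W' \<and> y \<in> W'" using ch[of W W'] by auto
      then show ?thesis using W submoduleD(3)[OF sub(1)] by blast
    qed
    moreover have "\<zero>\<^bsub>V\<^esub> \<in> \<Union>C" using C submoduleD(2)[OF sub(1)] by blast
    moreover have "a \<odot>\<^bsub>V\<^esub> x \<in> \<Union>C" if "a \<in> carrier K" "x \<in> \<Union>C" for a x
      using that submoduleD(4)[OF sub(1)] by blast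
    moreover have "\<Union>C \<subseteq> carrier V" using submoduleD(1)[OF sub(1)] by blast
    ultimately have "submodule (\<Union>C) K V" unfolding submodule_iff by blast
    then show "\<Union>C \<in> ?A" using sub C by blast
  qed
  then obtain W where WA: "W \<in> ?A" and mx: "\<forall>X\<in>?A. W \<subseteq> X \<longrightarrow> X = W"
    by (elim bexE)
  have W: "submodule W K V" "Z \<subseteq> W" "x0 \<notin> W"
    using WA by simp_all
  have max: "X = W" if "submodule X K V" "W \<subseteq> X" "x0 \<notin> X" for X
    using mx that W(2) by simp
  note WD = submoduleD[OF W(1)]
  \<comment> \<open>\<open>W\<close> and \<open>x0\<close> together span \<open>V\<close>. If
    \<open>x\<close> is not in \<open>W\<close>, then \<open>W + K x\<close> is strictly larger, so
    by maximality it contains \<open>x0\<close>; the resulting equation \<open>x0 = w + c x\<close>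
    has \<open>c\<close> nonzero and can be solved for \<open>x\<close>.\<close>
  have ex: "\<exists>c\<in>carrier K. x \<ominus>\<^bsub>V\<^esub> c \<odot>\<^bsub>V\<^esub> x0 \<in> W" if x: "x \<in> carrier V" for x
  proof (cases "x \<in> W")
    case True
    then show ?thesis
      using x x0V by (intro bexI[of _ "\<zero>\<^bsub>K\<^esub>"]) (auto simp: a_minus_def)
  next
    case False
    define X where "X = {w \<oplus>\<^bsub>V\<^esub> c \<odot>\<^bsub>V\<^esub> x | w c. w \<in> W \<and> c \<in> carrier K}"
    have XI: "w \<oplus>\<^bsub>V\<^esub> c \<odot>\<^bsub>V\<^esub> x \<in> X" if "w \<in> W" "c \<in> carrier K" for w c
      unfolding X_def using that by blast
    have XE: "\<exists>w c. p = w \<oplus>\<^bsub>V\<^esub> c \<odot>\<^bsub>V\<^esub> x \<and> w \<in> W \<and> c \<in> carrier K" if "p \<in> X" for p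
      using that unfolding X_def by blast
    have "submodule X K V"
      unfolding submodule_iff
    proof (intro conjI ballI)
      show "X \<subseteq> carrier V" using WD(1) x smult_closed by (auto simp: X_def)
      show "\<zero>\<^bsub>V\<^esub> \<in> X"
        using XI[of "\<zero>\<^bsub>V\<^esub>" "\<zero>\<^bsub>K\<^esub>"] WD(2) x by simp
      fix p assume "p \<in> X"
      then obtain w c where pw: "p = w \<oplus>\<^bsub>V\<^esub> c \<odot>\<^bsub>V\<^esub> x" "w \<in> W" "c \<in> carrier K"
        using XE by blast
      {
        fix q assume "q \<in> X"
        then obtain w' c' where q: "q = w' \<oplus>\<^bsub>V\<^esub> c' \<odot>\<^bsub>V\<^esub> x" "w' \<in> W" "c' \<in> carrier K"
          using XE by blast
        have "p \<oplus>\<^bsub>V\<^esub> q = (w \<oplus>\<^bsub>V\<^esub> w') \<oplus>\<^bsub>V\<^esub> (c \<oplus>\<^bsub>K\<^esub> c') \<odot>\<^bsub>V\<^esub> x"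
          using WD(1) x pw q smult_closed by (simp add: smult_l_distr M.a_ac)
        then show "p \<oplus>\<^bsub>V\<^esub> q \<in> X" using XI WD(3) pw q by simp
      }
      fix a assume a: "a \<in> carrier K"
      have "a \<odot>\<^bsub>V\<^esub> p = a \<odot>\<^bsub>V\<^esub> w \<oplus>\<^bsub>V\<^esub> (a \<otimes>\<^bsub>K\<^esub> c) \<odot>\<^bsub>V\<^esub> x"
        using WD(1) x pw a smult_closed by (simp add: smult_r_distr smult_assoc)
      then show "a \<odot>\<^bsub>V\<^esub> p \<in> X" using XI WD(4) pw a by simp
    qed
    moreover have "W \<subseteq> X"
    proof
      fix w assume "w \<in> W"
      then show "w \<in> X" using XI[of w "\<zero>\<^bsub>K\<^esub>"] WD(1) x by simp
    qed
    moreover have "x \<in> X"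
      using XI[of "\<zero>\<^bsub>V\<^esub>" "\<one>\<^bsub>K\<^esub>"] WD(2) x by (simp add: smult_one)
    ultimately have "x0 \<in> X" using max False by blast
    then obtain w c where wc: "x0 = w \<oplus>\<^bsub>V\<^esub> c \<odot>\<^bsub>V\<^esub> x" "w \<in> W" "c \<in> carrier K"
      using XE by blast
    have c0: "c \<noteq> \<zero>\<^bsub>K\<^esub>" using wc W x WD(1) by auto
    define d where "d = inv\<^bsub>K\<^esub> c"
    have d: "d \<in> carrier K" "d \<otimes>\<^bsub>K\<^esub> c = \<one>\<^bsub>K\<^esub>"
      using c0 wc K.field_Units unfolding d_def by auto
    have "d \<odot>\<^bsub>V\<^esub> x0 = d \<odot>\<^bsub>V\<^esub> w \<oplus>\<^bsub>V\<^esub> x"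
      using WD(1) x wc d smult_closed
      by (simp add: smult_r_distr smult_assoc[symmetric] smult_one)
    moreover have dw: "d \<odot>\<^bsub>V\<^esub> w \<in> W" "d \<odot>\<^bsub>V\<^esub> w \<in> carrier V"
      using WD(1,4) wc d by blast+
    moreover have "x \<oplus>\<^bsub>V\<^esub> (\<ominus>\<^bsub>V\<^esub> (d \<odot>\<^bsub>V\<^esub> w) \<oplus>\<^bsub>V\<^esub> \<ominus>\<^bsub>V\<^esub> x) = \<ominus>\<^bsub>V\<^esub> (d \<odot>\<^bsub>V\<^esub> w)"
      using dw x by (subst M.a_lcomm) (auto simp: M.r_neg)
    ultimately have "x \<ominus>\<^bsub>V\<^esub> d \<odot>\<^bsub>V\<^esub> x0 = \<ominus>\<^bsub>V\<^esub> (d \<odot>\<^bsub>V\<^esub> w)"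
      using x by (simp add: a_minus_def M.minus_add)
    then show ?thesis using WD(5)[OF dw(1)] d by (intro bexI[of _ d]) simp_all
  qed
  \<comment> \<open>Two different coefficients would put a nonzero multiple of \<open>x0\<close>,
    and therefore \<open>x0\<close> itself, into \<open>W\<close>.\<close>
  have uniq: "c = d" if "x \<in> carrier V" "c \<in> carrier K" "d \<in> carrier K"
    "x \<ominus>\<^bsub>V\<^esub> c \<odot>\<^bsub>V\<^esub> x0 \<in> W" "x \<ominus>\<^bsub>V\<^esub> d \<odot>\<^bsub>V\<^esub> x0 \<in> W" for x c d
  proof (rule ccontr)
    assume "c \<noteq> d"
    then have cd: "c \<ominus>\<^bsub>K\<^esub> d \<in> carrier K" "c \<ominus>\<^bsub>K\<^esub> d \<noteq> \<zero>\<^bsub>K\<^esub>"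
      using that by (auto simp: R.minus_eq_zero_iff)
    have "(c \<ominus>\<^bsub>K\<^esub> d) \<odot>\<^bsub>V\<^esub> x0 = (x \<ominus>\<^bsub>V\<^esub> d \<odot>\<^bsub>V\<^esub> x0) \<ominus>\<^bsub>V\<^esub> (x \<ominus>\<^bsub>V\<^esub> c \<odot>\<^bsub>V\<^esub> x0)"
      using M.minus_minus_cancel[of x "c \<odot>\<^bsub>V\<^esub> x0" "d \<odot>\<^bsub>V\<^esub> x0"] that x0V smult_closed
      by (simp add: a_minus_def smult_l_distr smult_l_minus)
    also have "\<dots> \<in> W" using that(4,5) WD(6) by blast
    finally show False using smult_cancel_mem[OF W(1) cd x0V] W(3) by blast
  qed
  define \<psi> where "\<psi> x = (THE c. c \<in> carrier K \<and> x \<ominus>\<^bsub>V\<^esub> c \<odot>\<^bsub>V\<^esub> x0 \<in> W)" for x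
  have \<psi>1: "\<psi> x = c" if "x \<in> carrier V" "c \<in> carrier K" "x \<ominus>\<^bsub>V\<^esub> c \<odot>\<^bsub>V\<^esub> x0 \<in> W" for x c
    unfolding \<psi>_def using that uniq[OF that(1)] by (intro the_equality) blast+
  have \<psi>2: "\<psi> x \<in> carrier K" "x \<ominus>\<^bsub>V\<^esub> \<psi> x \<odot>\<^bsub>V\<^esub> x0 \<in> W" if "x \<in> carrier V" for x
    using ex[OF that] \<psi>1[OF that] by metis+
  have "\<psi> \<in> linear_maps K V (regular_module K)"
  proof (rule linear_mapsI; simp)
    fix x assume x: "x \<in> carrier V"
    then show "\<psi> x \<in> carrier K" by (rule \<psi>2)
    {
      fix y assume y: "y \<in> carrier V"
      have "(x \<oplus>\<^bsub>V\<^esub> y) \<ominus>\<^bsub>V\<^esub> (\<psi> x \<oplus>\<^bsub>K\<^esub> \<psi> y) \<odot>\<^bsub>V\<^esub> x0 =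
        (x \<ominus>\<^bsub>V\<^esub> \<psi> x \<odot>\<^bsub>V\<^esub> x0) \<oplus>\<^bsub>V\<^esub> (y \<ominus>\<^bsub>V\<^esub> \<psi> y \<odot>\<^bsub>V\<^esub> x0)"
        using x y \<psi>2 x0V smult_closed
        by (simp add: a_minus_def smult_l_distr M.minus_add M.a_ac)
      then show "\<psi> (x \<oplus>\<^bsub>V\<^esub> y) = \<psi> x \<oplus>\<^bsub>K\<^esub> \<psi> y"
        using \<psi>1 \<psi>2 WD(3) x y by simp
    }
    fix a assume a: "a \<in> carrier K"
    have "a \<odot>\<^bsub>V\<^esub> x \<ominus>\<^bsub>V\<^esub> (a \<otimes>\<^bsub>K\<^esub> \<psi> x) \<odot>\<^bsub>V\<^esub> x0 = a \<odot>\<^bsub>V\<^esub> (x \<ominus>\<^bsub>V\<^esub> \<psi> x \<odot>\<^bsub>V\<^esub> x0)"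
      using x a \<psi>2 x0V smult_closed
      by (simp add: a_minus_def smult_r_distr smult_r_minus smult_assoc)
    then show "\<psi> (a \<odot>\<^bsub>V\<^esub> x) = a \<otimes>\<^bsub>K\<^esub> \<psi> x"
      using \<psi>1 \<psi>2 WD(4) x a smult_closed by simp
  qed
  \<comment> \<open>Since \<open>\<phi> x0 = 1\<close>, the vector \<open>x - (\<phi> x) x0\<close>
    lies in the kernel \<open>Z\<close> of \<phi>, which is contained in \<open>W\<close>; so
    \<open>\<phi> x\<close> is the coefficient that defines \<open>\<psi> x\<close>.\<close>
  moreover have "\<psi> x = \<phi> x" if x: "x \<in> N" for x
  proof -
    have "\<phi> (x \<oplus>\<^bsub>V\<^esub> (\<ominus>\<^bsub>K\<^esub> (\<phi> x)) \<odot>\<^bsub>V\<^esub> x0) = \<zero>\<^bsub>K\<^esub>"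
      using \<phi>D(1-3) x0 x ND by (simp add: R.r_neg)
    then have "x \<ominus>\<^bsub>V\<^esub> \<phi> x \<odot>\<^bsub>V\<^esub> x0 \<in> Z"
      using x x0 ND \<phi>D(1) x0V unfolding Z_def
      by (auto simp: a_minus_def smult_l_minus)
    then show ?thesis using \<psi>1 x ND(1) \<phi>D(1) W(2) by blast
  qed
  ultimately show ?thesis by blast
qed

abbreviation "D \<equiv> dual_space K V"

lemma dual_simps [simp]:
  "zero D = (\<lambda>x\<in>carrier V. \<zero>\<^bsub>K\<^esub>)" "add D f g = (\<lambda>x\<in>carrier V. f x \<oplus>\<^bsub>K\<^esub> g x)"
  "smult D c f = (\<lambda>x\<in>carrier V. c \<otimes>\<^bsub>K\<^esub> f x)"
  by (auto simp: dual_space_def)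

lemma dual_carrier: "carrier D = linear_maps K V (regular_module K) \<inter> extensional (carrier V)"
  by (simp add: dual_space_def)

lemma dualI:
  assumes "\<And>x. x \<in> carrier V \<Longrightarrow> h x \<in> carrier K"
    and "\<And>x y. \<lbrakk>x \<in> carrier V; y \<in> carrier V\<rbrakk> \<Longrightarrow> h (x \<oplus>\<^bsub>V\<^esub> y) = h x \<oplus>\<^bsub>K\<^esub> h y"
    and "\<And>a x. \<lbrakk>a \<in> carrier K; x \<in> carrier V\<rbrakk> \<Longrightarrow> h (a \<odot>\<^bsub>V\<^esub> x) = a \<otimes>\<^bsub>K\<^esub> h x"
  shows "(\<lambda>x\<in>carrier V. h x) \<in> carrier D"
  unfolding dual_carrier using assms by (auto intro!: linear_mapsI simp: smult_closed)

lemma dualD: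
  assumes "f \<in> carrier D"
  shows "x \<in> carrier V \<Longrightarrow> f x \<in> carrier K"
    "\<lbrakk>x \<in> carrier V; y \<in> carrier V\<rbrakk> \<Longrightarrow> f (x \<oplus>\<^bsub>V\<^esub> y) = f x \<oplus>\<^bsub>K\<^esub> f y"
    "\<lbrakk>a \<in> carrier K; x \<in> carrier V\<rbrakk> \<Longrightarrow> f (a \<odot>\<^bsub>V\<^esub> x) = a \<otimes>\<^bsub>K\<^esub> f x"
    "f \<zero>\<^bsub>V\<^esub> = \<zero>\<^bsub>K\<^esub>"
    "\<lbrakk>x \<in> carrier V; y \<in> carrier V\<rbrakk> \<Longrightarrow> f (x \<ominus>\<^bsub>V\<^esub> y) = f x \<ominus>\<^bsub>K\<^esub> f y"
  using functionalD[of f] assms a_inv_cong(2)[of "regular_module K" K] by (auto simp: dual_carrier)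

lemma dual_eqI:
  assumes "f \<in> carrier D" "g \<in> carrier D" "\<And>x. x \<in> carrier V \<Longrightarrow> f x = g x"
  shows "f = g"
  using assms by (auto simp: dual_carrier intro: extensionalityI)

lemma left_module_dual: "left_module K D"
proof (rule left_moduleI)
  show "ring K" by (rule R.ring_axioms)
  show "x \<oplus>\<^bsub>D\<^esub> y \<in> carrier D" if "x \<in> carrier D" "y \<in> carrier D" for x y
    unfolding dual_simps using dualD(1-3)[OF that(1)] dualD(1-3)[OF that(2)]
    by (intro dualI) (simp_all add: R.a_ac R.r_distr)
  show "\<zero>\<^bsub>D\<^esub> \<in> carrier D" unfolding dual_simps by (intro dualI) simp_all
  show "c \<odot>\<^bsub>D\<^esub> x \<in> carrier D" if "c \<in> carrier K" "x \<in> carrier D" for c x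
    unfolding dual_simps using dualD(1-3)[OF that(2)] that(1)
    by (intro dualI) (simp_all add: R.r_distr K.m_lcomm)
  show "\<one>\<^bsub>K\<^esub> \<odot>\<^bsub>D\<^esub> x = x" "\<zero>\<^bsub>D\<^esub> \<oplus>\<^bsub>D\<^esub> x = x" if "x \<in> carrier D" for x
    using dualD(1)[OF that] that by (auto simp: dual_carrier intro!: extensionalityI[of _ "carrier V"])
qed (simp_all add: dualD(1) R.a_ac R.l_distr R.r_distr R.m_assoc cong: restrict_cong)

interpretation dual: vector_space_over K D
  by (intro vector_space_over.intro left_module_dual K.field_axioms)

lemma dual_minus:
  assumes "f \<in> carrier D" "g \<in> carrier D" "x \<in> carrier V"
  shows "(f \<ominus>\<^bsub>D\<^esub> g) x = f x \<ominus>\<^bsub>K\<^esub> g x"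
proof -
  have "\<ominus>\<^bsub>D\<^esub> g = (\<ominus>\<^bsub>K\<^esub> \<one>\<^bsub>K\<^esub>) \<odot>\<^bsub>D\<^esub> g"
    using dual.smult_l_minus[of "\<one>\<^bsub>K\<^esub>" g] dual.smult_one assms by simp
  then show ?thesis
    using assms dualD(1) by (simp add: a_minus_def[of D] a_minus_def[of K] R.l_minus)
qed

text \<open>The transpose of an endomorphism. Both actions on \<open>E\<close> arise in this
  way.\<close>

lemma dual_comp:
  assumes "f \<in> carrier D" "h \<in> linear_maps K V V"
  shows "(\<lambda>x\<in>carrier V. f (h x)) \<in> carrier D"
  using dualD[OF assms(1)] linear_mapsD[OF assms(2) left_module_axioms]
  by (intro dualI) simp_all

text \<open>On the line through \<open>x\<close> the assignment \<open>c x \<mapsto> c\<close> is a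
  well-defined functional with value 1 at \<open>x\<close>; it extends to the whole space.\<close>

lemma dual_separates:
  assumes x: "x \<in> carrier V" "x \<noteq> \<zero>\<^bsub>V\<^esub>"
  shows "\<exists>f\<in>carrier D. f x \<noteq> \<zero>\<^bsub>K\<^esub>"
proof -
  define N where "N = (\<lambda>c. c \<odot>\<^bsub>V\<^esub> x) ` carrier K"
  have NI: "c \<odot>\<^bsub>V\<^esub> x \<in> N" if "c \<in> carrier K" for c
    using that by (simp add: N_def)
  have N: "submodule N K V"
    unfolding submodule_iff
  proof (intro conjI ballI)
    show "N \<subseteq> carrier V" using x smult_closed by (auto simp: N_def)
    show "\<zero>\<^bsub>V\<^esub> \<in> N" using NI[of "\<zero>\<^bsub>K\<^esub>"] x by simp
    fix p assume "p \<in> N"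
    then obtain c where p: "c \<in> carrier K" "p = c \<odot>\<^bsub>V\<^esub> x" by (auto simp: N_def)
    show "a \<odot>\<^bsub>V\<^esub> p \<in> N" if "a \<in> carrier K" for a
      using NI[of "a \<otimes>\<^bsub>K\<^esub> c"] that p x by (simp add: smult_assoc)
    fix q assume "q \<in> N"
    then obtain d where q: "d \<in> carrier K" "q = d \<odot>\<^bsub>V\<^esub> x" by (auto simp: N_def)
    show "p \<oplus>\<^bsub>V\<^esub> q \<in> N"
      using NI[of "c \<oplus>\<^bsub>K\<^esub> d"] p q x by (simp add: smult_l_distr)
  qed
  have inj: "c = d" if "c \<in> carrier K" "d \<in> carrier K" "c \<odot>\<^bsub>V\<^esub> x = d \<odot>\<^bsub>V\<^esub> x" for c d
  proof (rule ccontr)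
    assume "c \<noteq> d"
    then have cd: "c \<ominus>\<^bsub>K\<^esub> d \<in> carrier K" "c \<ominus>\<^bsub>K\<^esub> d \<noteq> \<zero>\<^bsub>K\<^esub>"
      using that by (auto simp: R.minus_eq_zero_iff)
    have "(c \<ominus>\<^bsub>K\<^esub> d) \<odot>\<^bsub>V\<^esub> x = \<zero>\<^bsub>V\<^esub>"
      using that x smult_closed by (simp add: a_minus_def smult_l_distr smult_l_minus M.r_neg)
    then have "x \<in> {\<zero>\<^bsub>V\<^esub>}"
      using smult_cancel_mem[of "{\<zero>\<^bsub>V\<^esub>}", OF _ cd x(1)] by (auto simp: submodule_iff)
    then show False using x by simp
  qed
  define \<phi> where "\<phi> y = (THE c. c \<in> carrier K \<and> y = c \<odot>\<^bsub>V\<^esub> x)" for y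
  have \<phi>: "\<phi> (c \<odot>\<^bsub>V\<^esub> x) = c" if "c \<in> carrier K" for c
    unfolding \<phi>_def using that inj by (intro the_equality) auto
  have "\<phi> \<in> linear_maps K (V\<lparr>carrier := N\<rparr>) (regular_module K)"
  proof (rule linear_mapsI; simp)
    fix p assume "p \<in> N"
    then obtain c where p: "c \<in> carrier K" "p = c \<odot>\<^bsub>V\<^esub> x" by (auto simp: N_def)
    show "\<phi> p \<in> carrier K" using p \<phi> by simp
    show "\<phi> (a \<odot>\<^bsub>V\<^esub> p) = a \<otimes>\<^bsub>K\<^esub> \<phi> p" if "a \<in> carrier K" for a
      using that p \<phi> \<phi>[of "a \<otimes>\<^bsub>K\<^esub> c"] x by (simp add: smult_assoc)
    fix q assume "q \<in> N"
    then obtain d where q: "d \<in> carrier K" "q = d \<odot>\<^bsub>V\<^esub> x" by (auto simp: N_def)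
    show "\<phi> (p \<oplus>\<^bsub>V\<^esub> q) = \<phi> p \<oplus>\<^bsub>K\<^esub> \<phi> q"
      using \<phi> \<phi>[of "c \<oplus>\<^bsub>K\<^esub> d"] p q x by (simp add: smult_l_distr)
  qed
  then obtain \<psi> where \<psi>: "\<psi> \<in> linear_maps K V (regular_module K)" "\<forall>y\<in>N. \<psi> y = \<phi> y"
    using functional_extension[OF N] by blast
  have "\<psi> x = \<one>\<^bsub>K\<^esub>"
    using \<psi>(2) NI[of "\<one>\<^bsub>K\<^esub>"] \<phi>[of "\<one>\<^bsub>K\<^esub>"] x by (simp add: smult_one)
  moreover have "(\<lambda>y\<in>carrier V. \<psi> y) \<in> carrier D"
    using functionalD[OF \<psi>(1)] by (intro dualI) auto
  ultimately show ?thesis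
    using x by (intro bexI[of _ "\<lambda>y\<in>carrier V. \<psi> y"]) auto
qed

text \<open>By the last clause the transpose of \<pi> sends every functional into the span of
  \<open>F\<close>. The span is written as the intersection of all subspaces that contain
  \<open>F\<close>, which is the form needed for \<open>finitely_generated\<close>. Idempotence is
  what allows a further vector to be added to \<open>B\<close>.\<close>

definition projects_with :: "'v set \<Rightarrow> ('v \<Rightarrow> 'k) set \<Rightarrow> ('v \<Rightarrow> 'v) \<Rightarrow> bool" where
  "projects_with B F \<pi> \<longleftrightarrow> \<pi> \<in> linear_maps K V V \<and> (\<forall>b\<in>B. \<pi> b = b) \<and>
     (\<forall>x\<in>carrier V. \<pi> (\<pi> x) = \<pi> x) \<and>
     (\<forall>W. submodule W K D \<longrightarrow> F \<subseteq> W \<longrightarrow> (\<forall>g\<in>carrier D. (\<lambda>x\<in>carrier V. g (\<pi> x)) \<in> W))"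

lemma projects_withD:
  assumes "projects_with B F \<pi>"
  shows "\<pi> \<in> linear_maps K V V" "b \<in> B \<Longrightarrow> \<pi> b = b" "x \<in> carrier V \<Longrightarrow> \<pi> (\<pi> x) = \<pi> x"
    "\<lbrakk>submodule W K D; F \<subseteq> W; g \<in> carrier D\<rbrakk> \<Longrightarrow> (\<lambda>x\<in>carrier V. g (\<pi> x)) \<in> W"
  using assms unfolding projects_with_def by blast+

text \<open>The projection onto the span of \<open>B\<close> is built by a Gram--Schmidt process that uses functionals
  from \<open>W\<close> only; \<open>F\<close> collects them.\<close>

lemma dual_projection:
  assumes W: "submodule W K D"
    and sep: "\<And>x. \<lbrakk>x \<in> carrier V; x \<noteq> \<zero>\<^bsub>V\<^esub>\<rbrakk> \<Longrightarrow> \<exists>w\<in>W. w x \<noteq> \<zero>\<^bsub>K\<^esub>"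
    and "finite B" "B \<subseteq> carrier V"
  shows "\<exists>\<pi> F. finite F \<and> F \<subseteq> W \<and> projects_with B F \<pi>"
  using assms(3,4)
proof (induction B)
  case empty
  have "(\<lambda>x. \<zero>\<^bsub>V\<^esub>) \<in> linear_maps K V V"
    by (rule linear_mapsI) auto
  moreover have "(\<lambda>x\<in>carrier V. g \<zero>\<^bsub>V\<^esub>) \<in> W'" if "submodule W' K D" "g \<in> carrier D" for W' g
    using dual.submoduleD(2)[OF that(1)] dualD(4)[OF that(2)] by simp
  ultimately have "projects_with {} {} (\<lambda>x. \<zero>\<^bsub>V\<^esub>)"
    unfolding projects_with_def by blast
  then show ?case by blast
next
  case (insert b B)
  have b: "b \<in> carrier V" and B: "B \<subseteq> carrier V" using insert.prems by auto
  obtain \<pi> F where F: "finite F" "F \<subseteq> W" and proj: "projects_with B F \<pi>"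
    using insert.IH[OF B] by blast
  note \<pi> = projects_withD(1)[OF proj] and \<pi>B = projects_withD(2)[OF proj]
    and \<pi>\<pi> = projects_withD(3)[OF proj] and \<pi>W = projects_withD(4)[OF proj]
  note \<pi>D = linear_mapsD[OF \<pi> left_module_axioms]
  show ?case
  proof (cases "\<pi> b = b")
    case True
    then have "projects_with (insert b B) F \<pi>"
      using proj by (simp add: projects_with_def)
    then show ?thesis using F by blast
  next
    case False
    \<comment> \<open>The part of \<open>b\<close> that \<pi> does not capture: nonzero, and killed
      by \<pi>.\<close>
    define b' where "b' = b \<ominus>\<^bsub>V\<^esub> \<pi> b"
    have b': "b' \<in> carrier V" "b' \<noteq> \<zero>\<^bsub>V\<^esub>"
      using b \<pi>D(1) False M.minus_eq_zero_iff[of b "\<pi> b"] by (auto simp: b'_def)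
    have \<pi>b': "\<pi> b' = \<zero>\<^bsub>V\<^esub>"
      using b \<pi>D \<pi>\<pi> M.minus_eq_zero_iff by (simp add: b'_def)
    obtain w where w: "w \<in> W" "w b' \<noteq> \<zero>\<^bsub>K\<^esub>" using sep b' by blast
    have wD: "w \<in> carrier D" using w dual.submoduleD(1)[OF W] by blast
    \<comment> \<open>Subtracting the functional \<open>x \<mapsto> w (\<pi> x)\<close> makes
      \<open>w'\<close> vanish on the image of \<pi> without changing its value at
      \<open>b'\<close>. The result stays in \<open>W\<close>, because the last clause of
      \<open>projects_with\<close>, applied to \<open>W\<close> itself, puts the subtracted
      functional there.\<close>
    define w' where "w' = w \<ominus>\<^bsub>D\<^esub> (\<lambda>x\<in>carrier V. w (\<pi> x))"
    have w'W: "w' \<in> W"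
      unfolding w'_def using \<pi>W[OF W F(2) wD] w(1) dual.submoduleD(6)[OF W] by blast
    have w'D: "w' \<in> carrier D" using w'W dual.submoduleD(1)[OF W] by blast
    have w'x: "w' x = w x \<ominus>\<^bsub>K\<^esub> w (\<pi> x)" if "x \<in> carrier V" for x
      unfolding w'_def using dual_minus[OF wD dual_comp[OF wD \<pi>] that] that by simp
    have w'b': "w' b' = w b'"
      using w'x[OF b'(1)] \<pi>b' dualD(1,4)[OF wD] b' by (simp add: a_minus_def R.minus_zero)
    define k where "k = inv\<^bsub>K\<^esub> (w b')"
    have k: "k \<in> carrier K" "k \<otimes>\<^bsub>K\<^esub> w b' = \<one>\<^bsub>K\<^esub>"
      using w dualD(1)[OF wD b'(1)] K.field_Units by (auto simp: k_def)
    define v where "v = k \<odot>\<^bsub>D\<^esub> w'"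
    have v: "v \<in> W" "v \<in> carrier D"
      unfolding v_def using dual.submoduleD(1,4)[OF W] k w'W by blast+
    note vD = dualD[OF v(2)]
    have vx: "v x = k \<otimes>\<^bsub>K\<^esub> w' x" if "x \<in> carrier V" for x
      using that by (simp add: v_def)
    have vb': "v b' = \<one>\<^bsub>K\<^esub>" using vx[OF b'(1)] w'b' k by simp
    have v\<pi>: "v (\<pi> x) = \<zero>\<^bsub>K\<^esub>" if "x \<in> carrier V" for x
      using vx[OF \<pi>D(1)[OF that]] w'x[OF \<pi>D(1)[OF that]] \<pi>\<pi>[OF that] dualD(1)[OF wD \<pi>D(1)[OF that]] k
      by (simp add: a_minus_def R.r_neg)
    have bb: "\<pi> b \<oplus>\<^bsub>V\<^esub> b' = b"
      using b \<pi>D(1)[OF b] by (simp add: b'_def a_minus_def M.a_lcomm M.r_neg)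
    have vb: "v b = \<one>\<^bsub>K\<^esub>"
      using vD(2)[OF \<pi>D(1)[OF b] b'(1)] v\<pi>[OF b] vb' by (simp add: bb)
    \<comment> \<open>As \<open>v\<close> is 1 at \<open>b'\<close> and 0 on the image of \<pi>, the
      new map fixes \<open>b'\<close> and every \<open>\<pi> x\<close>, hence also
      \<open>b = \<pi> b + b'\<close> and the old vectors of \<open>B\<close>.\<close>
    define \<pi>' where "\<pi>' x = \<pi> x \<oplus>\<^bsub>V\<^esub> v x \<odot>\<^bsub>V\<^esub> b'" for x
    have \<pi>'\<pi>: "\<pi>' (\<pi> x) = \<pi> x" if "x \<in> carrier V" for x
      using that v\<pi> \<pi>\<pi> \<pi>D(1) b' by (simp add: \<pi>'_def)
    have \<pi>'b': "\<pi>' b' = b'"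
      using b' \<pi>b' vb' smult_one by (simp add: \<pi>'_def)
    have \<pi>': "\<pi>' \<in> linear_maps K V V"
    proof (rule linear_mapsI)
      fix x assume x: "x \<in> carrier V"
      then show "\<pi>' x \<in> carrier V"
        using \<pi>D(1) vD(1) b' smult_closed by (simp add: \<pi>'_def)
      show "\<pi>' (a \<odot>\<^bsub>V\<^esub> x) = a \<odot>\<^bsub>V\<^esub> \<pi>' x" if "a \<in> carrier K" for a
        using that x \<pi>D(1,3) vD(1,3) b' smult_closed
        by (simp add: \<pi>'_def smult_r_distr smult_assoc)
      show "\<pi>' (x \<oplus>\<^bsub>V\<^esub> y) = \<pi>' x \<oplus>\<^bsub>V\<^esub> \<pi>' y" if "y \<in> carrier V" for y
        using that x \<pi>D(1,2) vD(1,2) b' smult_closed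
        by (simp add: \<pi>'_def smult_l_distr M.a_ac)
    qed
    note \<pi>'D = linear_mapsD[OF \<pi>' left_module_axioms]
    have "\<pi>' (\<pi>' x) = \<pi>' x" if x: "x \<in> carrier V" for x
    proof -
      have "\<pi>' (\<pi>' x) = \<pi>' (\<pi> x) \<oplus>\<^bsub>V\<^esub> v x \<odot>\<^bsub>V\<^esub> \<pi>' b'"
        using \<pi>'D(2,3) x \<pi>D(1) vD(1) b' smult_closed by (simp add: \<pi>'_def[of x])
      then show ?thesis using \<pi>'\<pi>[OF x] \<pi>'b' by (simp add: \<pi>'_def[of x])
    qed
    moreover have "\<pi>' c = c" if "c \<in> insert b B" for c
    proof (cases "c = b")
      case True
      then show ?thesis using vb bb b' smult_one by (simp add: \<pi>'_def)
    next
      case False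
      then have "c \<in> B" "c \<in> carrier V" using that B by auto
      then show ?thesis using \<pi>'\<pi>[of c] \<pi>B by simp
    qed
    moreover have "(\<lambda>x\<in>carrier V. g (\<pi>' x)) \<in> W'"
      if W': "submodule W' K D" and vF: "insert v F \<subseteq> W'" and g: "g \<in> carrier D" for W' g
    proof -
      note gD = dualD[OF g]
      \<comment> \<open>The transpose gains only a multiple of \<open>v\<close>, so adding
        \<open>v\<close> to \<open>F\<close> is enough.\<close>
      have "(\<lambda>x\<in>carrier V. g (\<pi>' x)) = (\<lambda>x\<in>carrier V. g (\<pi> x)) \<oplus>\<^bsub>D\<^esub> g b' \<odot>\<^bsub>D\<^esub> v"
        using gD(1-3) \<pi>D(1) vD(1) b' smult_closed
        by (auto simp: \<pi>'_def K.m_comm intro!: restrict_ext)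
      moreover have "(\<lambda>x\<in>carrier V. g (\<pi> x)) \<in> W'" using \<pi>W W' vF g by simp
      moreover have "g b' \<odot>\<^bsub>D\<^esub> v \<in> W'"
        using dual.submoduleD(4)[OF W'] vF gD(1)[OF b'(1)] by blast
      ultimately show ?thesis
        using dual.submoduleD(3)[OF W'] by (simp del: dual_simps)
    qed
    ultimately have "projects_with (insert b B) (insert v F) \<pi>'"
      using \<pi>' unfolding projects_with_def by blast
    then show ?thesis using F v(1) by (meson finite.insertI insert_subset)
  qed
qed

text \<open>If \<open>B\<close> generates \<open>V\<close>, the projection that fixes
  \<open>B\<close> is the identity, because its fixed points form a subspace. Then each functional
  equals its own transpose image and lies in the span of \<open>F\<close>.\<close>

lemma dual_generated:
  assumes "finitely_generated K V" "submodule W K D"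
    and "\<And>x. \<lbrakk>x \<in> carrier V; x \<noteq> \<zero>\<^bsub>V\<^esub>\<rbrakk> \<Longrightarrow> \<exists>w\<in>W. w x \<noteq> \<zero>\<^bsub>K\<^esub>"
  shows "\<exists>F. finite F \<and> F \<subseteq> W \<and> (\<forall>W'. submodule W' K D \<longrightarrow> F \<subseteq> W' \<longrightarrow> W' = carrier D)"
proof -
  obtain B where B: "finite B" "B \<subseteq> carrier V"
    and *: "\<And>N. \<lbrakk>submodule N K V; B \<subseteq> N\<rbrakk> \<Longrightarrow> N = carrier V"
    by (rule finitely_generatedE[OF assms(1)]) (rule that)
  obtain \<pi> F where F: "finite F" "F \<subseteq> W" and proj: "projects_with B F \<pi>"
    using dual_projection[OF assms(2,3) B] by blast
  note \<pi> = projects_withD(1)[OF proj] and \<pi>B = projects_withD(2)[OF proj]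
    and \<pi>W = projects_withD(4)[OF proj]
  note \<pi>D = linear_mapsD[OF \<pi> left_module_axioms]
  have "{x \<in> carrier V. \<pi> x = x} = carrier V"
    by (rule *) (use B \<pi>B \<pi>D(1-4) smult_closed in \<open>auto simp: submodule_iff\<close>)
  then have \<pi>x: "\<pi> x = x" if "x \<in> carrier V" for x using that by blast
  have "W' = carrier D" if W': "submodule W' K D" "F \<subseteq> W'" for W'
  proof
    show "W' \<subseteq> carrier D" using dual.submoduleD(1)[OF W'(1)] by blast
    show "carrier D \<subseteq> W'"
    proof
      fix g assume g: "g \<in> carrier D"
      have "g = (\<lambda>x\<in>carrier V. g (\<pi> x))"
        by (rule dual_eqI[OF g dual_comp[OF g \<pi>]]) (simp add: \<pi>x)
      then show "g \<in> W'" using \<pi>W[OF W' g] by simp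
    qed
  qed
  then show ?thesis using F by blast
qed

text \<open>The finite set that generates the dual can be chosen inside \<open>W\<close>.\<close>

lemma separating_subspace_eq_dual:
  assumes "finitely_generated K V" "submodule W K D"
    and "\<And>x. \<lbrakk>x \<in> carrier V; x \<noteq> \<zero>\<^bsub>V\<^esub>\<rbrakk> \<Longrightarrow> \<exists>w\<in>W. w x \<noteq> \<zero>\<^bsub>K\<^esub>"
  shows "W = carrier D"
  using dual_generated[OF assms] assms(2) by metis

lemma finitely_generated_dual:
  assumes "finitely_generated K V"
  shows "finitely_generated K D"
  using dual_generated[OF assms dual.submodule_carrier dual_separates]
  unfolding finitely_generated_def by (metis (no_types, lifting))

end


section \<open>Peak rings from an idempotent\<close>

lemma (in left_module) submodule_image:
  assumes "left_module R M'" "h \<in> linear_maps R M M'"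
  shows "submodule (h ` carrier M) R M'"
  unfolding left_module.submodule_iff[OF assms(1)]
proof (intro conjI ballI)
  note hD = linear_mapsD[OF assms(2,1)]
  show "h ` carrier M \<subseteq> carrier M'" using hD(1) by blast
  show "\<zero>\<^bsub>M'\<^esub> \<in> h ` carrier M" using hD(4) M.zero_closed by (metis imageI)
  fix p assume "p \<in> h ` carrier M"
  then obtain x where x: "x \<in> carrier M" "p = h x" by blast
  show "a \<odot>\<^bsub>M'\<^esub> p \<in> h ` carrier M" if "a \<in> carrier R" for a
    using hD(3)[OF that x(1)] x smult_closed[OF that x(1)] by (metis imageI)
  fix q assume "q \<in> h ` carrier M"
  then obtain y where y: "y \<in> carrier M" "q = h y" by blast
  show "p \<oplus>\<^bsub>M'\<^esub> q \<in> h ` carrier M"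
    using hD(2)[OF x(1) y(1)] x y M.a_closed[OF x(1) y(1)] by (metis imageI)
qed

text \<open>The basis construction below maps a power onto the socle, whereas
  \<open>peak_socle\<close> asks for a map out of the socle.\<close>

lemma module_iso_sym:
  assumes "left_module R M" "left_module R N" "module_iso R M N"
  shows "module_iso R N M"
proof -
  interpret M: left_module R M by fact
  interpret N: left_module R N by fact
  obtain h where h: "h \<in> linear_maps R M N" and bij: "bij_betw h (carrier M) (carrier N)"
    using assms(3) by (auto simp: module_iso_def)
  note hD = M.linear_mapsD[OF h assms(2)]
  define g where "g = inv_into (carrier M) h"
  have g: "g y \<in> carrier M" "h (g y) = y" if "y \<in> carrier N" for y
    using bij that unfolding g_def bij_betw_def by (auto simp: inv_into_into f_inv_into_f)
  have eq: "x = g y" if "x \<in> carrier M" "y \<in> carrier N" "h x = y" for x y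
    using bij g[OF that(2)] that unfolding bij_betw_def inj_on_def by auto
  have "g \<in> linear_maps R N M"
  proof (rule linear_mapsI)
    fix y assume y: "y \<in> carrier N"
    show "g y \<in> carrier M" using g y by blast
    show "g (a \<odot>\<^bsub>N\<^esub> y) = a \<odot>\<^bsub>M\<^esub> g y" if "a \<in> carrier R" for a
      using g[OF y] that y hD(3)[OF that g(1)[OF y]]
      by (intro eq[symmetric]) (simp_all add: M.smult_closed N.smult_closed)
    show "g (y \<oplus>\<^bsub>N\<^esub> z) = g y \<oplus>\<^bsub>M\<^esub> g z" if "z \<in> carrier N" for z
      using g[OF y] g[OF that] y that hD(2)[OF g(1)[OF y] g(1)[OF that]]
      by (intro eq[symmetric]) simp_all
  qed
  moreover have "bij_betw g (carrier N) (carrier M)"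
    unfolding g_def by (rule bij_betw_inv_into[OF bij])
  ultimately show ?thesis by (auto simp: module_iso_def)
qed

section \<open>Finite direct powers of a module\<close>

lemma direct_power_simps [simp]:
  "carrier (direct_power n M) = {..<n} \<rightarrow>\<^sub>E carrier M"
  "zero (direct_power n M) = (\<lambda>i\<in>{..<n}. \<zero>\<^bsub>M\<^esub>)"
  "add (direct_power n M) f g = (\<lambda>i\<in>{..<n}. f i \<oplus>\<^bsub>M\<^esub> g i)"
  "smult (direct_power n M) a f = (\<lambda>i\<in>{..<n}. a \<odot>\<^bsub>M\<^esub> f i)"
  by (simp_all add: direct_power_def)

lemma left_module_direct_power:
  assumes "left_module R M"
  shows "left_module R (direct_power n M)"
proof -
  interpret left_module R M by fact
  have mem: "f i \<in> carrier M" if "f \<in> {..<n} \<rightarrow>\<^sub>E carrier M" "i < n" for f i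
    using that by (auto simp: PiE_iff)
  have ext: "(\<lambda>i\<in>{..<n}. g i) = f" if "f \<in> {..<n} \<rightarrow>\<^sub>E carrier M" "\<And>i. i < n \<Longrightarrow> g i = f i" for f g
    using that by (auto simp: PiE_iff intro!: extensionalityI[of _ "{..<n}"])
  show ?thesis
  proof (rule left_moduleI)
    show "ring R" by (rule R.ring_axioms)
    show "\<one>\<^bsub>R\<^esub> \<odot>\<^bsub>direct_power n M\<^esub> f = f"
      "\<zero>\<^bsub>direct_power n M\<^esub> \<oplus>\<^bsub>direct_power n M\<^esub> f = f" if "f \<in> carrier (direct_power n M)" for f
      using that mem[of f] by (auto simp: smult_one intro!: ext)
    fix f assume f: "f \<in> carrier (direct_power n M)"
    note fD = mem[OF f[unfolded direct_power_simps]]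
    show "\<zero>\<^bsub>R\<^esub> \<odot>\<^bsub>direct_power n M\<^esub> f = \<zero>\<^bsub>direct_power n M\<^esub>"
      using fD by (auto intro!: restrict_ext)
    fix a assume a: "a \<in> carrier R"
    show "a \<odot>\<^bsub>direct_power n M\<^esub> f \<in> carrier (direct_power n M)"
      using fD a by (auto simp: smult_closed)
    show "(a \<oplus>\<^bsub>R\<^esub> b) \<odot>\<^bsub>direct_power n M\<^esub> f =
        a \<odot>\<^bsub>direct_power n M\<^esub> f \<oplus>\<^bsub>direct_power n M\<^esub> b \<odot>\<^bsub>direct_power n M\<^esub> f"
      "(a \<otimes>\<^bsub>R\<^esub> b) \<odot>\<^bsub>direct_power n M\<^esub> f =
        a \<odot>\<^bsub>direct_power n M\<^esub> (b \<odot>\<^bsub>direct_power n M\<^esub> f)" if "b \<in> carrier R" for b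
      using fD a that by (auto simp: smult_l_distr smult_assoc intro!: restrict_ext)
  next
    fix f g assume f: "f \<in> carrier (direct_power n M)" and g: "g \<in> carrier (direct_power n M)"
    note fD = mem[OF f[unfolded direct_power_simps]] and gD = mem[OF g[unfolded direct_power_simps]]
    show "f \<oplus>\<^bsub>direct_power n M\<^esub> g \<in> carrier (direct_power n M)"
      "f \<oplus>\<^bsub>direct_power n M\<^esub> g = g \<oplus>\<^bsub>direct_power n M\<^esub> f"
      using fD gD by (auto simp: M.a_comm intro!: restrict_ext)
    show "a \<odot>\<^bsub>direct_power n M\<^esub> (f \<oplus>\<^bsub>direct_power n M\<^esub> g) =
        a \<odot>\<^bsub>direct_power n M\<^esub> f \<oplus>\<^bsub>direct_power n M\<^esub> a \<odot>\<^bsub>direct_power n M\<^esub> g" if "a \<in> carrier R" for a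
      using fD gD that by (auto simp: smult_r_distr intro!: restrict_ext)
    fix h assume h: "h \<in> carrier (direct_power n M)"
    show "f \<oplus>\<^bsub>direct_power n M\<^esub> g \<oplus>\<^bsub>direct_power n M\<^esub> h =
        f \<oplus>\<^bsub>direct_power n M\<^esub> (g \<oplus>\<^bsub>direct_power n M\<^esub> h)"
      using fD gD mem[OF h[unfolded direct_power_simps]] by (auto simp: M.a_assoc intro!: restrict_ext)
  qed auto
qed

text \<open>The assumption \<open>corner\<close> says \<open>R e = e R e\<close>. The left inverse
  \<open>y\<close> may be taken anywhere in \<open>R\<close>: by \<open>corner\<close>,
  \<open>y (x e) = (y e) (x e)\<close>, and \<open>y e\<close> belongs to
  \<open>e R e\<close>.\<close>

locale peak_idempotent = ring R for R :: "('r, 'c) ring_scheme" (structure) +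
  fixes e
  assumes e_closed [simp]: "e \<in> carrier R" and e_idem [simp]: "e \<otimes> e = e" and e_nonzero: "e \<noteq> \<zero>"
    and corner: "x \<in> carrier R \<Longrightarrow> e \<otimes> (x \<otimes> e) = x \<otimes> e"
    and left_inverse: "\<lbrakk>x \<in> carrier R; x \<otimes> e \<noteq> \<zero>\<rbrakk> \<Longrightarrow> \<exists>y\<in>carrier R. y \<otimes> (x \<otimes> e) = e"
    and faithful: "\<lbrakk>z \<in> carrier R; z \<noteq> \<zero>\<rbrakk> \<Longrightarrow> \<exists>w\<in>carrier R. e \<otimes> (w \<otimes> z) \<noteq> \<zero>"
    and row_finitely_generated:
      "finitely_generated R ((regular_module R)\<lparr>carrier := {x \<in> carrier R. e \<otimes> x = x}\<rparr>)"
begin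

abbreviation "M \<equiv> regular_module R"

interpretation M: left_module R M by (rule left_module_regular)

definition "row = {x \<in> carrier R. e \<otimes> x = x}"

definition "column = {x \<in> carrier R. x \<otimes> e = x}"

definition "orbit x = (\<lambda>y. y \<otimes> x) ` carrier R"

lemma row_mem: "x \<in> row \<Longrightarrow> x \<in> carrier R" "x \<in> row \<Longrightarrow> e \<otimes> x = x"
  by (auto simp: row_def)

lemma column_mem: "x \<in> column \<Longrightarrow> x \<in> carrier R" "x \<in> column \<Longrightarrow> x \<otimes> e = x"
  by (auto simp: column_def)

text \<open>In general \<open>e R\<close> is a right ideal only. Here \<open>a x = (a e) x\<close>,
  and \<open>corner\<close> provides the factor \<open>e\<close> on the left of
  \<open>a e\<close>.\<close>

lemma submodule_row: "submodule row R M"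
proof -
  have "e \<otimes> (a \<otimes> x) = a \<otimes> x" if "a \<in> carrier R" "x \<in> row" for a x
  proof -
    have "e \<otimes> (a \<otimes> x) = e \<otimes> (a \<otimes> e) \<otimes> x"
      using row_mem[OF that(2)] that by (simp add: m_assoc)
    also have "\<dots> = a \<otimes> x"
      using row_mem[OF that(2)] that by (simp add: corner) (simp add: m_assoc)
    finally show ?thesis .
  qed
  then show ?thesis by (auto simp: M.submodule_iff row_def r_distr)
qed

lemma submodule_orbit:
  assumes "x \<in> carrier R" shows "submodule (orbit x) R M"
proof -
  have "(\<lambda>y. y \<otimes> x) \<in> linear_maps R M M"
    using assms by (intro linear_mapsI) (simp_all add: l_distr m_assoc)
  from M.submodule_image[OF left_module_regular this] show ?thesis by (simp add: orbit_def)
qed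

lemma mem_orbit: "x \<in> carrier R \<Longrightarrow> x \<in> orbit x"
  unfolding orbit_def by (rule image_eqI[of _ _ \<one>]) simp_all

text \<open>A nonzero multiple \<open>y x\<close> equals \<open>(y e) x\<close> with
  \<open>y e\<close> nonzero, and a left inverse of \<open>y e\<close> carries it back to
  \<open>e x = x\<close>. So each nonzero element of \<open>orbit x\<close> generates all of
  it.\<close>

lemma simple_orbit:
  assumes x: "x \<in> row" "x \<noteq> \<zero>"
  shows "simple_module R (M\<lparr>carrier := orbit x\<rparr>)"
  unfolding simple_module_def
proof (intro conjI allI impI)
  have xR: "x \<in> carrier R" and ex: "e \<otimes> x = x" using row_mem x by auto
  note O = submodule_orbit[OF xR]
  show "left_module R (M\<lparr>carrier := orbit x\<rparr>)" by (rule M.left_module_submodule[OF O])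
  show "carrier (M\<lparr>carrier := orbit x\<rparr>) \<noteq> {\<zero>\<^bsub>M\<lparr>carrier := orbit x\<rparr>\<^esub>}"
    using mem_orbit[OF xR] x by auto
  fix N assume "submodule N R (M\<lparr>carrier := orbit x\<rparr>)"
  then have N: "submodule N R M" "N \<subseteq> orbit x" by (simp_all add: M.submodule_submodule_iff[OF O])
  show "N = {\<zero>\<^bsub>M\<lparr>carrier := orbit x\<rparr>\<^esub>} \<or> N = carrier (M\<lparr>carrier := orbit x\<rparr>)"
  proof (cases "N = {\<zero>}")
    case False
    then obtain z where z: "z \<in> N" "z \<noteq> \<zero>"
      using M.submoduleD(2)[OF N(1)] by auto
    then obtain y where y: "y \<in> carrier R" "z = y \<otimes> x" using N by (auto simp: orbit_def)
    have z_eq: "z = y \<otimes> e \<otimes> x" using y xR ex by (simp add: m_assoc)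
    then have "y \<otimes> e \<noteq> \<zero>" using z xR by auto
    then obtain y' where y': "y' \<in> carrier R" "y' \<otimes> (y \<otimes> e) = e" using left_inverse y by blast
    have "y' \<otimes> z = x"
      using y' y xR ex unfolding z_eq by (metis e_closed m_assoc m_closed)
    then have "x \<in> N" using M.submoduleD(4)[OF N(1), of y' z] y' z by simp
    then have "orbit x \<subseteq> N"
      using M.submoduleD(4)[OF N(1), of _ x] by (auto simp: orbit_def)
    then show ?thesis using N by auto
  qed simp
qed

lemma column_eq_orbit: "column = orbit e"
  by (auto simp: column_def orbit_def m_assoc) (metis imageI)

lemma e_row: "e \<in> row" by (simp add: row_def)

abbreviation "S \<equiv> M\<lparr>carrier := column\<rparr>"

lemma simple_column: "simple_module R S"
  using simple_orbit[OF e_row e_nonzero] by (simp add: column_eq_orbit)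

lemma submodule_column: "submodule column R M"
  unfolding column_eq_orbit by (rule submodule_orbit) simp

lemma left_module_column: "left_module R S"
  by (rule M.left_module_submodule[OF submodule_column])

text \<open>\<open>R e\<close> is generated by \<open>e\<close>: with \<open>y\<close> a preimage of
  \<open>f e\<close>, the map \<open>x \<mapsto> x y\<close> is a lift, because
  \<open>x e = x\<close> on \<open>R e\<close>.\<close>

lemma projective_column: "projective_module R S"
  unfolding projective_module_def
proof (intro conjI allI impI left_module_column)
  fix N :: "('r, 'r \<Rightarrow> 'r) module" and L :: "('r, 'r) module" and g f
  assume *: "left_module R N \<and> left_module R L \<and> g \<in> linear_maps R N L \<and>
    g ` carrier N = carrier L \<and> f \<in> linear_maps R S L"
  interpret N: left_module R N using * by blast
  interpret L: left_module R L using * by blast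
  interpret S: left_module R S by (rule left_module_column)
  have gl: "g \<in> linear_maps R N L" and fl: "f \<in> linear_maps R S L" and g_surj: "g ` carrier N = carrier L"
    using * by blast+
  note gD = N.linear_mapsD[OF gl L.left_module_axioms]
  note fD = S.linear_mapsD[OF fl L.left_module_axioms]
  have e: "e \<in> column" by (simp add: column_def)
  then have "f e \<in> g ` carrier N" using fD(1) g_surj by simp
  then obtain y where y: "y \<in> carrier N" "g y = f e" by auto
  show "\<exists>h\<in>linear_maps R S N. \<forall>x\<in>carrier S. g (h x) = f x"
  proof
    show "(\<lambda>x. x \<odot>\<^bsub>N\<^esub> y) \<in> linear_maps R S N"
      using y column_mem by (intro linear_mapsI) (simp_all add: N.smult_closed N.smult_l_distr N.smult_assoc)
    show "\<forall>x\<in>carrier S. g (x \<odot>\<^bsub>N\<^esub> y) = f x"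
    proof
      fix x assume "x \<in> carrier S"
      then have x: "x \<in> carrier R" "x \<otimes> e = x" using column_mem by auto
      then show "g (x \<odot>\<^bsub>N\<^esub> y) = f x"
        using gD(3)[OF x(1) y(1)] fD(3)[of x e] e y by simp
    qed
  qed
qed

lemma socle_eq_row: "socle R M = row"
proof
  let ?U = "\<Union>{N. submodule N R M \<and> simple_module R (M\<lparr>carrier := N\<rparr>)}"
  have "N \<subseteq> row" if N: "submodule N R M" and simple: "simple_module R (M\<lparr>carrier := N\<rparr>)" for N
  proof -
    have "N \<noteq> {\<zero>}" using simple by (auto simp: simple_module_def)
    then obtain z where z: "z \<in> N" "z \<noteq> \<zero>" using M.submoduleD(2)[OF N] by auto
    have zR: "z \<in> carrier R" using M.submoduleD(1)[OF N] z by simp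
    then obtain w where w: "w \<in> carrier R" "e \<otimes> (w \<otimes> z) \<noteq> \<zero>" using faithful z by blast
    \<comment> \<open>This nonzero element lies in \<open>N\<close> and in \<open>row\<close>, so
      simplicity of \<open>N\<close> forces \<open>N\<close> into \<open>row\<close>.\<close>
    have "e \<otimes> (w \<otimes> z) \<in> N"
      using M.submoduleD(4)[OF N, of e "w \<otimes> z"] M.submoduleD(4)[OF N, of w z] w z by simp
    moreover have "e \<otimes> (w \<otimes> z) \<in> row"
      using w zR by (simp add: row_def m_assoc[symmetric])
    moreover have "submodule (N \<inter> row) R (M\<lparr>carrier := N\<rparr>)"
      unfolding M.submodule_submodule_iff[OF N]
      using N submodule_row by (simp add: M.submodule_iff subset_iff)
    then have "N \<inter> row = {\<zero>} \<or> N \<inter> row = N"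
      using simple by (auto simp: simple_module_def)
    ultimately show ?thesis using w by blast
  qed
  then have U: "?U \<subseteq> row" by blast
  have sub: "subgroup row (add_monoid M)"
    using submodule_row by (simp add: submodule_def)
  show "socle R M \<subseteq> row"
    unfolding socle_def
    by (rule group.generate_subgroup_incl[OF M.M.a_group U sub])
  show "row \<subseteq> socle R M"
  proof
    fix x assume x: "x \<in> row"
    show "x \<in> socle R M"
    proof (cases "x = \<zero>")
      case True
      then show ?thesis unfolding socle_def using generate.one[of "add_monoid M"] by simp
    next
      case False
      then have "x \<in> ?U"
        using simple_orbit[OF x] submodule_orbit mem_orbit row_mem(1)[OF x] by blast
      then show ?thesis unfolding socle_def by (rule generate.incl)
    qed
  qed
qed

abbreviation "V \<equiv> M\<lparr>carrier := row\<rparr>"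

lemma left_module_row: "left_module R V"
  by (rule M.left_module_submodule[OF submodule_row])

text \<open>A basis over the division ring \<open>e R e\<close> is selected from \<open>B\<close>
  one element at a time: a \<open>b\<close> that is already in the image is skipped, any other gets
  a coordinate of its own. If \<open>B\<close> generates \<open>e R\<close>, the embedding is
  onto.\<close>

lemma direct_power_embedding:
  assumes "finite B" "B \<subseteq> row"
  shows "\<exists>n g. g \<in> linear_maps R (direct_power n S) V \<and> inj_on g (carrier (direct_power n S)) \<and>
    B \<subseteq> g ` carrier (direct_power n S)"
  using assms
proof (induction B)
  case empty
  have "(\<lambda>f. \<zero>) \<in> linear_maps R (direct_power 0 S) V"
    using M.submoduleD(2)[OF submodule_row] by (intro linear_mapsI) simp_all
  then show ?case
    by (intro exI[of _ 0] exI[of _ "\<lambda>f. \<zero>"]) simp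
next
  case (insert b B)
  then obtain n g where g: "g \<in> linear_maps R (direct_power n S) V"
    and inj: "inj_on g (carrier (direct_power n S))" and B: "B \<subseteq> g ` carrier (direct_power n S)"
    by auto
  have b: "b \<in> carrier R" "e \<otimes> b = b" and b_row: "b \<in> row" using insert row_mem by auto
  let ?P = "direct_power n S" and ?Q = "direct_power (Suc n) S"
  interpret P: left_module R ?P by (rule left_module_direct_power[OF left_module_column])
  interpret V: left_module R V by (rule left_module_row)
  define I where "I = g ` carrier ?P"
  have I: "submodule I R V" unfolding I_def by (rule P.submodule_image[OF left_module_row g])
  have IM: "submodule I R M" using I by (simp add: M.submodule_submodule_iff[OF submodule_row])
  note gD = P.linear_mapsD[OF g left_module_row]
  show ?case
  proof (cases "b \<in> I")
    case True
    then show ?thesis using g inj B unfolding I_def by (intro exI[of _ n] exI[of _ g]) simp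
  next
    case False
    let ?r = "\<lambda>f. restrict f {..<n}"
    have r: "?r f \<in> carrier ?P" if "f \<in> carrier ?Q" for f
      using that by (auto simp: PiE_iff)
    have r': "g (?r f) \<in> carrier R" "g (?r f) \<in> row" if "f \<in> carrier ?Q" for f
      using gD(1)[OF r[OF that]] row_mem by auto
    have last: "f n \<in> carrier R" "f n \<otimes> e = f n" "f n \<in> column" if "f \<in> carrier ?Q" for f
      using that column_mem by (auto simp: PiE_iff)
    \<comment> \<open>The last coordinate is the coefficient of the new basis element
      \<open>b\<close>.\<close>
    define g' where "g' f = g (?r f) \<oplus> f n \<otimes> b" for f
    have "g' \<in> linear_maps R ?Q V"
    proof (rule linear_mapsI)
      fix f assume f: "f \<in> carrier ?Q"
      have "f n \<otimes> b \<in> row" using M.submoduleD(4)[OF submodule_row, of "f n" b] b_row last[OF f] by simp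
      then show "g' f \<in> carrier V"
        using M.submoduleD(3)[OF submodule_row r'(2)[OF f]] by (simp add: g'_def)
      show "g' (a \<odot>\<^bsub>?Q\<^esub> f) = a \<odot>\<^bsub>V\<^esub> g' f" if a: "a \<in> carrier R" for a
      proof -
        have "?r (a \<odot>\<^bsub>?Q\<^esub> f) = a \<odot>\<^bsub>?P\<^esub> ?r f" by (auto simp: restrict_def)
        then show ?thesis
          using gD(3)[OF a r[OF f]] r'[OF f] last[OF f] b a
          by (simp add: g'_def r_distr m_assoc)
      qed
      show "g' (f \<oplus>\<^bsub>?Q\<^esub> f') = g' f \<oplus>\<^bsub>V\<^esub> g' f'" if f': "f' \<in> carrier ?Q" for f'
      proof -
        have "?r (f \<oplus>\<^bsub>?Q\<^esub> f') = ?r f \<oplus>\<^bsub>?P\<^esub> ?r f'" by (auto simp: restrict_def)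
        then show ?thesis
          using gD(2)[OF r[OF f] r[OF f']] r'[OF f] r'[OF f'] last[OF f] last[OF f'] b
          by (simp add: g'_def l_distr a_ac)
      qed
    qed
    moreover have "inj_on g' (carrier ?Q)"
    proof (rule inj_onI)
      fix f f' assume f: "f \<in> carrier ?Q" and f': "f' \<in> carrier ?Q" and eq: "g' f = g' f'"
      note cl = r'(1)[OF f] r'(1)[OF f'] last(1)[OF f] last(1)[OF f'] b(1)
      \<comment> \<open>Otherwise \<open>d = f n - f' n\<close> is a nonzero element of
        \<open>R e\<close> with \<open>d b\<close> in the old image \<open>I\<close>. Multiplying by
        \<open>y\<close> with \<open>y d = e\<close> gives \<open>y d b = e b = b\<close>, so
        \<open>b\<close> would be in \<open>I\<close>.\<close>
      have n: "f n = f' n"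
      proof (rule ccontr)
        assume "f n \<noteq> f' n"
        then have d: "f n \<ominus> f' n \<in> carrier R" "f n \<ominus> f' n \<noteq> \<zero>"
          using last[OF f] last[OF f'] by (auto simp: minus_eq_zero_iff)
        have "(f n \<ominus> f' n) \<otimes> e = f n \<ominus> f' n"
          using last[OF f] last[OF f'] by (simp add: a_minus_def l_distr l_minus)
        then obtain y where y: "y \<in> carrier R" "y \<otimes> (f n \<ominus> f' n) = e"
          using left_inverse[OF d(1)] d(2) by auto
        have "(f n \<ominus> f' n) \<otimes> b = g (?r f') \<ominus> g (?r f)"
          using minus_eq_minus_of_add_eq[of "f n \<otimes> b" "f' n \<otimes> b" "g (?r f)" "g (?r f')"] cl eq
          by (simp add: g'_def a_minus_def l_distr l_minus)
        also have "\<dots> = g (?r f') \<ominus>\<^bsub>M\<^esub> g (?r f)"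
          using a_inv_cong(2)[of M R] by simp
        also have "\<dots> \<in> I" using r[OF f] r[OF f'] M.submoduleD(6)[OF IM] by (simp add: I_def)
        finally have "y \<otimes> ((f n \<ominus> f' n) \<otimes> b) \<in> I" using M.submoduleD(4)[OF IM y(1)] by simp
        moreover have "y \<otimes> ((f n \<ominus> f' n) \<otimes> b) = b"
          using y d b by (simp add: m_assoc[symmetric])
        ultimately show False using False by simp
      qed
      then have "g (?r f) = g (?r f')" using eq cl by (simp add: g'_def)
      then have rr: "?r f = ?r f'" using inj r[OF f] r[OF f'] by (simp add: inj_on_def)
      show "f = f'"
      proof (rule PiE_ext)
        show "f \<in> {..<Suc n} \<rightarrow>\<^sub>E column" "f' \<in> {..<Suc n} \<rightarrow>\<^sub>E column" using f f' by auto
        show "f i = f' i" if "i \<in> {..<Suc n}" for i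
          using that n fun_cong[OF rr, of i] by (cases "i = n") auto
      qed
    qed
    moreover have "insert b B \<subseteq> g' ` carrier ?Q"
    proof -
      \<comment> \<open>The tuple \<open>p\<close> with the coordinate \<open>d\<close> appended.
        The tuple \<open>(0, e)\<close> is sent to \<open>e b = b\<close>, and \<open>(p, 0)\<close>
        to \<open>g p\<close>.\<close>
      define x where "x p d = (\<lambda>i\<in>{..<Suc n}. if i < n then p i else d)" for p :: "nat \<Rightarrow> 'r" and d
      have x: "x p d \<in> carrier ?Q" "g' (x p d) = g p \<oplus> d \<otimes> b"
        if "p \<in> carrier ?P" "d \<in> column" for p d
      proof -
        show "x p d \<in> carrier ?Q" using that by (auto simp: x_def PiE_iff)
        have "?r (x p d) = p" using that by (auto simp: x_def PiE_iff extensional_def fun_eq_iff)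
        then show "g' (x p d) = g p \<oplus> d \<otimes> b" by (simp add: g'_def) (simp add: x_def)
      qed
      have e: "e \<in> column" and 0: "\<zero> \<in> column" by (simp_all add: column_def)
      have "g' (x \<zero>\<^bsub>?P\<^esub> e) = b"
        using x(2)[OF P.M.zero_closed e] gD(4) b by simp
      then have "b \<in> g' ` carrier ?Q"
        by (intro rev_image_eqI[OF x(1)[OF P.M.zero_closed e]]) (rule sym)
      moreover have "c \<in> g' ` carrier ?Q" if c: "c \<in> B" for c
      proof -
        obtain p where p: "p \<in> carrier ?P" "c = g p"
          using subsetD[OF B c] by (elim imageE) (rule that)
        have "c \<in> carrier R" using gD(1)[OF p(1)] p row_mem by simp
        then have "g' (x p \<zero>) = c" using x(2)[OF p(1) 0] p b by simp
        then show ?thesis by (intro rev_image_eqI[OF x(1)[OF p(1) 0]]) (rule sym)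
      qed
      ultimately show ?thesis by blast
    qed
    ultimately show ?thesis by (intro exI[of _ "Suc n"] exI[of _ g']) (intro conjI)
  qed
qed

lemma row_iso_direct_power: "\<exists>n. module_iso R V (direct_power n S)"
proof -
  have "finitely_generated R V" using row_finitely_generated by (simp add: row_def)
  then obtain B where B: "finite B" "B \<subseteq> carrier V"
    and *: "\<And>N. \<lbrakk>submodule N R V; B \<subseteq> N\<rbrakk> \<Longrightarrow> N = carrier V"
    by (rule finitely_generatedE) (rule that)
  then obtain n g where g: "g \<in> linear_maps R (direct_power n S) V"
    "inj_on g (carrier (direct_power n S))" "B \<subseteq> g ` carrier (direct_power n S)"
    using direct_power_embedding[of B] by auto
  have P: "left_module R (direct_power n S)"
    by (rule left_module_direct_power[OF left_module_column])
  have "g ` carrier (direct_power n S) = carrier V"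
    by (rule *[OF left_module.submodule_image[OF P left_module_row g(1)] g(3)])
  then have "module_iso R (direct_power n S) V"
    using g by (auto simp: module_iso_def bij_betw_def)
  then show ?thesis using module_iso_sym[OF P left_module_row] by blast
qed

lemma peak_socle: "peak_socle R"
  using simple_column projective_column row_iso_direct_power
  unfolding peak_socle_def socle_eq_row by blast

end


section \<open>Algebras over a field and triangular matrices\<close>

text \<open>Exchanges the two sums in the associativity of the matrix product.\<close>

lemma (in abelian_monoid) finsum_swap:
  assumes "finite I" "finite J" "\<And>i j. \<lbrakk>i \<in> I; j \<in> J\<rbrakk> \<Longrightarrow> f i j \<in> carrier G"
  shows "(\<Oplus>i\<in>I. \<Oplus>j\<in>J. f i j) = (\<Oplus>j\<in>J. \<Oplus>i\<in>I. f i j)"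
  using assms(1,3)
proof (induction I)
  case empty
  then show ?case by simp
next
  case (insert i I)
  then have *: "(\<Oplus>j\<in>J. f k j) \<in> carrier G" "(\<lambda>j. f k j) \<in> J \<rightarrow> carrier G" if "k \<in> insert i I" for k
    using that by auto
  have "(\<Oplus>k\<in>insert i I. \<Oplus>j\<in>J. f k j) = (\<Oplus>j\<in>J. f i j) \<oplus> (\<Oplus>j\<in>J. \<Oplus>k\<in>I. f k j)"
    using insert * by (simp add: Pi_iff)
  also have "\<dots> = (\<Oplus>j\<in>J. f i j \<oplus> (\<Oplus>k\<in>I. f k j))"
    using insert.prems by (intro finsum_addf[symmetric]) auto
  also have "\<dots> = (\<Oplus>j\<in>J. \<Oplus>k\<in>insert i I. f k j)"
    using insert by (intro finsum_cong') (auto simp: Pi_iff)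
  finally show ?case .
qed

lemma (in module) left_module: "left_module R M"
  by (intro left_module.intro left_module_axioms.intro R.ring_axioms M.abelian_group_axioms)
    (auto simp: smult_l_distr smult_r_distr smult_assoc1)

lemma (in K_algebra) left_module: "left_module K A"
  by (rule module.left_module) (rule module_axioms)

lemma K_algebraI:
  assumes "field K" "left_module K A"
    and "\<And>x y. \<lbrakk>x \<in> carrier A; y \<in> carrier A\<rbrakk> \<Longrightarrow> x \<otimes>\<^bsub>A\<^esub> y \<in> carrier A"
    and "\<one>\<^bsub>A\<^esub> \<in> carrier A"
    and "\<And>x y z. \<lbrakk>x \<in> carrier A; y \<in> carrier A; z \<in> carrier A\<rbrakk>
      \<Longrightarrow> x \<otimes>\<^bsub>A\<^esub> y \<otimes>\<^bsub>A\<^esub> z = x \<otimes>\<^bsub>A\<^esub> (y \<otimes>\<^bsub>A\<^esub> z)"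
    and "\<And>x. x \<in> carrier A \<Longrightarrow> \<one>\<^bsub>A\<^esub> \<otimes>\<^bsub>A\<^esub> x = x"
    and "\<And>x. x \<in> carrier A \<Longrightarrow> x \<otimes>\<^bsub>A\<^esub> \<one>\<^bsub>A\<^esub> = x"
    and "\<And>x y z. \<lbrakk>x \<in> carrier A; y \<in> carrier A; z \<in> carrier A\<rbrakk>
      \<Longrightarrow> (x \<oplus>\<^bsub>A\<^esub> y) \<otimes>\<^bsub>A\<^esub> z = x \<otimes>\<^bsub>A\<^esub> z \<oplus>\<^bsub>A\<^esub> y \<otimes>\<^bsub>A\<^esub> z"
    and "\<And>x y z. \<lbrakk>x \<in> carrier A; y \<in> carrier A; z \<in> carrier A\<rbrakk>
      \<Longrightarrow> z \<otimes>\<^bsub>A\<^esub> (x \<oplus>\<^bsub>A\<^esub> y) = z \<otimes>\<^bsub>A\<^esub> x \<oplus>\<^bsub>A\<^esub> z \<otimes>\<^bsub>A\<^esub> y"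
    and "\<And>c x y. \<lbrakk>c \<in> carrier K; x \<in> carrier A; y \<in> carrier A\<rbrakk>
      \<Longrightarrow> (c \<odot>\<^bsub>A\<^esub> x) \<otimes>\<^bsub>A\<^esub> y = c \<odot>\<^bsub>A\<^esub> (x \<otimes>\<^bsub>A\<^esub> y)"
    and "\<And>c x y. \<lbrakk>c \<in> carrier K; x \<in> carrier A; y \<in> carrier A\<rbrakk>
      \<Longrightarrow> x \<otimes>\<^bsub>A\<^esub> (c \<odot>\<^bsub>A\<^esub> y) = c \<odot>\<^bsub>A\<^esub> (x \<otimes>\<^bsub>A\<^esub> y)"
  shows "K_algebra K A"
proof -
  interpret left_module K A by fact
  interpret K: field K by fact
  have "ring A"
    by (intro ringI M.abelian_group_axioms monoidI) (simp_all add: assms)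
  moreover have "module K A"
    by (intro moduleI K.cring_axioms M.abelian_group_axioms)
      (simp_all add: smult_closed smult_l_distr smult_r_distr smult_assoc smult_one)
  ultimately show ?thesis
    using assms by (intro K_algebra.intro K_algebra_axioms.intro) simp_all
qed

lemma opposite_simps [simp]:
  "carrier (opposite R) = carrier R" "one (opposite R) = one R" "zero (opposite R) = zero R"
  "add (opposite R) = add R" "mult (opposite R) x y = mult R y x"
  by (simp_all add: opposite_def)

lemma smult_opposite [simp]: "smult (opposite R) = smult R"
  by (simp add: opposite_def)

lemma (in K_algebra) K_algebra_opposite: "K_algebra K (opposite A)"
proof (rule K_algebraI)
  interpret L: left_module K A by (rule left_module)
  show "left_module K (opposite A)"
    by (rule left_moduleI)
      (simp_all add: K.ring_axioms M.a_ac L.smult_l_distr L.smult_r_distr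
        L.smult_assoc L.smult_closed L.smult_one)
qed (simp_all add: K.field_axioms A.m_assoc A.l_distr A.r_distr smult_mult_l smult_mult_r)

lemma (in K_algebra) ring_opposite: "ring (opposite A)"
  using K_algebra_opposite by (simp add: K_algebra_def)

text \<open>Generators over \<open>K\<close> give generators over \<open>A\<close>, because
  \<open>c x = (c 1) x\<close> makes each \<open>A\<close>-submodule \<open>N\<close> a
  \<open>K\<close>-subspace. The \<open>x\<close> with \<open>e x\<close> in \<open>N\<close> then
  form a \<open>K\<close>-subspace; if \<open>N\<close> contains all \<open>e b\<close>, this
  subspace contains \<open>B\<close> and so is everything.\<close>

lemma (in K_algebra) finitely_generated_row:
  assumes "finitely_generated K A" and e: "e \<in> carrier A" "e \<otimes>\<^bsub>A\<^esub> e = e"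
  shows "finitely_generated A ((regular_module A)\<lparr>carrier := {x \<in> carrier A. e \<otimes>\<^bsub>A\<^esub> x = x}\<rparr>)"
    (is "finitely_generated A ?V")
proof -
  interpret L: left_module K A by (rule left_module)
  obtain B where B: "finite B" "B \<subseteq> carrier A"
    and *: "\<And>N. \<lbrakk>submodule N K A; B \<subseteq> N\<rbrakk> \<Longrightarrow> N = carrier A"
    by (rule finitely_generatedE[OF assms(1)]) (rule that)
  let ?B = "(\<lambda>b. e \<otimes>\<^bsub>A\<^esub> b) ` B"
  have "N = carrier ?V" if N: "submodule N A ?V" "?B \<subseteq> N" for N
  proof -
    interpret N: submodule N A ?V by fact
    have NV: "N \<subseteq> carrier ?V" using N.subset by simp
    have "submodule {x \<in> carrier A. e \<otimes>\<^bsub>A\<^esub> x \<in> N} K A"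
      unfolding L.submodule_iff
    proof (intro conjI ballI)
      show "\<zero>\<^bsub>A\<^esub> \<in> {x \<in> carrier A. e \<otimes>\<^bsub>A\<^esub> x \<in> N}" using N.one_closed e by simp
      fix x assume x: "x \<in> {x \<in> carrier A. e \<otimes>\<^bsub>A\<^esub> x \<in> N}"
      show "x \<oplus>\<^bsub>A\<^esub> y \<in> {x \<in> carrier A. e \<otimes>\<^bsub>A\<^esub> x \<in> N}" if "y \<in> {x \<in> carrier A. e \<otimes>\<^bsub>A\<^esub> x \<in> N}" for y
        using x that e N.m_closed[of "e \<otimes>\<^bsub>A\<^esub> x" "e \<otimes>\<^bsub>A\<^esub> y"] by (simp add: A.r_distr)
      fix c assume c: "c \<in> carrier K"
      have "e \<otimes>\<^bsub>A\<^esub> (c \<odot>\<^bsub>A\<^esub> x) = (c \<odot>\<^bsub>A\<^esub> \<one>\<^bsub>A\<^esub>) \<otimes>\<^bsub>A\<^esub> (e \<otimes>\<^bsub>A\<^esub> x)"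
        using x c e by (simp add: smult_mult_l smult_mult_r)
      then show "c \<odot>\<^bsub>A\<^esub> x \<in> {x \<in> carrier A. e \<otimes>\<^bsub>A\<^esub> x \<in> N}"
        using N.smult_closed[of "c \<odot>\<^bsub>A\<^esub> \<one>\<^bsub>A\<^esub>" "e \<otimes>\<^bsub>A\<^esub> x"] x c by simp
    qed blast
    then have "{x \<in> carrier A. e \<otimes>\<^bsub>A\<^esub> x \<in> N} = carrier A"
      by (rule *) (use B N(2) in auto)
    then have "e \<otimes>\<^bsub>A\<^esub> x \<in> N" if "x \<in> carrier A" for x using that by blast
    then have "carrier ?V \<subseteq> N" by force
    then show ?thesis using NV by blast
  qed
  moreover have "?B \<subseteq> carrier ?V"
    using B e by (auto simp: A.m_assoc[symmetric])
  ultimately show ?thesis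
    using B(1) unfolding finitely_generated_def by (intro exI[of _ ?B]) simp
qed

section \<open>Triangular matrix algebras over a bimodule\<close>

lemma triangular_simps [simp]:
  "carrier (triangular_algebra S E T la ra) = carrier S \<times> carrier E \<times> carrier T"
  "mult (triangular_algebra S E T la ra) (s, x, t) (s', x', t') =
     (s \<otimes>\<^bsub>S\<^esub> s', la s x' \<oplus>\<^bsub>E\<^esub> ra x t', t \<otimes>\<^bsub>T\<^esub> t')"
  "one (triangular_algebra S E T la ra) = (\<one>\<^bsub>S\<^esub>, \<zero>\<^bsub>E\<^esub>, \<one>\<^bsub>T\<^esub>)"
  "zero (triangular_algebra S E T la ra) = (\<zero>\<^bsub>S\<^esub>, \<zero>\<^bsub>E\<^esub>, \<zero>\<^bsub>T\<^esub>)"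
  "add (triangular_algebra S E T la ra) (s, x, t) (s', x', t') =
     (s \<oplus>\<^bsub>S\<^esub> s', x \<oplus>\<^bsub>E\<^esub> x', t \<oplus>\<^bsub>T\<^esub> t')"
  "smult (triangular_algebra S E T la ra) c (s, x, t) = (c \<odot>\<^bsub>S\<^esub> s, c \<odot>\<^bsub>E\<^esub> x, c \<odot>\<^bsub>T\<^esub> t)"
  by (simp_all add: triangular_algebra_def)

text \<open>A bimodule on which \<open>K\<close> acts in the same way directly, through
  \<open>S\<close> and through \<open>T\<close>; this is what associativity and bilinearity of the
  triangular product require.\<close>

locale triangular_data = S: K_algebra K S + T: K_algebra K T + E: left_module K E
  for K :: "'k ring" and S :: "('k, 's) module" and T :: "('k, 't) module"
    and E :: "('k, 'e) module" +
  fixes la :: "'s \<Rightarrow> 'e \<Rightarrow> 'e" and ra :: "'e \<Rightarrow> 't \<Rightarrow> 'e"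
  assumes la_closed [simp]: "\<lbrakk>s \<in> carrier S; x \<in> carrier E\<rbrakk> \<Longrightarrow> la s x \<in> carrier E"
    and ra_closed [simp]: "\<lbrakk>t \<in> carrier T; x \<in> carrier E\<rbrakk> \<Longrightarrow> ra x t \<in> carrier E"
    and la_add_l: "\<lbrakk>s \<in> carrier S; s' \<in> carrier S; x \<in> carrier E\<rbrakk>
      \<Longrightarrow> la (s \<oplus>\<^bsub>S\<^esub> s') x = la s x \<oplus>\<^bsub>E\<^esub> la s' x"
    and la_add_r: "\<lbrakk>s \<in> carrier S; x \<in> carrier E; y \<in> carrier E\<rbrakk>
      \<Longrightarrow> la s (x \<oplus>\<^bsub>E\<^esub> y) = la s x \<oplus>\<^bsub>E\<^esub> la s y"
    and ra_add_l: "\<lbrakk>t \<in> carrier T; t' \<in> carrier T; x \<in> carrier E\<rbrakk>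
      \<Longrightarrow> ra x (t \<oplus>\<^bsub>T\<^esub> t') = ra x t \<oplus>\<^bsub>E\<^esub> ra x t'"
    and ra_add_r: "\<lbrakk>t \<in> carrier T; x \<in> carrier E; y \<in> carrier E\<rbrakk>
      \<Longrightarrow> ra (x \<oplus>\<^bsub>E\<^esub> y) t = ra x t \<oplus>\<^bsub>E\<^esub> ra y t"
    and la_mult: "\<lbrakk>s \<in> carrier S; s' \<in> carrier S; x \<in> carrier E\<rbrakk>
      \<Longrightarrow> la (s \<otimes>\<^bsub>S\<^esub> s') x = la s (la s' x)"
    and ra_mult: "\<lbrakk>t \<in> carrier T; t' \<in> carrier T; x \<in> carrier E\<rbrakk>
      \<Longrightarrow> ra x (t \<otimes>\<^bsub>T\<^esub> t') = ra (ra x t) t'"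
    and la_one [simp]: "x \<in> carrier E \<Longrightarrow> la \<one>\<^bsub>S\<^esub> x = x"
    and ra_one [simp]: "x \<in> carrier E \<Longrightarrow> ra x \<one>\<^bsub>T\<^esub> = x"
    and la_ra: "\<lbrakk>s \<in> carrier S; t \<in> carrier T; x \<in> carrier E\<rbrakk>
      \<Longrightarrow> la s (ra x t) = ra (la s x) t"
    and la_smult_l: "\<lbrakk>c \<in> carrier K; s \<in> carrier S; x \<in> carrier E\<rbrakk>
      \<Longrightarrow> la (c \<odot>\<^bsub>S\<^esub> s) x = c \<odot>\<^bsub>E\<^esub> la s x"
    and la_smult_r: "\<lbrakk>c \<in> carrier K; s \<in> carrier S; x \<in> carrier E\<rbrakk>
      \<Longrightarrow> la s (c \<odot>\<^bsub>E\<^esub> x) = c \<odot>\<^bsub>E\<^esub> la s x"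
    and ra_smult_l: "\<lbrakk>c \<in> carrier K; t \<in> carrier T; x \<in> carrier E\<rbrakk>
      \<Longrightarrow> ra x (c \<odot>\<^bsub>T\<^esub> t) = c \<odot>\<^bsub>E\<^esub> ra x t"
    and ra_smult_r: "\<lbrakk>c \<in> carrier K; t \<in> carrier T; x \<in> carrier E\<rbrakk>
      \<Longrightarrow> ra (c \<odot>\<^bsub>E\<^esub> x) t = c \<odot>\<^bsub>E\<^esub> ra x t"
begin

text \<open>In each case the scalar zero of \<open>K\<close> is pulled out of the vanishing
  argument.\<close>

lemma zero_actions [simp]:
  "s \<in> carrier S \<Longrightarrow> la s \<zero>\<^bsub>E\<^esub> = \<zero>\<^bsub>E\<^esub>" "t \<in> carrier T \<Longrightarrow> ra \<zero>\<^bsub>E\<^esub> t = \<zero>\<^bsub>E\<^esub>"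
  "x \<in> carrier E \<Longrightarrow> la \<zero>\<^bsub>S\<^esub> x = \<zero>\<^bsub>E\<^esub>" "x \<in> carrier E \<Longrightarrow> ra x \<zero>\<^bsub>T\<^esub> = \<zero>\<^bsub>E\<^esub>"
  using la_smult_r[of "\<zero>\<^bsub>K\<^esub>" s "\<zero>\<^bsub>E\<^esub>"] ra_smult_r[of "\<zero>\<^bsub>K\<^esub>" t "\<zero>\<^bsub>E\<^esub>"]
    la_smult_l[of "\<zero>\<^bsub>K\<^esub>" "\<zero>\<^bsub>S\<^esub>" x] ra_smult_l[of "\<zero>\<^bsub>K\<^esub>" "\<zero>\<^bsub>T\<^esub>" x]
  by simp_all

abbreviation "\<Delta> \<equiv> triangular_algebra S E T la ra"

lemma left_module_triangular: "left_module K \<Delta>"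
proof -
  interpret S': left_module K S by (rule S.left_module)
  interpret T': left_module K T by (rule T.left_module)
  show ?thesis
    by (rule left_moduleI)
      (auto simp: S.K.ring_axioms S.M.a_ac E.M.a_ac T.M.a_ac
        S.smult_l_distr S.smult_r_distr T.smult_l_distr T.smult_r_distr E.smult_l_distr E.smult_r_distr
        S'.smult_assoc T'.smult_assoc E.smult_assoc S'.smult_one T'.smult_one E.smult_one E.smult_closed)
qed

lemma K_algebra_triangular: "K_algebra K \<Delta>"
proof (rule K_algebraI[OF S.K.field_axioms left_module_triangular])
  show "x \<otimes>\<^bsub>\<Delta>\<^esub> y \<otimes>\<^bsub>\<Delta>\<^esub> z = x \<otimes>\<^bsub>\<Delta>\<^esub> (y \<otimes>\<^bsub>\<Delta>\<^esub> z)"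
    if "x \<in> carrier \<Delta>" "y \<in> carrier \<Delta>" "z \<in> carrier \<Delta>" for x y z
    using that
    by (auto simp: S.A.m_assoc T.A.m_assoc la_add_r ra_add_r la_mult ra_mult la_ra E.M.a_assoc)
  show "(x \<oplus>\<^bsub>\<Delta>\<^esub> y) \<otimes>\<^bsub>\<Delta>\<^esub> z = x \<otimes>\<^bsub>\<Delta>\<^esub> z \<oplus>\<^bsub>\<Delta>\<^esub> y \<otimes>\<^bsub>\<Delta>\<^esub> z"
    "z \<otimes>\<^bsub>\<Delta>\<^esub> (x \<oplus>\<^bsub>\<Delta>\<^esub> y) = z \<otimes>\<^bsub>\<Delta>\<^esub> x \<oplus>\<^bsub>\<Delta>\<^esub> z \<otimes>\<^bsub>\<Delta>\<^esub> y"
    if "x \<in> carrier \<Delta>" "y \<in> carrier \<Delta>" "z \<in> carrier \<Delta>" for x y z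
    using that
    by (auto simp: S.A.l_distr T.A.l_distr S.A.r_distr T.A.r_distr la_add_l la_add_r ra_add_l ra_add_r
        E.M.a_ac)
qed (auto simp: E.smult_closed S.smult_mult_l S.smult_mult_r T.smult_mult_l T.smult_mult_r
       la_smult_l la_smult_r ra_smult_l ra_smult_r E.smult_r_distr)

lemma finitely_generated_triangular:
  assumes "finitely_generated K S" "finitely_generated K E" "finitely_generated K T"
  shows "finitely_generated K \<Delta>"
proof -
  interpret S': left_module K S by (rule S.left_module)
  interpret T': left_module K T by (rule T.left_module)
  interpret \<Delta>: left_module K \<Delta> by (rule left_module_triangular)
  obtain BS where BS: "finite BS" "BS \<subseteq> carrier S"
    and S: "\<And>N. \<lbrakk>submodule N K S; BS \<subseteq> N\<rbrakk> \<Longrightarrow> N = carrier S"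
    by (rule finitely_generatedE[OF assms(1)]) (rule that)
  obtain BE where BE: "finite BE" "BE \<subseteq> carrier E"
    and E: "\<And>N. \<lbrakk>submodule N K E; BE \<subseteq> N\<rbrakk> \<Longrightarrow> N = carrier E"
    by (rule finitely_generatedE[OF assms(2)]) (rule that)
  obtain BT where BT: "finite BT" "BT \<subseteq> carrier T"
    and T: "\<And>N. \<lbrakk>submodule N K T; BT \<subseteq> N\<rbrakk> \<Longrightarrow> N = carrier T"
    by (rule finitely_generatedE[OF assms(3)]) (rule that)
  let ?iS = "\<lambda>s. (s, \<zero>\<^bsub>E\<^esub>, \<zero>\<^bsub>T\<^esub>)" and ?iE = "\<lambda>x. (\<zero>\<^bsub>S\<^esub>, x, \<zero>\<^bsub>T\<^esub>)" and ?iT = "\<lambda>t. (\<zero>\<^bsub>S\<^esub>, \<zero>\<^bsub>E\<^esub>, t)"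
  have i: "?iS \<in> linear_maps K S \<Delta>" "?iE \<in> linear_maps K E \<Delta>" "?iT \<in> linear_maps K T \<Delta>"
    by (intro linear_mapsI; simp)+
  let ?B = "?iS ` BS \<union> ?iE ` BE \<union> ?iT ` BT"
  have "carrier \<Delta> \<subseteq> N" if N: "submodule N K \<Delta>" "?B \<subseteq> N" for N
  proof -
    have "{x \<in> carrier S. ?iS x \<in> N} = carrier S"
      by (rule S[OF S'.submodule_vimage[OF left_module_triangular i(1) N(1)]]) (use BS N(2) in auto)
    moreover have "{x \<in> carrier E. ?iE x \<in> N} = carrier E"
      by (rule E[OF E.submodule_vimage[OF left_module_triangular i(2) N(1)]]) (use BE N(2) in auto)
    moreover have "{x \<in> carrier T. ?iT x \<in> N} = carrier T"
      by (rule T[OF T'.submodule_vimage[OF left_module_triangular i(3) N(1)]]) (use BT N(2) in auto)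
    ultimately have mem: "?iS s \<in> N" "?iE x \<in> N" "?iT t \<in> N"
      if "s \<in> carrier S" "x \<in> carrier E" "t \<in> carrier T" for s x t
      using that by blast+
    show ?thesis
    proof
      fix z assume "z \<in> carrier \<Delta>"
      then obtain s x t where z: "z = (s, x, t)" "s \<in> carrier S" "x \<in> carrier E" "t \<in> carrier T"
        by auto
      have "?iS s \<oplus>\<^bsub>\<Delta>\<^esub> ?iE x \<oplus>\<^bsub>\<Delta>\<^esub> ?iT t \<in> N"
        using mem[OF z(2-4)] \<Delta>.submoduleD(3)[OF N(1)] by blast
      then show "z \<in> N" using z by simp
    qed
  qed
  moreover have "N \<subseteq> carrier \<Delta>" if "submodule N K \<Delta>" for N
    using \<Delta>.submoduleD(1)[OF that] by blast
  moreover have "?B \<subseteq> carrier \<Delta>" using BS BE BT by auto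
  ultimately show ?thesis
    using BS BE BT unfolding finitely_generated_def by (intro exI[of _ ?B]) (simp add: subset_antisym)
qed

end


section \<open>The matrix algebra of a multiplicative system\<close>

lemma matrix_unit_apply [simp]:
  "matrix_unit A i j r k l = (if k = i \<and> l = j then r else \<zero>\<^bsub>A\<^esub>)"
  by (simp add: matrix_unit_def)

context multiplicative_system
begin

abbreviation "L \<equiv> Lambda A R u"

interpretation A: left_module K A by (rule left_module)

text \<open>Extending the system by zero to all pairs of indices lets matrix products be summed over
  the whole poset without order conditions; \<open>entry_mult\<close> is then (M.1) for arbitrary
  indices.\<close>

definition entry :: "'p \<Rightarrow> 'p \<Rightarrow> 'a set" where
  "entry i j = (if i \<le> j then R i j else {\<zero>\<^bsub>A\<^esub>})"

lemma submodule_entry: "submodule (entry i j) K A"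
  using subspace by (auto simp: entry_def A.submodule_iff)

lemmas entryD = A.submoduleD[OF submodule_entry]

lemma entry_closed [simp]: "x \<in> entry i j \<Longrightarrow> x \<in> carrier A"
  by (rule entryD)

lemma R_closed [simp]: "\<lbrakk>i \<le> j; x \<in> R i j\<rbrakk> \<Longrightarrow> x \<in> carrier A"
  using entry_closed[of x i j] by (simp add: entry_def)

lemma u_closed [simp]: "u i \<in> carrier A"
  using R_closed[of i i "u i"] unit_closed by simp

lemma entry_mult:
  assumes x: "x \<in> entry i j" and y: "y \<in> entry j l"
  shows "x \<otimes>\<^bsub>A\<^esub> y \<in> entry i l"
proof (cases "i \<le> j \<and> j \<le> l")
  case True
  then have "i \<le> l" by auto
  with True show ?thesis using mult_closed[of i j l x y] x y by (simp add: entry_def)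
next
  case False
  then have "x = \<zero>\<^bsub>A\<^esub> \<or> y = \<zero>\<^bsub>A\<^esub>" using x y by (auto simp: entry_def)
  then have "x \<otimes>\<^bsub>A\<^esub> y = \<zero>\<^bsub>A\<^esub>" using entry_closed[OF x] entry_closed[OF y] by auto
  then show ?thesis by (simp add: entryD(2))
qed

lemma entry_unit: "x \<in> entry i j \<Longrightarrow> u i \<otimes>\<^bsub>A\<^esub> x = x" "x \<in> entry i j \<Longrightarrow> x \<otimes>\<^bsub>A\<^esub> u j = x"
  using unit_l unit_r by (auto simp: entry_def split: if_splits)

lemma Lambda_simps [simp]:
  "zero L = (\<lambda>i j. \<zero>\<^bsub>A\<^esub>)" "(x \<oplus>\<^bsub>L\<^esub> y) i j = x i j \<oplus>\<^bsub>A\<^esub> y i j" "(c \<odot>\<^bsub>L\<^esub> x) i j = c \<odot>\<^bsub>A\<^esub> x i j"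
  "\<one>\<^bsub>L\<^esub> i j = (if i = j then u i else \<zero>\<^bsub>A\<^esub>)"
  by (simp_all add: Lambda_def)

lemma Lambda_mult: "(x \<otimes>\<^bsub>L\<^esub> y) i l = (\<Oplus>\<^bsub>A\<^esub>j\<in>UNIV. x i j \<otimes>\<^bsub>A\<^esub> y j l)"
  by (simp add: Lambda_def)

lemma Lambda_carrier: "x \<in> carrier L \<longleftrightarrow> (\<forall>i j. x i j \<in> entry i j)"
  by (simp add: Lambda_def entry_def)

lemma Lambda_entry: "x \<in> carrier L \<Longrightarrow> x i j \<in> entry i j"
  by (simp add: Lambda_carrier)

lemma Lambda_closed [simp]: "x \<in> carrier L \<Longrightarrow> x i j \<in> carrier A"
  using Lambda_entry entry_closed by blast

lemma K_algebra_Lambda: "K_algebra K L"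
proof (rule K_algebraI)
  show "field K" by (rule K.field_axioms)
  show "left_module K L"
    by (rule left_moduleI)
      (auto simp: Lambda_carrier fun_eq_iff entryD(2-4) K.ring_axioms M.a_ac A.smult_l_distr A.smult_r_distr
        A.smult_assoc A.smult_one)
  show "x \<otimes>\<^bsub>L\<^esub> y \<in> carrier L" if "x \<in> carrier L" "y \<in> carrier L" for x y
    unfolding Lambda_carrier
  proof (intro allI)
    fix i l
    have "(\<lambda>j. x i j \<otimes>\<^bsub>A\<^esub> y j l) \<in> UNIV \<rightarrow> entry i l"
      by (intro funcsetI entry_mult[OF Lambda_entry[OF that(1)] Lambda_entry[OF that(2)]])
    then show "(x \<otimes>\<^bsub>L\<^esub> y) i l \<in> entry i l"
      unfolding Lambda_mult by (intro A.submodule_finsum[OF submodule_entry]) simp_all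
  qed
  show "\<one>\<^bsub>L\<^esub> \<in> carrier L"
    using unit_closed entryD(2) by (auto simp: Lambda_carrier) (simp add: entry_def)
  show "x \<otimes>\<^bsub>L\<^esub> y \<otimes>\<^bsub>L\<^esub> z = x \<otimes>\<^bsub>L\<^esub> (y \<otimes>\<^bsub>L\<^esub> z)"
    if x: "x \<in> carrier L" and y: "y \<in> carrier L" and z: "z \<in> carrier L" for x y z
  proof (intro ext)
    fix i l
    have "(x \<otimes>\<^bsub>L\<^esub> y \<otimes>\<^bsub>L\<^esub> z) i l = (\<Oplus>\<^bsub>A\<^esub>k\<in>UNIV. \<Oplus>\<^bsub>A\<^esub>j\<in>UNIV. x i j \<otimes>\<^bsub>A\<^esub> y j k \<otimes>\<^bsub>A\<^esub> z k l)"
      unfolding Lambda_mult using x y z by (intro M.finsum_cong' A.finsum_ldistr) auto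
    also have "\<dots> = (\<Oplus>\<^bsub>A\<^esub>j\<in>UNIV. \<Oplus>\<^bsub>A\<^esub>k\<in>UNIV. x i j \<otimes>\<^bsub>A\<^esub> y j k \<otimes>\<^bsub>A\<^esub> z k l)"
      using x y z by (intro M.finsum_swap) auto
    also have "\<dots> = (\<Oplus>\<^bsub>A\<^esub>j\<in>UNIV. \<Oplus>\<^bsub>A\<^esub>k\<in>UNIV. x i j \<otimes>\<^bsub>A\<^esub> (y j k \<otimes>\<^bsub>A\<^esub> z k l))"
      using x y z by (intro M.finsum_cong') (auto simp: A.m_assoc)
    also have "\<dots> = (x \<otimes>\<^bsub>L\<^esub> (y \<otimes>\<^bsub>L\<^esub> z)) i l"
      unfolding Lambda_mult using x y z by (intro M.finsum_cong' A.finsum_rdistr[symmetric]) auto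
    finally show "(x \<otimes>\<^bsub>L\<^esub> y \<otimes>\<^bsub>L\<^esub> z) i l = (x \<otimes>\<^bsub>L\<^esub> (y \<otimes>\<^bsub>L\<^esub> z)) i l" .
  qed
  show "\<one>\<^bsub>L\<^esub> \<otimes>\<^bsub>L\<^esub> x = x" "x \<otimes>\<^bsub>L\<^esub> \<one>\<^bsub>L\<^esub> = x" if x: "x \<in> carrier L" for x
  proof (safe intro!: ext)
    fix i l
    have "(\<one>\<^bsub>L\<^esub> \<otimes>\<^bsub>L\<^esub> x) i l = (\<Oplus>\<^bsub>A\<^esub>j\<in>UNIV. if i = j then x j l else \<zero>\<^bsub>A\<^esub>)"
      unfolding Lambda_mult using x entry_unit(1)[OF Lambda_entry[OF x]]
      by (intro M.finsum_cong') auto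
    then show "(\<one>\<^bsub>L\<^esub> \<otimes>\<^bsub>L\<^esub> x) i l = x i l"
      using x M.finsum_singleton[of i UNIV "\<lambda>j. x j l"] by simp
    have "(x \<otimes>\<^bsub>L\<^esub> \<one>\<^bsub>L\<^esub>) i l = (\<Oplus>\<^bsub>A\<^esub>j\<in>UNIV. if l = j then x i j else \<zero>\<^bsub>A\<^esub>)"
      unfolding Lambda_mult using x entry_unit(2)[OF Lambda_entry[OF x]]
      by (intro M.finsum_cong') auto
    then show "(x \<otimes>\<^bsub>L\<^esub> \<one>\<^bsub>L\<^esub>) i l = x i l"
      using x M.finsum_singleton[of l UNIV "\<lambda>j. x i j"] by simp
  qed
  fix x y z assume x: "x \<in> carrier L" and y: "y \<in> carrier L" and z: "z \<in> carrier L"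
  show "(x \<oplus>\<^bsub>L\<^esub> y) \<otimes>\<^bsub>L\<^esub> z = x \<otimes>\<^bsub>L\<^esub> z \<oplus>\<^bsub>L\<^esub> y \<otimes>\<^bsub>L\<^esub> z"
    "z \<otimes>\<^bsub>L\<^esub> (x \<oplus>\<^bsub>L\<^esub> y) = z \<otimes>\<^bsub>L\<^esub> x \<oplus>\<^bsub>L\<^esub> z \<otimes>\<^bsub>L\<^esub> y"
    using x y z by (auto simp: fun_eq_iff Lambda_mult A.l_distr A.r_distr M.finsum_addf Pi_iff)
next
  fix c x y assume c: "c \<in> carrier K" and x: "x \<in> carrier L" and y: "y \<in> carrier L"
  show "(c \<odot>\<^bsub>L\<^esub> x) \<otimes>\<^bsub>L\<^esub> y = c \<odot>\<^bsub>L\<^esub> (x \<otimes>\<^bsub>L\<^esub> y)" "x \<otimes>\<^bsub>L\<^esub> (c \<odot>\<^bsub>L\<^esub> y) = c \<odot>\<^bsub>L\<^esub> (x \<otimes>\<^bsub>L\<^esub> y)"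
    using c x y by (auto simp: fun_eq_iff Lambda_mult smult_mult_l smult_mult_r finsum_smult_ldistr Pi_iff)
qed

sublocale L: K_algebra K L by (rule K_algebra_Lambda)

section \<open>Matrix units and the left ideals \<open>\<Lambda> e\<^sub>i\<close>\<close>

lemma matrix_unit_closed: "r \<in> entry i j \<Longrightarrow> matrix_unit A i j r \<in> carrier L"
  using entryD(2) by (auto simp: Lambda_carrier)

lemma mult_matrix_unit:
  assumes "x \<in> carrier L" "r \<in> entry j k"
  shows "(x \<otimes>\<^bsub>L\<^esub> matrix_unit A j k r) i l = (if l = k then x i j \<otimes>\<^bsub>A\<^esub> r else \<zero>\<^bsub>A\<^esub>)"
proof -
  have r: "r \<in> carrier A" using assms by simp
  have "(x \<otimes>\<^bsub>L\<^esub> matrix_unit A j k r) i l =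
    (\<Oplus>\<^bsub>A\<^esub>j'\<in>UNIV. if j = j' then (if l = k then x i j' \<otimes>\<^bsub>A\<^esub> r else \<zero>\<^bsub>A\<^esub>) else \<zero>\<^bsub>A\<^esub>)"
    unfolding Lambda_mult using assms(1) r by (intro M.finsum_cong') auto
  then show ?thesis
    using assms(1) r M.finsum_singleton[of j UNIV "\<lambda>j'. if l = k then x i j' \<otimes>\<^bsub>A\<^esub> r else \<zero>\<^bsub>A\<^esub>"] by simp
qed

lemma matrix_unit_mult:
  assumes "x \<in> carrier L" "r \<in> entry i j"
  shows "(matrix_unit A i j r \<otimes>\<^bsub>L\<^esub> x) k l = (if k = i then r \<otimes>\<^bsub>A\<^esub> x j l else \<zero>\<^bsub>A\<^esub>)"
proof -
  have r: "r \<in> carrier A" using assms by simp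
  have "(matrix_unit A i j r \<otimes>\<^bsub>L\<^esub> x) k l =
    (\<Oplus>\<^bsub>A\<^esub>j'\<in>UNIV. if j = j' then (if k = i then r \<otimes>\<^bsub>A\<^esub> x j' l else \<zero>\<^bsub>A\<^esub>) else \<zero>\<^bsub>A\<^esub>)"
    unfolding Lambda_mult using assms(1) r by (intro M.finsum_cong') auto
  then show ?thesis
    using assms(1) r M.finsum_singleton[of j UNIV "\<lambda>j'. if k = i then r \<otimes>\<^bsub>A\<^esub> x j' l else \<zero>\<^bsub>A\<^esub>"] by simp
qed

lemma idem_closed: "idem A u i \<in> carrier L"
  unfolding idem_def using unit_closed by (intro matrix_unit_closed) (simp add: entry_def)

lemma Lambda_idem_simps [simp]:
  "zero (Lambda_idem A R u i) = zero L" "add (Lambda_idem A R u i) = add L"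
  "smult (Lambda_idem A R u i) = smult L" "mult (Lambda_idem A R u i) = mult L"
  by (simp_all add: Lambda_idem_def)

lemma u_entry: "u i \<in> entry i i"
  using unit_closed by (simp add: entry_def)

text \<open>Right multiplication by \<open>e\<^sub>i\<close> keeps column \<open>i\<close> and
  clears the others. Later arguments use this description of \<open>\<Lambda> e\<^sub>i\<close> by
  its support.\<close>

lemma Lambda_idem_carrier:
  "carrier (Lambda_idem A R u i) = {x \<in> carrier L. \<forall>k l. l \<noteq> i \<longrightarrow> x k l = \<zero>\<^bsub>A\<^esub>}"
proof safe
  fix x assume "x \<in> carrier (Lambda_idem A R u i)"
  then obtain y where y: "y \<in> carrier L" "x = y \<otimes>\<^bsub>L\<^esub> idem A u i" by (auto simp: Lambda_idem_def)
  then show "x \<in> carrier L" using idem_closed by simp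
  show "x k l = \<zero>\<^bsub>A\<^esub>" if "l \<noteq> i" for k l
    using y that mult_matrix_unit[OF y(1) u_entry] by (simp add: idem_def)
next
  fix x assume x: "x \<in> carrier L" "\<forall>k l. l \<noteq> i \<longrightarrow> x k l = \<zero>\<^bsub>A\<^esub>"
  have "x \<otimes>\<^bsub>L\<^esub> idem A u i = x"
    using x mult_matrix_unit[OF x(1) u_entry] entry_unit(2)[OF Lambda_entry[OF x(1)]]
    by (auto simp: idem_def fun_eq_iff)
  then show "x \<in> carrier (Lambda_idem A R u i)"
    using x(1) unfolding Lambda_idem_def by (simp add: rev_image_eqI)
qed

lemma mult_idem:
  assumes "x \<in> carrier (Lambda_idem A R u i)" shows "x \<otimes>\<^bsub>L\<^esub> idem A u i = x"
  using assms mult_matrix_unit[OF _ u_entry, of x] entry_unit(2)[OF Lambda_entry, of x]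
  by (auto simp: idem_def fun_eq_iff Lambda_idem_carrier)

end


section \<open>The two socles\<close>

context admissible_system
begin

abbreviation "V \<equiv> Lambda_idem A R u m"
abbreviation "E \<equiv> dual_space K V"
abbreviation "Rm \<equiv> diagonal_algebra A R u m"
abbreviation "mu \<equiv> matrix_unit A m m"
abbreviation "la \<equiv> E_left_action A R u m"
abbreviation "ra \<equiv> E_right_action A R u m"

lemma diagonal_simps [simp]:
  "carrier (diagonal_algebra A R u i) = R i i" "zero (diagonal_algebra A R u i) = zero A"
  "one (diagonal_algebra A R u i) = u i" "add (diagonal_algebra A R u i) = add A"
  "mult (diagonal_algebra A R u i) = mult A" "smult (diagonal_algebra A R u i) = smult A"
  by (simp_all add: diagonal_algebra_def)

interpretation AL: left_module K A by (rule left_module)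
interpretation LL: left_module K L by (rule L.left_module)

lemma diagonal_inverse:
  assumes "r \<in> R i i" "r \<noteq> \<zero>\<^bsub>A\<^esub>"
  shows "\<exists>s\<in>R i i. s \<otimes>\<^bsub>A\<^esub> r = u i \<and> r \<otimes>\<^bsub>A\<^esub> s = u i"
proof -
  have "r \<in> Units (diagonal_algebra A R u i)"
    using division[of i] assms by (simp add: division_ring_def)
  then show ?thesis by (auto simp: Units_def)
qed

lemma u_nonzero: "u i \<noteq> \<zero>\<^bsub>A\<^esub>"
  using division[of i] by (simp add: division_ring_def)

lemma K_algebra_diagonal: "K_algebra K (diagonal_algebra A R u i)"
proof (rule K_algebraI)
  have "left_module K (A\<lparr>carrier := R i i\<rparr>)"
    by (rule AL.left_module_submodule) (simp add: subspace)
  then show "left_module K (diagonal_algebra A R u i)"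
    by (rule left_module.left_module_cong) (simp_all)
qed (use mult_closed[of i i i] unit_closed[of i] unit_l[of i i] unit_r[of i i] R_closed[of i i]
     in \<open>auto simp: K.field_axioms A.m_assoc A.l_distr A.r_distr smult_mult_l smult_mult_r\<close>)

text \<open>A single use of (A.2) only moves the right index strictly upwards. The number of
  elements above it drops, so after finitely many steps it is \<open>m\<close>, where multiplication
  by the unit ends the chain. By (M.1) the factors used combine into one element of
  \<open>R j m\<close>.\<close>

lemma nonzero_product_to_greatest:
  assumes "i \<le> j" "x \<in> R i j" "x \<noteq> \<zero>\<^bsub>A\<^esub>"
  shows "\<exists>y\<in>R j m. x \<otimes>\<^bsub>A\<^esub> y \<noteq> \<zero>\<^bsub>A\<^esub>"
  using assms
proof (induction "card {k. j < k}" arbitrary: j x rule: less_induct)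
  case less
  show ?case
  proof (cases "j = m")
    case True
    then show ?thesis using less.prems unit_r unit_closed by (intro bexI[of _ "u m"]) auto
  next
    case False
    then have "j < m" using greatest[of j] by simp
    then obtain l y where y: "j \<le> l" "l \<noteq> j" "y \<in> R j l" "x \<otimes>\<^bsub>A\<^esub> y \<noteq> \<zero>\<^bsub>A\<^esub>"
      using extend less.prems by blast
    have jl: "j < l" using y by simp
    have "{k. l < k} \<subset> {k. j < k}"
    proof
      show "{k. l < k} \<subseteq> {k. j < k}" using less_trans[OF jl] by blast
      show "{k. l < k} \<noteq> {k. j < k}" using jl by blast
    qed
    then have card: "card {k. l < k} < card {k. j < k}"
      by (rule psubset_card_mono[OF finite])
    have il: "i \<le> l" by (rule order_trans[OF less.prems(1) y(1)])
    obtain z where z: "z \<in> R l m" "x \<otimes>\<^bsub>A\<^esub> y \<otimes>\<^bsub>A\<^esub> z \<noteq> \<zero>\<^bsub>A\<^esub>"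
      using less.hyps[OF card il mult_closed[OF less.prems(1) y(1) less.prems(2) y(3)] y(4)] by blast
    have cl: "x \<in> carrier A" "y \<in> carrier A" "z \<in> carrier A"
      using R_closed[OF less.prems(1,2)] R_closed[OF y(1,3)] R_closed[OF greatest z(1)] by auto
    have "y \<otimes>\<^bsub>A\<^esub> z \<in> R j m" using mult_closed[of j l m y z] y z greatest by simp
    moreover have "x \<otimes>\<^bsub>A\<^esub> (y \<otimes>\<^bsub>A\<^esub> z) \<noteq> \<zero>\<^bsub>A\<^esub>"
      using z cl by (simp add: A.m_assoc)
    ultimately show ?thesis by blast
  qed
qed

lemma entry_m: "entry i m = R i m"
  using greatest by (simp add: entry_def)

lemma V_memD:
  assumes "x \<in> carrier V"
  shows "x \<in> carrier L" "l \<noteq> m \<Longrightarrow> x k l = \<zero>\<^bsub>A\<^esub>" "x k m \<in> R k m"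
  using assms Lambda_entry[of x k m] by (auto simp: Lambda_idem_carrier entry_m)

lemma V_memI: "\<lbrakk>x \<in> carrier L; \<And>k l. l \<noteq> m \<Longrightarrow> x k l = \<zero>\<^bsub>A\<^esub>\<rbrakk> \<Longrightarrow> x \<in> carrier V"
  by (simp add: Lambda_idem_carrier)

lemma submodule_V: "submodule (carrier V) K L"
proof -
  have "\<zero>\<^bsub>L\<^esub> \<in> carrier L" by (rule L.M.zero_closed)
  then show ?thesis by (auto simp: LL.submodule_iff Lambda_idem_carrier)
qed

lemma vector_space_V: "vector_space_over K V"
proof -
  have "V = L\<lparr>carrier := carrier V\<rparr>" by (simp add: Lambda_idem_def)
  then show ?thesis
    using LL.left_module_submodule[OF submodule_V] K.field_axioms
    by (intro vector_space_over.intro) simp_all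
qed

interpretation V: vector_space_over K V by (rule vector_space_V)

lemma V_mult:
  assumes "a \<in> carrier L" "x \<in> carrier V" shows "a \<otimes>\<^bsub>L\<^esub> x \<in> carrier V"
proof (rule V_memI)
  show "a \<otimes>\<^bsub>L\<^esub> x \<in> carrier L" using assms V_memD by simp
  fix k l assume "l \<noteq> m"
  then show "(a \<otimes>\<^bsub>L\<^esub> x) k l = \<zero>\<^bsub>A\<^esub>"
    using assms V_memD(2)[OF assms(2)] by (simp add: Lambda_mult)
qed

lemma mu_entry: "r \<in> R m m \<Longrightarrow> r \<in> entry m m"
  by (simp add: entry_def)

lemma mu_V: "r \<in> R m m \<Longrightarrow> mu r \<in> carrier V"
  using matrix_unit_closed[OF mu_entry] by (intro V_memI) auto

lemma mu_L [simp]: "r \<in> R m m \<Longrightarrow> mu r \<in> carrier L"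
  by (rule V_memD(1)[OF mu_V])

lemma idem_eq_mu: "idem A u m = mu (u m)"
  by (simp add: idem_def)

lemma idem_V: "idem A u m \<in> carrier V"
  using mu_V unit_closed by (simp add: idem_eq_mu)

lemma mu_mult:
  assumes "r \<in> R m m" "s \<in> R m m" shows "mu (r \<otimes>\<^bsub>A\<^esub> s) = mu r \<otimes>\<^bsub>L\<^esub> mu s"
proof (intro ext)
  have "r \<in> carrier A" "s \<in> carrier A" using assms R_closed[of m m] by auto
  then show "mu (r \<otimes>\<^bsub>A\<^esub> s) i j = (mu r \<otimes>\<^bsub>L\<^esub> mu s) i j" for i j
    using assms by (auto simp: matrix_unit_mult[OF mu_L mu_entry])
qed

lemma mu_add: "mu (r \<oplus>\<^bsub>A\<^esub> s) = mu r \<oplus>\<^bsub>L\<^esub> mu s"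
  by (auto simp: fun_eq_iff)

lemma mu_smult: "c \<in> carrier K \<Longrightarrow> mu (c \<odot>\<^bsub>A\<^esub> r) = c \<odot>\<^bsub>L\<^esub> mu r"
  by (auto simp: fun_eq_iff)

lemma V_mult_mu: "\<lbrakk>x \<in> carrier V; r \<in> R m m\<rbrakk> \<Longrightarrow> x \<otimes>\<^bsub>L\<^esub> mu r \<in> carrier V"
  using V_memD(1) mu_V by (intro V_mult) auto

text \<open>\<open>x\<close> lives in column \<open>m\<close>, so only row \<open>m\<close> of
  \<open>y\<close> is used, and in that row \<open>y\<close> has only its corner entry. Hence
  functionals of the form \<open>z \<mapsto> f (x z)\<close> depend on the corner entry of
  \<open>z\<close> alone.\<close>

lemma V_mult_V:
  assumes "x \<in> carrier V" "y \<in> carrier V"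
  shows "x \<otimes>\<^bsub>L\<^esub> y = x \<otimes>\<^bsub>L\<^esub> mu (y m m)"
proof (intro ext)
  fix i l
  note xD = V_memD[OF assms(1)] and yD = V_memD[OF assms(2)]
  have "(x \<otimes>\<^bsub>L\<^esub> y) i l = (\<Oplus>\<^bsub>A\<^esub>j\<in>UNIV. if m = j then x i j \<otimes>\<^bsub>A\<^esub> y j l else \<zero>\<^bsub>A\<^esub>)"
    unfolding Lambda_mult using xD yD by (intro M.finsum_cong') auto
  also have "\<dots> = x i m \<otimes>\<^bsub>A\<^esub> y m l"
    using xD(1) yD(1) M.finsum_singleton[of m UNIV "\<lambda>j. x i j \<otimes>\<^bsub>A\<^esub> y j l"] by simp
  also have "\<dots> = (x \<otimes>\<^bsub>L\<^esub> mu (y m m)) i l"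
    using xD(1) yD(2) mult_matrix_unit[OF xD(1) mu_entry[OF yD(3)]] by simp
  finally show "(x \<otimes>\<^bsub>L\<^esub> y) i l = (x \<otimes>\<^bsub>L\<^esub> mu (y m m)) i l" .
qed

text \<open>Nothing lies strictly above \<open>m\<close>, so row \<open>m\<close> of
  \<open>x\<close> vanishes off the corner and the sum has one term.\<close>

lemma corner_mult:
  assumes "x \<in> carrier L" "y \<in> carrier L"
  shows "(x \<otimes>\<^bsub>L\<^esub> y) m m = x m m \<otimes>\<^bsub>A\<^esub> y m m"
proof -
  have 0: "x m j = \<zero>\<^bsub>A\<^esub>" if "j \<noteq> m" for j
    using Lambda_entry[OF assms(1), of m j] that greatest[of j] by (auto simp: entry_def)
  have "(x \<otimes>\<^bsub>L\<^esub> y) m m = (\<Oplus>\<^bsub>A\<^esub>j\<in>UNIV. if m = j then x m j \<otimes>\<^bsub>A\<^esub> y j m else \<zero>\<^bsub>A\<^esub>)"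
    unfolding Lambda_mult using assms 0 by (intro M.finsum_cong') auto
  then show ?thesis
    using assms M.finsum_singleton[of m UNIV "\<lambda>j. x m j \<otimes>\<^bsub>A\<^esub> y j m"] by simp
qed

text \<open>Row \<open>m\<close> of \<open>x\<close> is zero off the corner, so
  \<open>e\<^sub>m \<Lambda> = e\<^sub>m \<Lambda> e\<^sub>m\<close> is a copy of
  \<open>R m m\<close>. For the right socle this yields the condition \<open>corner\<close>.\<close>

lemma idem_mult:
  assumes "x \<in> carrier L" shows "idem A u m \<otimes>\<^bsub>L\<^esub> x = mu (x m m)"
proof (intro ext)
  fix k l
  have 0: "x m j = \<zero>\<^bsub>A\<^esub>" if "j \<noteq> m" for j
    using Lambda_entry[OF assms(1), of m j] that greatest[of j] by (auto simp: entry_def)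
  then show "(idem A u m \<otimes>\<^bsub>L\<^esub> x) k l = mu (x m m) k l"
    using matrix_unit_mult[OF assms u_entry[of m]] entry_unit(1)[OF Lambda_entry[OF assms]]
    by (simp add: idem_def)
qed

lemma corner_mem: "x \<in> carrier L \<Longrightarrow> x m m \<in> R m m"
  using Lambda_entry[of x m m] by (simp add: entry_m)

text \<open>A nonzero entry at \<open>(i, j)\<close> has a nonzero product with some
  \<open>y\<close> in \<open>R j m\<close>; the matrix unit carrying \<open>y\<close> at
  \<open>(j, m)\<close> moves this product to the place \<open>(i, m)\<close>.\<close>

lemma faithful_V:
  assumes t: "t \<in> carrier L" "t \<noteq> \<zero>\<^bsub>L\<^esub>"
  shows "\<exists>y\<in>carrier V. t \<otimes>\<^bsub>L\<^esub> y \<noteq> \<zero>\<^bsub>L\<^esub>"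
proof -
  obtain i j where ij: "t i j \<noteq> \<zero>\<^bsub>A\<^esub>" using t by (auto simp: fun_eq_iff)
  then have "i \<le> j" "t i j \<in> R i j"
    using Lambda_entry[OF t(1), of i j] by (auto simp: entry_def split: if_splits)
  then obtain y where y: "y \<in> R j m" "t i j \<otimes>\<^bsub>A\<^esub> y \<noteq> \<zero>\<^bsub>A\<^esub>"
    using nonzero_product_to_greatest ij by blast
  have ye: "y \<in> entry j m" using y by (simp add: entry_m)
  have "matrix_unit A j m y \<in> carrier V"
    using matrix_unit_closed[OF ye] by (intro V_memI) auto
  moreover have "(t \<otimes>\<^bsub>L\<^esub> matrix_unit A j m y) i m \<noteq> \<zero>\<^bsub>A\<^esub>"
    using mult_matrix_unit[OF t(1) ye] y by simp
  then have "t \<otimes>\<^bsub>L\<^esub> matrix_unit A j m y \<noteq> \<zero>\<^bsub>L\<^esub>" by auto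
  ultimately show ?thesis by blast
qed

section \<open>\<open>E\<close> as a bimodule over \<open>R m m\<close> and \<Lambda>\<close>

lemma la_apply: "x \<in> carrier V \<Longrightarrow> la r f x = f (x \<otimes>\<^bsub>L\<^esub> mu r)"
  by (simp add: E_left_action_def)

lemma ra_apply: "x \<in> carrier V \<Longrightarrow> ra f a x = f (a \<otimes>\<^bsub>L\<^esub> x)"
  by (simp add: E_right_action_def)

lemma left_mult_linear: "a \<in> carrier L \<Longrightarrow> (\<lambda>x. a \<otimes>\<^bsub>L\<^esub> x) \<in> linear_maps K V V"
  using V_mult V_memD(1) by (intro linear_mapsI) (simp_all add: L.A.r_distr L.smult_mult_r)

lemma right_mult_linear: "r \<in> R m m \<Longrightarrow> (\<lambda>x. x \<otimes>\<^bsub>L\<^esub> mu r) \<in> linear_maps K V V"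
  using V_mult_mu V_memD(1) by (intro linear_mapsI) (simp_all add: L.A.l_distr L.smult_mult_l)

lemma la_mem: "\<lbrakk>r \<in> R m m; f \<in> carrier E\<rbrakk> \<Longrightarrow> la r f \<in> carrier E"
  unfolding E_left_action_def by (rule V.dual_comp[OF _ right_mult_linear])

lemma ra_mem: "\<lbrakk>a \<in> carrier L; f \<in> carrier E\<rbrakk> \<Longrightarrow> ra f a \<in> carrier E"
  unfolding E_right_action_def by (rule V.dual_comp[OF _ left_mult_linear])

interpretation E: left_module K E by (rule V.left_module_dual)

lemma triangular_data: "triangular_data K Rm L E la ra"
proof (intro triangular_data.intro triangular_data_axioms.intro)
  show "K_algebra K Rm" by (rule K_algebra_diagonal)
  show "K_algebra K L" by (rule K_algebra_Lambda)
  show "left_module K E" by (rule V.left_module_dual)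
  \<comment> \<open>Elements of \<open>E\<close> are extensional, so equality is tested on
    \<open>V\<close>. The second premise, membership in \<Lambda>, lets the ring laws of \<Lambda>
    apply directly in the computations below.\<close>
  have eqI: "g = h" if "g \<in> carrier E" "h \<in> carrier E"
    "\<And>x. \<lbrakk>x \<in> carrier V; x \<in> carrier L\<rbrakk> \<Longrightarrow> g x = h x" for g h
    using that V_memD(1) by (intro V.dual_eqI) blast+
  note mem = la_mem ra_mem E.M.a_closed E.smult_closed L.A.m_closed L.M.a_closed L.smult_closed
  fix f assume f: "f \<in> carrier E"
  note fD = V.dualD(2,3)[OF f]
  {
    fix s assume "s \<in> carrier Rm"
    then have s: "s \<in> R m m" by simp
    show "la s f \<in> carrier E" using la_mem s f by blast
    show "la s (f \<oplus>\<^bsub>E\<^esub> g) = la s f \<oplus>\<^bsub>E\<^esub> la s g" if g: "g \<in> carrier E" for g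
      by (rule eqI, (intro mem s f g)+) (simp add: la_apply V_mult_mu s)
    show "la (s \<oplus>\<^bsub>Rm\<^esub> s') f = la s f \<oplus>\<^bsub>E\<^esub> la s' f" if "s' \<in> carrier Rm" for s'
    proof -
      have s': "s' \<in> R m m" using that by simp
      have ss: "s \<oplus>\<^bsub>A\<^esub> s' \<in> R m m" using AL.submoduleD(3)[OF subspace s s'] by simp
      have "la (s \<oplus>\<^bsub>A\<^esub> s') f = la s f \<oplus>\<^bsub>E\<^esub> la s' f"
        by (rule eqI, (intro mem s s' ss f)+)
          (simp add: la_apply V_mult_mu s s' mu_add L.A.r_distr fD(1)[simplified])
      then show ?thesis by simp
    qed
    show "la (s \<otimes>\<^bsub>Rm\<^esub> s') f = la s (la s' f)" if "s' \<in> carrier Rm" for s'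
    proof -
      have s': "s' \<in> R m m" using that by simp
      have ss: "s \<otimes>\<^bsub>A\<^esub> s' \<in> R m m" using mult_closed[of m m m s s'] s s' by simp
      have "la (s \<otimes>\<^bsub>A\<^esub> s') f = la s (la s' f)"
        by (rule eqI, (intro mem s s' ss f)+)
          (simp add: la_apply V_mult_mu s s' mu_mult L.A.m_assoc)
      then show ?thesis by simp
    qed
    show "la s (ra f t) = ra (la s f) t" if t: "t \<in> carrier L" for t
      by (rule eqI, (intro mem s f t)+)
        (simp add: la_apply ra_apply V_mult_mu V_mult s t L.A.m_assoc)
    fix c assume c: "c \<in> carrier K"
    show "la (c \<odot>\<^bsub>Rm\<^esub> s) f = c \<odot>\<^bsub>E\<^esub> la s f"
    proof -
      have cs: "c \<odot>\<^bsub>A\<^esub> s \<in> R m m" using AL.submoduleD(4)[OF subspace c s] by simp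
      have "la (c \<odot>\<^bsub>A\<^esub> s) f = c \<odot>\<^bsub>E\<^esub> la s f"
        by (rule eqI, (intro mem s cs c f)+)
          (simp add: la_apply V_mult_mu s c mu_smult L.smult_mult_r fD(2)[simplified])
      then show ?thesis by simp
    qed
    show "la s (c \<odot>\<^bsub>E\<^esub> f) = c \<odot>\<^bsub>E\<^esub> la s f"
      by (rule eqI, (intro mem s c f)+) (simp add: la_apply V_mult_mu s)
  }
  {
    fix t assume t: "t \<in> carrier L"
    show "ra f t \<in> carrier E" using ra_mem t f by blast
    show "ra (f \<oplus>\<^bsub>E\<^esub> g) t = ra f t \<oplus>\<^bsub>E\<^esub> ra g t" if g: "g \<in> carrier E" for g
      by (rule eqI, (intro mem t f g)+) (simp add: ra_apply V_mult t)
    show "ra f (t \<oplus>\<^bsub>L\<^esub> t') = ra f t \<oplus>\<^bsub>E\<^esub> ra f t'" if t': "t' \<in> carrier L" for t'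
      by (rule eqI, (intro mem t t' f)+)
        (simp add: ra_apply V_mult t t' L.A.l_distr fD(1)[simplified])
    show "ra f (t \<otimes>\<^bsub>L\<^esub> t') = ra (ra f t) t'" if t': "t' \<in> carrier L" for t'
      by (rule eqI, (intro mem t t' f)+) (simp add: ra_apply V_mult t t' L.A.m_assoc)
    fix c assume c: "c \<in> carrier K"
    show "ra f (c \<odot>\<^bsub>L\<^esub> t) = c \<odot>\<^bsub>E\<^esub> ra f t"
      by (rule eqI, (intro mem t c f)+)
        (simp add: ra_apply V_mult t c L.smult_mult_l fD(2)[simplified])
    show "ra (c \<odot>\<^bsub>E\<^esub> f) t = c \<odot>\<^bsub>E\<^esub> ra f t"
      by (rule eqI, (intro mem t c f)+) (simp add: ra_apply V_mult t)
  }
  have "la (u m) f = f"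
    by (rule eqI, (intro mem unit_closed f)+) (simp add: la_apply idem_eq_mu[symmetric] mult_idem)
  then show "la \<one>\<^bsub>Rm\<^esub> f = f" by simp
  show "ra f \<one>\<^bsub>L\<^esub> = f"
    by (rule eqI, (intro mem L.A.one_closed f)+) (simp add: ra_apply)
qed

interpretation tri: triangular_data K Rm L E la ra by (rule triangular_data)
interpretation tilde: K_algebra K "tri.\<Delta>" by (rule tri.K_algebra_triangular)

section \<open>Finite generation of the blocks, and the socles of the triangular algebra\<close>

lemma finitely_generated_V:
  assumes "finitely_generated K L" shows "finitely_generated K V"
proof (rule finitely_generated_image[OF L.left_module V.left_module_axioms _ _ assms])
  have "x \<otimes>\<^bsub>L\<^esub> idem A u m \<in> carrier V" if "x \<in> carrier L" for x
    using V_mult[OF that idem_V] .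
  then show "(\<lambda>x. x \<otimes>\<^bsub>L\<^esub> idem A u m) \<in> linear_maps K L V"
    using idem_closed by (intro linear_mapsI) (simp_all add: L.A.l_distr L.smult_mult_l)
  show "carrier V \<subseteq> (\<lambda>x. x \<otimes>\<^bsub>L\<^esub> idem A u m) ` carrier L"
    by (simp add: Lambda_idem_def)
qed

lemma finitely_generated_diagonal:
  assumes "finitely_generated K L" shows "finitely_generated K Rm"
proof (rule finitely_generated_image[OF L.left_module tri.S.left_module _ _ assms])
  show "(\<lambda>x. x m m) \<in> linear_maps K L Rm"
    using corner_mem by (intro linear_mapsI) simp_all
  show "carrier Rm \<subseteq> (\<lambda>x. x m m) ` carrier L"
  proof
    fix r assume "r \<in> carrier Rm"
    then show "r \<in> (\<lambda>x. x m m) ` carrier L"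
      using mu_L by (intro rev_image_eqI[of "mu r"]) simp_all
  qed
qed

lemma finitely_generated_tilde:
  assumes "finitely_generated K L" shows "finitely_generated K tri.\<Delta>"
  using assms by (intro tri.finitely_generated_triangular finitely_generated_diagonal
      V.finitely_generated_dual finitely_generated_V)

lemma evaluation_nonzero:
  assumes "f \<in> carrier E" "f \<noteq> \<zero>\<^bsub>E\<^esub>"
  shows "\<exists>x\<in>carrier V. f x \<noteq> \<zero>\<^bsub>K\<^esub>"
proof (rule ccontr)
  assume "\<not> ?thesis"
  then have "f = \<zero>\<^bsub>E\<^esub>" by (intro V.dual_eqI[OF assms(1) E.M.zero_closed]) simp
  with assms(2) show False by blast
qed

lemma functional_nonzero: "\<lbrakk>x \<in> carrier V; f x \<noteq> \<zero>\<^bsub>K\<^esub>\<rbrakk> \<Longrightarrow> f \<noteq> \<zero>\<^bsub>E\<^esub>"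
  by auto

text \<open>Multiplying by \<open>e\<close> on the left keeps the row \<open>(R m m, E, 0)\<close>,
  and on the right the corner \<open>R m m\<close> alone, so the division ring needed is
  \<open>R m m\<close>.\<close>

lemma peak_socle_left:
  assumes fg: "finitely_generated K L"
  shows "peak_socle tri.\<Delta>"
proof -
  let ?e = "(u m, \<zero>\<^bsub>E\<^esub>, \<zero>\<^bsub>L\<^esub>)"
  note zE = E.M.zero_closed and zL = L.M.zero_closed
  have um: "u m \<in> R m m" by (rule unit_closed)
  \<comment> \<open>The rules removed here and in similar steps would unfold the zeros of
    \<open>E\<close> and \<Lambda> into functions, after which facts stated with these zeros no
    longer match.\<close>
  have e: "?e \<in> carrier tri.\<Delta>" using um zE zL by (simp del: Lambda_simps V.dual_simps)
  have xe: "(s, f, t) \<otimes>\<^bsub>tri.\<Delta>\<^esub> ?e = (s, \<zero>\<^bsub>E\<^esub>, \<zero>\<^bsub>L\<^esub>)"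
    if "s \<in> R m m" "f \<in> carrier E" "t \<in> carrier L" for s f t
    using that um zE zL unit_r[of m m s] tri.zero_actions
    by (simp del: Lambda_simps V.dual_simps)
  have ex: "?e \<otimes>\<^bsub>tri.\<Delta>\<^esub> (s, f, t) = (s, f, \<zero>\<^bsub>L\<^esub>)"
    if "s \<in> R m m" "f \<in> carrier E" "t \<in> carrier L" for s f t
    using that um zE zL unit_l[of m m s] tri.zero_actions tri.la_one
    by (simp del: Lambda_simps V.dual_simps)
  have ee: "?e \<otimes>\<^bsub>tri.\<Delta>\<^esub> ?e = ?e" by (rule xe[OF um zE zL])
  have "peak_idempotent tri.\<Delta> ?e"
  proof (intro peak_idempotent.intro peak_idempotent_axioms.intro)
    show "ring tri.\<Delta>" by (rule tilde.A.ring_axioms)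
    show "?e \<in> carrier tri.\<Delta>" by (rule e)
    show "?e \<otimes>\<^bsub>tri.\<Delta>\<^esub> ?e = ?e" by (rule ee)
    show "?e \<noteq> \<zero>\<^bsub>tri.\<Delta>\<^esub>" using u_nonzero by simp
    show "finitely_generated tri.\<Delta> (regular_module tri.\<Delta>\<lparr>carrier := {x \<in> carrier tri.\<Delta>. ?e \<otimes>\<^bsub>tri.\<Delta>\<^esub> x = x}\<rparr>)"
      by (rule tilde.finitely_generated_row[OF finitely_generated_tilde[OF fg] e ee])
    fix x assume "x \<in> carrier tri.\<Delta>"
    then obtain s f t where x: "x = (s, f, t)" and s: "s \<in> R m m" and f: "f \<in> carrier E" and t: "t \<in> carrier L"
      by auto
    show "?e \<otimes>\<^bsub>tri.\<Delta>\<^esub> (x \<otimes>\<^bsub>tri.\<Delta>\<^esub> ?e) = x \<otimes>\<^bsub>tri.\<Delta>\<^esub> ?e"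
      unfolding x xe[OF s f t] ex[OF s zE zL] ..
    show "\<exists>y\<in>carrier tri.\<Delta>. y \<otimes>\<^bsub>tri.\<Delta>\<^esub> (x \<otimes>\<^bsub>tri.\<Delta>\<^esub> ?e) = ?e" if "x \<otimes>\<^bsub>tri.\<Delta>\<^esub> ?e \<noteq> \<zero>\<^bsub>tri.\<Delta>\<^esub>"
    proof -
      have "s \<noteq> \<zero>\<^bsub>A\<^esub>" using that unfolding x xe[OF s f t] by simp
      then obtain r where r: "r \<in> R m m" "r \<otimes>\<^bsub>A\<^esub> s = u m" using diagonal_inverse s by blast
      have "(r, \<zero>\<^bsub>E\<^esub>, \<zero>\<^bsub>L\<^esub>) \<otimes>\<^bsub>tri.\<Delta>\<^esub> (s, \<zero>\<^bsub>E\<^esub>, \<zero>\<^bsub>L\<^esub>) = ?e"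
        using r s zE zL tri.zero_actions by (simp del: Lambda_simps V.dual_simps)
      moreover have "(r, \<zero>\<^bsub>E\<^esub>, \<zero>\<^bsub>L\<^esub>) \<in> carrier tri.\<Delta>" using r zE zL by (simp del: Lambda_simps V.dual_simps)
      ultimately show ?thesis unfolding x xe[OF s f t] by blast
    qed
    show "\<exists>w\<in>carrier tri.\<Delta>. ?e \<otimes>\<^bsub>tri.\<Delta>\<^esub> (w \<otimes>\<^bsub>tri.\<Delta>\<^esub> x) \<noteq> \<zero>\<^bsub>tri.\<Delta>\<^esub>" if nz: "x \<noteq> \<zero>\<^bsub>tri.\<Delta>\<^esub>"
    proof (cases "t = \<zero>\<^bsub>L\<^esub>")
      case True
      \<comment> \<open>With \<open>t = 0\<close> the matrix is already in the row of
        \<open>e\<close>, so \<open>w = 1\<close> works.\<close>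
      then have "?e \<otimes>\<^bsub>tri.\<Delta>\<^esub> (\<one>\<^bsub>tri.\<Delta>\<^esub> \<otimes>\<^bsub>tri.\<Delta>\<^esub> x) = x"
        using tilde.A.l_one[OF \<open>x \<in> carrier tri.\<Delta>\<close>] ex[OF s f t] x by metis
      then show ?thesis using nz tilde.A.one_closed by metis
    next
      case False
      then obtain y where y: "y \<in> carrier V" "t \<otimes>\<^bsub>L\<^esub> y \<noteq> \<zero>\<^bsub>L\<^esub>" using faithful_V[OF t] by blast
      have "t \<otimes>\<^bsub>L\<^esub> y \<in> carrier V" by (rule V_mult[OF t y(1)])
      then obtain g where g: "g \<in> carrier E" "g (t \<otimes>\<^bsub>L\<^esub> y) \<noteq> \<zero>\<^bsub>K\<^esub>"
        using V.dual_separates y(2) Lambda_idem_simps(1) by metis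
      \<comment> \<open>Left multiplication by \<open>w\<close> turns \<open>t\<close> into the
        functional \<open>ra g t\<close> in \<open>E\<close>, whose value at \<open>y\<close> is
        \<open>g (t y)\<close>, hence nonzero.\<close>
      define w where "w = (\<zero>\<^bsub>A\<^esub>, g, \<zero>\<^bsub>L\<^esub>)"
      have z: "\<zero>\<^bsub>A\<^esub> \<in> R m m" using AL.submoduleD(2)[OF subspace] by simp
      have w: "w \<in> carrier tri.\<Delta>" using g(1) z zL by (simp add: w_def del: Lambda_simps V.dual_simps)
      have "ra g t y \<noteq> \<zero>\<^bsub>K\<^esub>" using g y by (simp add: ra_apply)
      then have "ra g t \<noteq> \<zero>\<^bsub>E\<^esub>" by (rule functional_nonzero[OF y(1)])
      moreover have "w \<otimes>\<^bsub>tri.\<Delta>\<^esub> x = (\<zero>\<^bsub>A\<^esub>, ra g t, \<zero>\<^bsub>L\<^esub>)"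
        using s f t g(1) z zL tri.zero_actions(3)[OF f] ra_mem[OF t g(1)] R_closed[OF _ s]
        by (simp add: w_def x del: Lambda_simps V.dual_simps)
      then have "?e \<otimes>\<^bsub>tri.\<Delta>\<^esub> (w \<otimes>\<^bsub>tri.\<Delta>\<^esub> x) = (\<zero>\<^bsub>A\<^esub>, ra g t, \<zero>\<^bsub>L\<^esub>)"
        using ex[OF z ra_mem[OF t g(1)] zL] by simp
      ultimately show ?thesis using w by (intro bexI[of _ w]) simp_all
    qed
  qed
  then show ?thesis by (rule peak_idempotent.peak_socle)
qed

text \<open>Products are reversed in \<open>opposite\<close>, so the nonvanishing condition asks for
  \<open>w\<close> with \<open>x w e\<^sub>m\<close> nonzero. A nonzero \<open>t\<close> is handled
  by \<open>faithful_V\<close>. If \<open>t = 0\<close>, a nonzero \<open>s\<close> is first pushed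
  into \<open>E\<close>, and a nonzero element of \<open>E\<close> is moved to the column of
  \<open>e\<^sub>m\<close> by a \<open>y\<close> at which it does not vanish.\<close>

lemma peak_socle_right:
  assumes fg: "finitely_generated K L"
  shows "peak_socle (opposite tri.\<Delta>)"
proof -
  let ?O = "opposite tri.\<Delta>"
  let ?e = "(\<zero>\<^bsub>A\<^esub>, \<zero>\<^bsub>E\<^esub>, idem A u m)"
  interpret op: K_algebra K ?O by (rule tilde.K_algebra_opposite)
  note zE = E.M.zero_closed and zL = L.M.zero_closed and iL = idem_closed[of m]
  have um: "u m \<in> R m m" by (rule unit_closed)
  have z: "\<zero>\<^bsub>A\<^esub> \<in> R m m" using AL.submoduleD(2)[OF subspace] by simp
  have ii: "idem A u m \<otimes>\<^bsub>L\<^esub> idem A u m = idem A u m" by (rule mult_idem[OF idem_V])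
  have e: "?e \<in> carrier tri.\<Delta>" using z zE iL by (simp del: Lambda_simps V.dual_simps)
  have ex: "?e \<otimes>\<^bsub>tri.\<Delta>\<^esub> (s, f, t) = (\<zero>\<^bsub>A\<^esub>, \<zero>\<^bsub>E\<^esub>, mu (t m m))"
    if "s \<in> R m m" "f \<in> carrier E" "t \<in> carrier L" for s f t
    using that z zE zL iL R_closed[OF _ that(1)] tri.zero_actions(2,3) idem_mult[OF that(3)]
    by (simp del: Lambda_simps V.dual_simps)
  have xe: "(\<zero>\<^bsub>A\<^esub>, f, t) \<otimes>\<^bsub>tri.\<Delta>\<^esub> ?e = (\<zero>\<^bsub>A\<^esub>, ra f (idem A u m), t \<otimes>\<^bsub>L\<^esub> idem A u m)"
    if "f \<in> carrier E" "t \<in> carrier L" for f t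
    using that z zE zL iL tri.zero_actions(1) ra_mem[OF iL]
    by (simp del: Lambda_simps V.dual_simps)
  have ee: "?e \<otimes>\<^bsub>?O\<^esub> ?e = ?e"
    using ex[OF z zE iL] by (simp add: idem_def)
  have "peak_idempotent ?O ?e"
  proof (intro peak_idempotent.intro peak_idempotent_axioms.intro)
    show "ring ?O" by (rule tilde.ring_opposite)
    show eO: "?e \<in> carrier ?O" using e by simp
    show "?e \<otimes>\<^bsub>?O\<^esub> ?e = ?e" by (rule ee)
    have "idem A u m m m \<noteq> \<zero>\<^bsub>A\<^esub>" using u_nonzero by (simp add: idem_def)
    then show "?e \<noteq> \<zero>\<^bsub>?O\<^esub>" by auto
    have "finitely_generated K ?O"
      by (rule finitely_generated_image[OF tilde.left_module op.left_module _ _ finitely_generated_tilde[OF fg],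
            of "\<lambda>x. x"]) (auto intro!: linear_mapsI)
    then show "finitely_generated ?O (regular_module ?O\<lparr>carrier := {x \<in> carrier ?O. ?e \<otimes>\<^bsub>?O\<^esub> x = x}\<rparr>)"
      by (rule op.finitely_generated_row[OF _ eO ee])
    fix x assume xO: "x \<in> carrier ?O"
    then obtain s f t where x: "x = (s, f, t)" and s: "s \<in> R m m" and f: "f \<in> carrier E" and t: "t \<in> carrier L"
      by auto
    have tm: "t m m \<in> R m m" by (rule corner_mem[OF t])
    have "(\<zero>\<^bsub>A\<^esub>, \<zero>\<^bsub>E\<^esub>, mu (t m m)) \<otimes>\<^bsub>tri.\<Delta>\<^esub> ?e = (\<zero>\<^bsub>A\<^esub>, \<zero>\<^bsub>E\<^esub>, mu (t m m))"
      using xe[OF zE mu_L[OF tm]] tri.zero_actions(2)[OF iL] mult_idem[OF mu_V[OF tm]] by simp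
    then show "?e \<otimes>\<^bsub>?O\<^esub> (x \<otimes>\<^bsub>?O\<^esub> ?e) = x \<otimes>\<^bsub>?O\<^esub> ?e"
      unfolding opposite_simps x ex[OF s f t] .
    show "\<exists>y\<in>carrier ?O. y \<otimes>\<^bsub>?O\<^esub> (x \<otimes>\<^bsub>?O\<^esub> ?e) = ?e" if "x \<otimes>\<^bsub>?O\<^esub> ?e \<noteq> \<zero>\<^bsub>?O\<^esub>"
    proof -
      have "t m m \<noteq> \<zero>\<^bsub>A\<^esub>"
        using that unfolding opposite_simps x ex[OF s f t] by (auto simp: fun_eq_iff split: if_splits)
      then obtain r where r: "r \<in> R m m" "t m m \<otimes>\<^bsub>A\<^esub> r = u m" using diagonal_inverse tm by blast
      have "(\<zero>\<^bsub>A\<^esub>, \<zero>\<^bsub>E\<^esub>, mu (t m m)) \<otimes>\<^bsub>tri.\<Delta>\<^esub> (\<zero>\<^bsub>A\<^esub>, \<zero>\<^bsub>E\<^esub>, mu r) = ?e"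
        using r zE z tm tri.zero_actions(1)[OF z[folded diagonal_simps(1)]] tri.zero_actions(2)[OF mu_L[OF r(1)]]
          mu_mult[OF tm r(1)]
        by (simp add: idem_eq_mu del: Lambda_simps V.dual_simps)
      moreover have "(\<zero>\<^bsub>A\<^esub>, \<zero>\<^bsub>E\<^esub>, mu r) \<in> carrier ?O"
        using r z zE by (simp del: Lambda_simps V.dual_simps)
      ultimately show ?thesis unfolding opposite_simps x ex[OF s f t] by blast
    qed
    show "\<exists>w\<in>carrier ?O. ?e \<otimes>\<^bsub>?O\<^esub> (w \<otimes>\<^bsub>?O\<^esub> x) \<noteq> \<zero>\<^bsub>?O\<^esub>" if nz: "x \<noteq> \<zero>\<^bsub>?O\<^esub>"
    proof -
      \<comment> \<open>For \<open>g y\<close> nonzero, the functional obtained from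
        \<open>g\<close> by acting with \<open>y\<close> and then with \<open>e\<^sub>m\<close>
        takes at \<open>e\<^sub>m\<close> the value \<open>g (y e\<^sub>m) = g y\<close>.\<close>
      have E_case: "\<exists>y\<in>carrier L. (\<zero>\<^bsub>A\<^esub>, g, \<zero>\<^bsub>L\<^esub>) \<otimes>\<^bsub>tri.\<Delta>\<^esub> (\<zero>\<^bsub>A\<^esub>, \<zero>\<^bsub>E\<^esub>, y) \<otimes>\<^bsub>tri.\<Delta>\<^esub> ?e \<noteq> \<zero>\<^bsub>tri.\<Delta>\<^esub>"
        if g: "g \<in> carrier E" "g \<noteq> \<zero>\<^bsub>E\<^esub>" for g
      proof -
        obtain y where y: "y \<in> carrier V" "g y \<noteq> \<zero>\<^bsub>K\<^esub>" using evaluation_nonzero[OF g] by blast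
        have yL: "y \<in> carrier L" by (rule V_memD(1)[OF y(1)])
        have gy: "ra g y \<in> carrier E" by (rule ra_mem[OF yL g(1)])
        have "ra (ra g y) (idem A u m) (idem A u m) = g y"
          using ra_apply[OF idem_V] ii mult_idem[OF y(1)] by simp
        then have "ra (ra g y) (idem A u m) \<noteq> \<zero>\<^bsub>E\<^esub>"
          using y by (intro functional_nonzero[OF idem_V]) simp
        moreover have "(\<zero>\<^bsub>A\<^esub>, g, \<zero>\<^bsub>L\<^esub>) \<otimes>\<^bsub>tri.\<Delta>\<^esub> (\<zero>\<^bsub>A\<^esub>, \<zero>\<^bsub>E\<^esub>, y) = (\<zero>\<^bsub>A\<^esub>, ra g y, \<zero>\<^bsub>L\<^esub>)"
          using z zE zL g(1) yL gy tri.zero_actions(1)[OF z[folded diagonal_simps(1)]]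
          by (simp del: Lambda_simps V.dual_simps)
        ultimately have "(\<zero>\<^bsub>A\<^esub>, g, \<zero>\<^bsub>L\<^esub>) \<otimes>\<^bsub>tri.\<Delta>\<^esub> (\<zero>\<^bsub>A\<^esub>, \<zero>\<^bsub>E\<^esub>, y) \<otimes>\<^bsub>tri.\<Delta>\<^esub> ?e \<noteq> \<zero>\<^bsub>tri.\<Delta>\<^esub>"
          using xe[OF gy zL] by (simp del: V.dual_simps)
        then show ?thesis using yL by blast
      qed
      have "\<exists>w\<in>carrier tri.\<Delta>. x \<otimes>\<^bsub>tri.\<Delta>\<^esub> w \<otimes>\<^bsub>tri.\<Delta>\<^esub> ?e \<noteq> \<zero>\<^bsub>tri.\<Delta>\<^esub>"
      proof (cases "t = \<zero>\<^bsub>L\<^esub>")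
        case False
        then obtain y where y: "y \<in> carrier V" "t \<otimes>\<^bsub>L\<^esub> y \<noteq> \<zero>\<^bsub>L\<^esub>" using faithful_V[OF t] by blast
        have yL: "y \<in> carrier L" by (rule V_memD(1)[OF y(1)])
        have w: "(\<zero>\<^bsub>A\<^esub>, \<zero>\<^bsub>E\<^esub>, y) \<in> carrier tri.\<Delta>" using z zE yL by (simp del: Lambda_simps V.dual_simps)
        have "x \<otimes>\<^bsub>tri.\<Delta>\<^esub> (\<zero>\<^bsub>A\<^esub>, \<zero>\<^bsub>E\<^esub>, y) = (\<zero>\<^bsub>A\<^esub>, ra f y, t \<otimes>\<^bsub>L\<^esub> y)"
          using z zE s f t yL R_closed[OF _ s] tri.zero_actions(1) ra_mem[OF yL f]
          by (simp add: x del: Lambda_simps V.dual_simps)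
        then have "x \<otimes>\<^bsub>tri.\<Delta>\<^esub> (\<zero>\<^bsub>A\<^esub>, \<zero>\<^bsub>E\<^esub>, y) \<otimes>\<^bsub>tri.\<Delta>\<^esub> ?e =
            (\<zero>\<^bsub>A\<^esub>, ra (ra f y) (idem A u m), t \<otimes>\<^bsub>L\<^esub> y)"
          using xe[OF ra_mem[OF yL f] L.A.m_closed[OF t yL]] mult_idem[OF V_mult[OF t y(1)]] by simp
        then have "x \<otimes>\<^bsub>tri.\<Delta>\<^esub> (\<zero>\<^bsub>A\<^esub>, \<zero>\<^bsub>E\<^esub>, y) \<otimes>\<^bsub>tri.\<Delta>\<^esub> ?e \<noteq> \<zero>\<^bsub>tri.\<Delta>\<^esub>" using y(2) by simp
        then show ?thesis using w by blast
      next
        case t0: True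
        show ?thesis
        proof (cases "s = \<zero>\<^bsub>A\<^esub>")
          case True
          then have "f \<noteq> \<zero>\<^bsub>E\<^esub>" using nz x t0 by simp
          then obtain y where y: "y \<in> carrier L" "x \<otimes>\<^bsub>tri.\<Delta>\<^esub> (\<zero>\<^bsub>A\<^esub>, \<zero>\<^bsub>E\<^esub>, y) \<otimes>\<^bsub>tri.\<Delta>\<^esub> ?e \<noteq> \<zero>\<^bsub>tri.\<Delta>\<^esub>"
            using E_case[OF f] unfolding x t0 True by blast
          moreover have "(\<zero>\<^bsub>A\<^esub>, \<zero>\<^bsub>E\<^esub>, y) \<in> carrier tri.\<Delta>" using z zE y by (simp del: Lambda_simps V.dual_simps)
          ultimately show ?thesis by blast
        next
          case False
          \<comment> \<open>A functional \<open>g\<close> that detects \<open>mu s\<close> makes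
            \<open>la s g\<close> nonzero: its value at \<open>e\<^sub>m\<close> is
            \<open>g (mu s)\<close>. Multiplying \<open>x\<close> by \<open>(0, g, 0)\<close> thus
            reduces to the case of \<open>E\<close>.\<close>
          have "mu s \<noteq> \<zero>\<^bsub>V\<^esub>" using False by (auto simp: fun_eq_iff matrix_unit_def)
          then obtain g where g: "g \<in> carrier E" "g (mu s) \<noteq> \<zero>\<^bsub>K\<^esub>"
            using V.dual_separates[OF mu_V[OF s]] by blast
          have "la s g (idem A u m) = g (mu s)"
            using idem_mult[OF mu_L[OF s]] idem_V by (simp add: la_apply)
          then have lasg: "la s g \<noteq> \<zero>\<^bsub>E\<^esub>" "la s g \<in> carrier E"
            using g la_mem[OF s g(1)] functional_nonzero[OF idem_V, of "la s g"] by auto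
          then obtain y where y: "y \<in> carrier L"
            "(\<zero>\<^bsub>A\<^esub>, la s g, \<zero>\<^bsub>L\<^esub>) \<otimes>\<^bsub>tri.\<Delta>\<^esub> (\<zero>\<^bsub>A\<^esub>, \<zero>\<^bsub>E\<^esub>, y) \<otimes>\<^bsub>tri.\<Delta>\<^esub> ?e \<noteq> \<zero>\<^bsub>tri.\<Delta>\<^esub>"
            using E_case by blast
          have w: "(\<zero>\<^bsub>A\<^esub>, g, \<zero>\<^bsub>L\<^esub>) \<in> carrier tri.\<Delta>" "(\<zero>\<^bsub>A\<^esub>, \<zero>\<^bsub>E\<^esub>, y) \<in> carrier tri.\<Delta>"
            using z zE zL g(1) y(1) by (simp_all del: Lambda_simps V.dual_simps)
          have eq: "x \<otimes>\<^bsub>tri.\<Delta>\<^esub> (\<zero>\<^bsub>A\<^esub>, g, \<zero>\<^bsub>L\<^esub>) = (\<zero>\<^bsub>A\<^esub>, la s g, \<zero>\<^bsub>L\<^esub>)"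
            using s f g(1) z zL R_closed[OF _ s] tri.zero_actions(4)[OF f] lasg(2)
            by (simp add: x t0 del: Lambda_simps V.dual_simps)
          have xT: "x \<in> carrier tri.\<Delta>" using xO unfolding opposite_simps .
          have "x \<otimes>\<^bsub>tri.\<Delta>\<^esub> ((\<zero>\<^bsub>A\<^esub>, g, \<zero>\<^bsub>L\<^esub>) \<otimes>\<^bsub>tri.\<Delta>\<^esub> (\<zero>\<^bsub>A\<^esub>, \<zero>\<^bsub>E\<^esub>, y)) \<otimes>\<^bsub>tri.\<Delta>\<^esub> ?e \<noteq> \<zero>\<^bsub>tri.\<Delta>\<^esub>"
            unfolding tilde.A.m_assoc[OF xT w, symmetric] eq by (rule y(2))
          then show ?thesis using tilde.A.m_closed[OF w] by blast
        qed
      qed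
      then show ?thesis unfolding opposite_simps .
    qed
  qed
  then show ?thesis by (rule peak_idempotent.peak_socle)
qed


section \<open>The injective envelope\<close>

abbreviation "Lo \<equiv> opposite L"
abbreviation "EO \<equiv> E_right_module K A R u m"

lemma E_right_module_simps [simp]:
  "carrier EO = carrier E" "add EO = add E" "zero EO = zero E" "smult EO a f = ra f a"
  by (simp_all add: E_right_module_def E_space_def)

lemma left_module_E_right_module: "left_module Lo EO"
  by (rule left_moduleI)
    (simp_all add: L.ring_opposite E.M.a_ac tri.ra_add_l tri.ra_add_r tri.ra_mult del: Lambda_simps V.dual_simps)

lemma left_module_regular_opposite: "left_module Lo (regular_module Lo)"
  by (rule ring.left_module_regular[OF L.ring_opposite])

lemma submodule_idem_Lambda:
  "submodule ((\<lambda>x. idem A u m \<otimes>\<^bsub>L\<^esub> x) ` carrier L) Lo (regular_module Lo)"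
proof -
  have "(\<lambda>x. idem A u m \<otimes>\<^bsub>L\<^esub> x) \<in> linear_maps Lo (regular_module Lo) (regular_module Lo)"
    using idem_closed by (intro linear_mapsI) (simp_all add: L.A.r_distr L.A.m_assoc)
  from left_module.submodule_image[OF left_module_regular_opposite left_module_regular_opposite this]
  show ?thesis by simp
qed

lemma left_module_idem_Lambda: "left_module Lo (idem_Lambda A R u m)"
  unfolding idem_Lambda_def
  by (rule left_module.left_module_submodule[OF left_module_regular_opposite submodule_idem_Lambda])

text \<open>A \<Lambda>-linear map \<open>f\<close> into \<open>E\<close> is recovered from the
  functional \<open>\<phi> n = f n e\<^sub>m\<close>, and a functional \<psi> on \<open>M\<close>
  yields the \<Lambda>-linear map that sends \<open>x\<close> to
  \<open>y \<mapsto> \<psi> (x y)\<close>. So extending \<open>f\<close> amounts to extending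
  \<phi>.\<close>

lemma injective_E_right_module: "injective_module Lo EO"
  unfolding injective_module_def
proof (intro conjI allI impI left_module_E_right_module)
  fix M :: "('p \<Rightarrow> 'p \<Rightarrow> 'a, 'p \<Rightarrow> 'p \<Rightarrow> 'a) module" and N f
  assume *: "left_module Lo M \<and> submodule N Lo M \<and> f \<in> linear_maps Lo (M\<lparr>carrier := N\<rparr>) EO"
  interpret M: left_module Lo M using * by blast
  have N: "submodule N Lo M" and f: "f \<in> linear_maps Lo (M\<lparr>carrier := N\<rparr>) EO"
    using * by blast+
  interpret N: left_module Lo "M\<lparr>carrier := N\<rparr>" by (rule M.left_module_submodule[OF N])
  note ND = M.submoduleD[OF N]
  note fD = N.linear_mapsD[OF f left_module_E_right_module]
  \<comment> \<open>\<open>K\<close> acts on \<open>M\<close> through the multiples of the unit of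
    \<Lambda>, which turns \<open>M\<close> into a vector space.\<close>
  let ?c = "\<lambda>c. c \<odot>\<^bsub>L\<^esub> \<one>\<^bsub>L\<^esub>"
  define M' where "M' = with_scalars M (\<lambda>c x. ?c c \<odot>\<^bsub>M\<^esub> x)"
  have M's: "carrier M' = carrier M" "zero M' = zero M" "add M' = add M" "smult M' c x = ?c c \<odot>\<^bsub>M\<^esub> x" for c x
    by (simp_all add: M'_def)
  have cL: "?c c \<in> carrier L" if "c \<in> carrier K" for c
    by (rule L.smult_closed[OF that L.A.one_closed])
  \<comment> \<open>The scalars come from the opposite ring: \<open>a \<odot> x\<close> stands for
    \<open>x a\<close>, hence the reversed order.\<close>
  have assoc: "a \<odot>\<^bsub>M\<^esub> (b \<odot>\<^bsub>M\<^esub> x) = (b \<otimes>\<^bsub>L\<^esub> a) \<odot>\<^bsub>M\<^esub> x"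
    if "a \<in> carrier L" "b \<in> carrier L" "x \<in> carrier M" for a b x
    using M.smult_assoc[of a b x] that by simp
  have cl: "a \<odot>\<^bsub>M\<^esub> x \<in> carrier M" if "a \<in> carrier L" "x \<in> carrier M" for a x
    using M.smult_closed[of a x] that by simp
  have "left_module K M'"
  proof (rule left_moduleI, unfold M's)
    show "ring K" by (rule K.ring_axioms)
    fix x assume x: "x \<in> carrier M"
    show "?c \<one>\<^bsub>K\<^esub> \<odot>\<^bsub>M\<^esub> x = x" using x M.smult_one[OF x] by simp
    show "?c \<zero>\<^bsub>K\<^esub> \<odot>\<^bsub>M\<^esub> x = \<zero>\<^bsub>M\<^esub>"
      using M.smult_l_null[OF x] L.A.one_closed by (simp add: L.smult_l_null del: Lambda_simps)
    fix c assume c: "c \<in> carrier K"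
    show "?c c \<odot>\<^bsub>M\<^esub> x \<in> carrier M" by (rule cl[OF cL[OF c] x])
    show "?c c \<odot>\<^bsub>M\<^esub> (x \<oplus>\<^bsub>M\<^esub> y) = ?c c \<odot>\<^bsub>M\<^esub> x \<oplus>\<^bsub>M\<^esub> ?c c \<odot>\<^bsub>M\<^esub> y" if "y \<in> carrier M" for y
      using M.smult_r_distr[of "?c c" x y] cL[OF c] x that by simp
    fix d assume d: "d \<in> carrier K"
    show "?c (c \<oplus>\<^bsub>K\<^esub> d) \<odot>\<^bsub>M\<^esub> x = ?c c \<odot>\<^bsub>M\<^esub> x \<oplus>\<^bsub>M\<^esub> ?c d \<odot>\<^bsub>M\<^esub> x"
      using M.smult_l_distr[of "?c c" "?c d" x] cL[OF c] cL[OF d] x c d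
      by (simp add: L.smult_l_distr)
    have "?c d \<otimes>\<^bsub>L\<^esub> ?c c = ?c (c \<otimes>\<^bsub>K\<^esub> d)"
      using c d cL[OF c] by (simp add: L.smult_mult_l LL.smult_assoc[symmetric] K.m_comm)
    then show "?c (c \<otimes>\<^bsub>K\<^esub> d) \<odot>\<^bsub>M\<^esub> x = ?c c \<odot>\<^bsub>M\<^esub> (?c d \<odot>\<^bsub>M\<^esub> x)"
      using assoc[OF cL[OF c] cL[OF d] x] by simp
  qed (simp_all add: M.M.a_ac)
  then interpret M': vector_space_over K M'
    by (intro vector_space_over.intro K.field_axioms)
  have NK: "submodule N K M'"
    unfolding M'.submodule_iff M's using ND(1-3) ND(4)[of "?c _"] cL by (auto simp del: Lambda_simps)
  define \<phi> where "\<phi> n = f n (idem A u m)" for n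
  have "\<phi> \<in> linear_maps K (M'\<lparr>carrier := N\<rparr>) (regular_module K)"
  proof (rule linear_mapsI)
    fix n assume "n \<in> carrier (M'\<lparr>carrier := N\<rparr>)"
    then have n: "n \<in> N" by simp
    have fn: "f n \<in> carrier E" using fD(1)[of n] n by simp
    show "\<phi> n \<in> carrier (regular_module K)"
      using V.dualD(1)[OF fn idem_V] by (simp add: \<phi>_def)
    show "\<phi> (n \<oplus>\<^bsub>M'\<lparr>carrier := N\<rparr>\<^esub> k) = \<phi> n \<oplus>\<^bsub>regular_module K\<^esub> \<phi> k" if "k \<in> carrier (M'\<lparr>carrier := N\<rparr>)" for k
      using fD(2)[of n k] n that idem_V by (simp add: \<phi>_def M's)
    show "\<phi> (c \<odot>\<^bsub>M'\<lparr>carrier := N\<rparr>\<^esub> n) = c \<odot>\<^bsub>regular_module K\<^esub> \<phi> n" if c: "c \<in> carrier K" for c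
    proof -
      have "f (?c c \<odot>\<^bsub>M\<^esub> n) = ra (f n) (?c c)" using fD(3)[of "?c c" n] cL[OF c] n by simp
      moreover have "?c c \<otimes>\<^bsub>L\<^esub> idem A u m = c \<odot>\<^bsub>L\<^esub> idem A u m"
        using c idem_closed by (simp add: L.smult_mult_l)
      ultimately show ?thesis
        using ra_apply[OF idem_V] V.dualD(3)[OF fn c idem_V] by (simp add: \<phi>_def M's)
    qed
  qed
  then obtain \<psi> where \<psi>: "\<psi> \<in> linear_maps K M' (regular_module K)" and \<psi>N: "\<forall>n\<in>N. \<psi> n = \<phi> n"
    using M'.functional_extension[OF NK] by blast
  note \<psi>D = M'.functionalD[OF \<psi>, unfolded M's]
  define g where "g x = (\<lambda>y\<in>carrier V. \<psi> (y \<odot>\<^bsub>M\<^esub> x))" for x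
  note VL = V_memD(1)
  have gE: "g x \<in> carrier E" if x: "x \<in> carrier M" for x
    unfolding g_def
  proof (rule V.dualI)
    fix y assume y: "y \<in> carrier V"
    note yL = VL[OF y]
    show "\<psi> (y \<odot>\<^bsub>M\<^esub> x) \<in> carrier K" by (rule \<psi>D(1)[OF cl[OF yL x]])
    show "\<psi> ((y \<oplus>\<^bsub>V\<^esub> z) \<odot>\<^bsub>M\<^esub> x) = \<psi> (y \<odot>\<^bsub>M\<^esub> x) \<oplus>\<^bsub>K\<^esub> \<psi> (z \<odot>\<^bsub>M\<^esub> x)" if z: "z \<in> carrier V" for z
      using M.smult_l_distr[of y z x] \<psi>D(2)[OF cl[OF yL x] cl[OF VL[OF z] x]] yL VL[OF z] x by simp
    show "\<psi> ((c \<odot>\<^bsub>V\<^esub> y) \<odot>\<^bsub>M\<^esub> x) = c \<otimes>\<^bsub>K\<^esub> \<psi> (y \<odot>\<^bsub>M\<^esub> x)" if c: "c \<in> carrier K" for c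
    proof -
      have "?c c \<odot>\<^bsub>M\<^esub> (y \<odot>\<^bsub>M\<^esub> x) = (c \<odot>\<^bsub>V\<^esub> y) \<odot>\<^bsub>M\<^esub> x"
        using assoc[OF cL[OF c] yL x] yL c by (simp add: L.smult_mult_r)
      then show ?thesis using \<psi>D(3)[OF c cl[OF yL x]] by simp
    qed
  qed
  have g_apply: "g x y = \<psi> (y \<odot>\<^bsub>M\<^esub> x)" if "y \<in> carrier V" for x y
    using that by (simp add: g_def)
  have "g \<in> linear_maps Lo M EO"
  proof (rule linear_mapsI)
    fix x assume x: "x \<in> carrier M"
    show "g x \<in> carrier EO" using gE[OF x] by simp
    show "g (x \<oplus>\<^bsub>M\<^esub> z) = g x \<oplus>\<^bsub>EO\<^esub> g z" if z: "z \<in> carrier M" for z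
    proof -
      have "g (x \<oplus>\<^bsub>M\<^esub> z) = g x \<oplus>\<^bsub>E\<^esub> g z"
      proof (rule V.dual_eqI)
        show "g (x \<oplus>\<^bsub>M\<^esub> z) \<in> carrier E" "g x \<oplus>\<^bsub>E\<^esub> g z \<in> carrier E"
          using gE x z E.M.a_closed by blast+
        fix y assume y: "y \<in> carrier V"
        then show "g (x \<oplus>\<^bsub>M\<^esub> z) y = (g x \<oplus>\<^bsub>E\<^esub> g z) y"
          using M.smult_r_distr[of y x z] x z VL[OF y] \<psi>D(2)[OF cl[OF VL[OF y] x] cl[OF VL[OF y] z]]
          by (simp add: g_apply)
      qed
      then show ?thesis by simp
    qed
    show "g (a \<odot>\<^bsub>M\<^esub> x) = a \<odot>\<^bsub>EO\<^esub> g x" if "a \<in> carrier Lo" for a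
    proof -
      have a: "a \<in> carrier L" using that by simp
      have "g (a \<odot>\<^bsub>M\<^esub> x) = ra (g x) a"
      proof (rule V.dual_eqI)
        show "g (a \<odot>\<^bsub>M\<^esub> x) \<in> carrier E" by (rule gE[OF cl[OF a x]])
        show "ra (g x) a \<in> carrier E" by (rule ra_mem[OF a gE[OF x]])
        fix y assume y: "y \<in> carrier V"
        then show "g (a \<odot>\<^bsub>M\<^esub> x) y = ra (g x) a y"
          using assoc[OF VL[OF y] a x] V_mult[OF a y] by (simp add: g_apply ra_apply)
      qed
      then show ?thesis by simp
    qed
  qed
  moreover have "g n = f n" if n: "n \<in> N" for n
  proof (rule V.dual_eqI)
    show "g n \<in> carrier E" by (rule gE[OF ND(1)[OF n]])
    show fn: "f n \<in> carrier E" using fD(1)[of n] n by simp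
    fix y assume y: "y \<in> carrier V"
    \<comment> \<open>Because \<open>N\<close> is stable under \<open>y\<close>, \<psi> may be
      replaced by \<phi> there; linearity of \<open>f\<close> then moves \<open>y\<close> into the
      argument, where \<open>y e\<^sub>m = y\<close>.\<close>
    have "y \<odot>\<^bsub>M\<^esub> n \<in> N" using ND(4)[of y n] VL[OF y] n by simp
    then have "g n y = f (y \<odot>\<^bsub>M\<^esub> n) (idem A u m)"
      using \<psi>N y by (simp add: g_apply \<phi>_def)
    also have "\<dots> = f n (y \<otimes>\<^bsub>L\<^esub> idem A u m)"
      using fD(3)[of y n] VL[OF y] n ra_apply[OF idem_V] by simp
    also have "\<dots> = f n y" using mult_idem[OF y] by simp
    finally show "g n y = f n y" .
  qed
  ultimately show "\<exists>g\<in>linear_maps Lo M EO. \<forall>x\<in>N. g x = f x" by blast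
qed

text \<open>Restricting the functionals in \<open>N\<close> that only see the corner entry gives a subspace of the dual
  of \<open>R m m\<close>. It separates points because \<open>R m m\<close> is a division ring, so it is the whole dual.\<close>

lemma submodule_contains_corner_functionals:
  assumes fg: "finitely_generated K L"
    and N: "submodule N Lo EO" "N \<noteq> {\<zero>\<^bsub>E\<^esub>}" and t: "t \<in> carrier (dual_space K Rm)"
  shows "(\<lambda>y\<in>carrier V. t (y m m)) \<in> N"
proof -
  interpret EO: left_module Lo EO by (rule left_module_E_right_module)
  interpret D: vector_space_over K Rm
    by (intro vector_space_over.intro tri.S.left_module K.field_axioms)
  note ND = EO.submoduleD[OF N(1)]
  have NE: "g \<in> carrier E" if "g \<in> N" for g using ND(1)[OF that] by simp
  have Nra: "ra g a \<in> N" if "g \<in> N" "a \<in> carrier L" for g a using ND(4)[of a g] that by simp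
  \<comment> \<open>These functionals factor through the corner entry, so their restriction \<rho>
    to \<open>R m m\<close> determines them. This is what allows the return from the dual of
    \<open>R m m\<close> to \<open>N\<close> at the end.\<close>
  define N0 where "N0 = {g \<in> N. \<forall>y\<in>carrier V. g y = g (mu (y m m))}"
  define \<rho> where "\<rho> g = (\<lambda>r\<in>R m m. g (mu r))" for g :: "('p \<Rightarrow> 'p \<Rightarrow> 'a) \<Rightarrow> 'k"
  have \<rho>D: "\<rho> g \<in> carrier (dual_space K Rm)" if "g \<in> N" for g
  proof -
    note gD = V.dualD(1-3)[OF NE[OF that]]
    have "(\<lambda>r\<in>carrier Rm. g (mu r)) \<in> carrier (dual_space K Rm)"
    proof (rule D.dualI)
      fix r assume "r \<in> carrier Rm"
      then have r: "mu r \<in> carrier V" using mu_V by simp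
      show "g (mu r) \<in> carrier K" by (rule gD(1)[OF r])
      show "g (mu (r \<oplus>\<^bsub>Rm\<^esub> s)) = g (mu r) \<oplus>\<^bsub>K\<^esub> g (mu s)" if "s \<in> carrier Rm" for s
        using gD(2)[OF r mu_V[of s]] that by (simp add: mu_add)
      show "g (mu (c \<odot>\<^bsub>Rm\<^esub> r)) = c \<otimes>\<^bsub>K\<^esub> g (mu r)" if "c \<in> carrier K" for c
        using gD(3)[OF that r] that by (simp add: mu_smult)
    qed
    then show ?thesis by (simp add: \<rho>_def)
  qed
  define W where "W = \<rho> ` N0"
  have scal: "c \<odot>\<^bsub>E\<^esub> g \<in> N" if "g \<in> N" "c \<in> carrier K" for g c
  proof -
    \<comment> \<open>A \<Lambda>-submodule is a \<open>K\<close>-subspace because \<open>c\<close>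
      acts as \<open>c 1\<close>.\<close>
    have "c \<odot>\<^bsub>E\<^esub> g = ra g (c \<odot>\<^bsub>L\<^esub> \<one>\<^bsub>L\<^esub>)"
      using tri.ra_smult_l[OF that(2) L.A.one_closed NE[OF that(1)]] tri.ra_one[OF NE[OF that(1)]]
      by (simp del: V.dual_simps)
    then show ?thesis using Nra[OF that(1) L.smult_closed[OF that(2) L.A.one_closed]] by simp
  qed
  have N0I: "g \<in> N0"
    if "g \<in> N" "\<And>y. \<lbrakk>y \<in> carrier V; mu (y m m) \<in> carrier V\<rbrakk> \<Longrightarrow> g y = g (mu (y m m))" for g
    unfolding N0_def using that mu_V[OF V_memD(3)] by blast
  have N0N: "g \<in> N" and N0_eq: "y \<in> carrier V \<Longrightarrow> g y = g (mu (y m m))" if "g \<in> N0" for g y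
    using that unfolding N0_def by blast+
  have N0: "submodule N0 K E"
    unfolding E.submodule_iff
  proof (intro conjI ballI)
    show "N0 \<subseteq> carrier E" using NE N0N by blast
    show "\<zero>\<^bsub>E\<^esub> \<in> N0" using ND(2) by (intro N0I) simp_all
    fix g assume g: "g \<in> N0"
    show "g \<oplus>\<^bsub>E\<^esub> h \<in> N0" if h: "h \<in> N0" for h
    proof (rule N0I)
      show "g \<oplus>\<^bsub>E\<^esub> h \<in> N" using ND(3)[OF N0N[OF g] N0N[OF h]] by simp
      fix y assume y: "y \<in> carrier V" "mu (y m m) \<in> carrier V"
      show "(g \<oplus>\<^bsub>E\<^esub> h) y = (g \<oplus>\<^bsub>E\<^esub> h) (mu (y m m))"
        using N0_eq[OF g y(1)] N0_eq[OF h y(1)] y by simp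
    qed
    show "c \<odot>\<^bsub>E\<^esub> g \<in> N0" if c: "c \<in> carrier K" for c
    proof (rule N0I)
      show "c \<odot>\<^bsub>E\<^esub> g \<in> N" by (rule scal[OF N0N[OF g] c])
      fix y assume y: "y \<in> carrier V" "mu (y m m) \<in> carrier V"
      show "(c \<odot>\<^bsub>E\<^esub> g) y = (c \<odot>\<^bsub>E\<^esub> g) (mu (y m m))"
        using N0_eq[OF g y(1)] y by simp
    qed
  qed
  have "\<rho> \<in> linear_maps K (E\<lparr>carrier := N0\<rparr>) (dual_space K Rm)"
    using \<rho>D[OF N0N] mu_V by (intro linear_mapsI) (auto simp: \<rho>_def intro!: restrict_ext)
  from left_module.submodule_image[OF E.left_module_submodule[OF N0] D.left_module_dual this]
  have W: "submodule W K (dual_space K Rm)" by (simp add: W_def)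
  obtain f where f: "f \<in> N" "f \<noteq> \<zero>\<^bsub>E\<^esub>" using N(2) ND(2) by auto
  then obtain y where y: "y \<in> carrier V" "f y \<noteq> \<zero>\<^bsub>K\<^esub>"
    using evaluation_nonzero[OF NE] by blast
  have yL: "y \<in> carrier L" by (rule V_memD(1)[OF y(1)])
  have "\<exists>w\<in>W. w x \<noteq> \<zero>\<^bsub>K\<^esub>" if x': "x \<in> carrier Rm" "x \<noteq> \<zero>\<^bsub>Rm\<^esub>" for x
  proof -
    have x: "x \<in> R m m" using x' by simp
    then obtain s where s: "s \<in> R m m" "s \<otimes>\<^bsub>A\<^esub> x = u m"
      using diagonal_inverse[OF x] x'(2) by auto
    \<comment> \<open>Here \<open>g z = f (y s z)\<close>. By \<open>V_mult_V\<close> the product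
      \<open>s z\<close> depends only on the corner entry of \<open>z\<close>, so \<open>g\<close>
      is in \<open>N0\<close>; at \<open>z = x\<close> the choice \<open>s x = 1\<close> gives
      \<open>f (y e\<^sub>m) = f y\<close>, which is nonzero.\<close>
    define g where "g = ra (ra f y) (mu s)"
    have g_apply: "g z = f (y \<otimes>\<^bsub>L\<^esub> (mu s \<otimes>\<^bsub>L\<^esub> z))" if "z \<in> carrier V" for z
      using that V_mult[OF mu_L[OF s(1)] that] by (simp add: g_def ra_apply)
    have g_eq: "g z = g (mu (z m m))" if "z \<in> carrier V" for z
      unfolding g_apply[OF that] g_apply[OF mu_V[OF V_memD(3)[OF that]]]
        V_mult_V[OF mu_V[OF s(1)] that] ..
    have "g \<in> N" unfolding g_def by (rule Nra[OF Nra[OF f(1) yL] mu_L[OF s(1)]])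
    then have "g \<in> N0" by (rule N0I) (rule g_eq)
    moreover have "\<rho> g x = f y"
      using x g_apply[OF mu_V[OF x]] mu_mult[OF s(1) x] s(2) mult_idem[OF y(1)]
      by (simp add: \<rho>_def idem_eq_mu)
    ultimately show ?thesis using y(2) unfolding W_def by (intro bexI[of _ "\<rho> g"]) simp_all
  qed
  \<comment> \<open>Finite dimension is decisive here: \<open>W\<close> separates points and is
    therefore the whole dual.\<close>
  then have "W = carrier (dual_space K Rm)"
    by (intro D.separating_subspace_eq_dual[OF finitely_generated_diagonal[OF fg] W])
  then obtain g where g: "g \<in> N0" "t = \<rho> g" using t by (auto simp: W_def)
  have "(\<lambda>y\<in>carrier V. t (y m m)) = g"
  proof -
    have "(\<lambda>y\<in>carrier V. t (y m m)) = (\<lambda>y\<in>carrier V. g y)"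
      using V_memD(3) N0_eq[OF g(1)] unfolding g(2) by (intro restrict_ext) (simp add: \<rho>_def)
    also have "\<dots> = g"
      using NE[OF N0N[OF g(1)]] by (simp add: V.dual_carrier extensional_restrict)
    finally show ?thesis .
  qed
  then show ?thesis using N0N[OF g(1)] by simp
qed

text \<open>Essentiality is reduced to a single element of the image: \<open>h e\<^sub>m\<close> is
  the functional \<open>y \<mapsto> t (y m m)\<close>, which every nonzero submodule of
  \<open>E\<close> contains.\<close>

lemma injective_envelope_E:
  assumes fg: "finitely_generated K L"
  shows "injective_envelope Lo (idem_Lambda A R u m) EO"
proof -
  interpret D: vector_space_over K Rm
    by (intro vector_space_over.intro tri.S.left_module K.field_axioms)
  \<comment> \<open>Only the value at the unit matters: it makes \<open>h\<close> injective and
    \<open>h e\<^sub>m\<close> nonzero.\<close>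
  obtain t where t: "t \<in> carrier (dual_space K Rm)" "t (u m) \<noteq> \<zero>\<^bsub>K\<^esub>"
    using D.dual_separates[of "u m"] unit_closed[of m] u_nonzero[of m] by auto
  note tD = D.dualD[OF t(1), simplified]
  let ?M = "idem_Lambda A R u m"
  have M: "carrier ?M = mu ` R m m" "add ?M = add L" "smult ?M a x = x \<otimes>\<^bsub>L\<^esub> a" for a x
  proof -
    have "(\<lambda>x. idem A u m \<otimes>\<^bsub>L\<^esub> x) ` carrier L = mu ` R m m"
    proof safe
      fix x assume x: "x \<in> carrier L"
      then show "idem A u m \<otimes>\<^bsub>L\<^esub> x \<in> mu ` R m m"
        using corner_mem[OF x] by (simp add: idem_mult)
    next
      fix r assume r: "r \<in> R m m"
      show "mu r \<in> (\<lambda>x. idem A u m \<otimes>\<^bsub>L\<^esub> x) ` carrier L"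
        using idem_mult[OF mu_L[OF r]] by (intro rev_image_eqI[OF mu_L[OF r]]) simp
    qed
    then show "carrier ?M = mu ` R m m" by (simp add: idem_Lambda_def)
  qed (simp_all add: idem_Lambda_def)
  define h where "h x = (\<lambda>y\<in>carrier V. t (x m m \<otimes>\<^bsub>A\<^esub> y m m))" for x :: "'p \<Rightarrow> 'p \<Rightarrow> 'a"
  have corner: "y m m \<in> R m m" if "y \<in> carrier V" for y by (rule V_memD(3)[OF that])
  have RA: "r \<in> carrier A" if "r \<in> R m m" for r by (rule R_closed[OF _ that]) simp
  have mult: "r \<otimes>\<^bsub>A\<^esub> s \<in> R m m" if "r \<in> R m m" "s \<in> R m m" for r s
    by (rule mult_closed[OF _ _ that]) simp_all
  have hE: "h x \<in> carrier E" if x: "x m m \<in> R m m" for x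
    unfolding h_def
  proof (rule V.dualI)
    fix y assume y: "y \<in> carrier V"
    note c = corner[OF y] mult[OF x corner[OF y]]
    show "t (x m m \<otimes>\<^bsub>A\<^esub> y m m) \<in> carrier K" by (rule tD(1)[OF c(2)])
    show "t (x m m \<otimes>\<^bsub>A\<^esub> (y \<oplus>\<^bsub>V\<^esub> z) m m) = t (x m m \<otimes>\<^bsub>A\<^esub> y m m) \<oplus>\<^bsub>K\<^esub> t (x m m \<otimes>\<^bsub>A\<^esub> z m m)"
      if z: "z \<in> carrier V" for z
      using tD(2)[OF c(2) mult[OF x corner[OF z]]] RA[OF x] RA[OF c(1)] RA[OF corner[OF z]]
      by (simp add: A.r_distr)
    show "t (x m m \<otimes>\<^bsub>A\<^esub> (a \<odot>\<^bsub>V\<^esub> y) m m) = a \<otimes>\<^bsub>K\<^esub> t (x m m \<otimes>\<^bsub>A\<^esub> y m m)"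
      if a: "a \<in> carrier K" for a
      using tD(3)[OF a c(2)] RA[OF x] RA[OF c(1)] a by (simp add: smult_mult_r)
  qed
  have h: "h \<in> linear_maps Lo ?M EO"
  proof (rule linear_mapsI)
    fix x assume "x \<in> carrier ?M"
    then obtain r where r: "r \<in> R m m" "x = mu r" using M by auto
    then have x: "x m m \<in> R m m" "x \<in> carrier L" by simp_all
    show "h x \<in> carrier EO" using hE[of x] x(1) by simp
    show "h (x \<oplus>\<^bsub>?M\<^esub> z) = h x \<oplus>\<^bsub>EO\<^esub> h z" if "z \<in> carrier ?M" for z
    proof -
      have z: "z m m \<in> R m m" using that M by auto
      show ?thesis
        using tD(2)[OF mult[OF x(1) corner] mult[OF z corner]] RA[OF x(1)] RA[OF z] RA[OF corner]
        by (auto simp: h_def M A.l_distr intro!: restrict_ext)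
    qed
    show "h (a \<odot>\<^bsub>?M\<^esub> x) = a \<odot>\<^bsub>EO\<^esub> h x" if "a \<in> carrier Lo" for a
    proof -
      have a: "a \<in> carrier L" using that by simp
      show ?thesis
        using V_mult[OF a] corner_mult[OF x(2) a] corner_mult[OF a V_memD(1)] RA[OF x(1)] RA[OF corner]
          RA[OF corner_mem[OF a]]
        by (auto simp: h_def M E_right_action_def A.m_assoc intro!: restrict_ext)
    qed
  qed
  have inj: "inj_on h (carrier ?M)"
  proof (rule inj_onI)
    fix x z assume xz: "x \<in> carrier ?M" "z \<in> carrier ?M" "h x = h z"
    obtain r s where r: "r \<in> R m m" "x = mu r" and s: "s \<in> R m m" "z = mu s" using xz M by auto
    have d: "r \<ominus>\<^bsub>A\<^esub> s \<in> R m m" using AL.submoduleD(6)[OF subspace r(1) s(1)] by simp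
    show "x = z"
    proof (rule ccontr)
      assume "x \<noteq> z"
      then have "r \<ominus>\<^bsub>A\<^esub> s \<noteq> \<zero>\<^bsub>A\<^esub>" using r s RA M.minus_eq_zero_iff by auto
      then obtain q where q: "q \<in> R m m" "(r \<ominus>\<^bsub>A\<^esub> s) \<otimes>\<^bsub>A\<^esub> q = u m" using diagonal_inverse d by blast
      \<comment> \<open>With \<open>q\<close> inverse to \<open>r - s\<close>, the two functionals
        differ at \<open>mu q\<close> by \<open>t ((r - s) q) = t (u m)\<close>.\<close>
      have "r \<otimes>\<^bsub>A\<^esub> q = (r \<ominus>\<^bsub>A\<^esub> s) \<otimes>\<^bsub>A\<^esub> q \<oplus>\<^bsub>A\<^esub> s \<otimes>\<^bsub>A\<^esub> q"
        using RA[OF r(1)] RA[OF s(1)] RA[OF q(1)]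
        by (simp add: a_minus_def A.l_distr[symmetric] M.a_assoc M.l_neg)
      then have "t (r \<otimes>\<^bsub>A\<^esub> q) = t (u m) \<oplus>\<^bsub>K\<^esub> t (s \<otimes>\<^bsub>A\<^esub> q)"
        using q(2) tD(2)[OF unit_closed mult[OF s(1) q(1)]] by simp
      moreover have "h x (mu q) = h z (mu q)" using xz by simp
      then have "t (r \<otimes>\<^bsub>A\<^esub> q) = t (s \<otimes>\<^bsub>A\<^esub> q)"
        using mu_V[OF q(1)] r s by (simp add: h_def)
      ultimately show False
        using t(2) K.add.r_cancel_one[OF tD(1)[OF mult[OF s(1) q(1)]] tD(1)[OF unit_closed]] by simp
    qed
  qed
  have essential: "N = {\<zero>\<^bsub>EO\<^esub>}" if N: "submodule N Lo EO" "N \<inter> h ` carrier ?M = {\<zero>\<^bsub>EO\<^esub>}" for N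
  proof (rule ccontr)
    assume "N \<noteq> {\<zero>\<^bsub>EO\<^esub>}"
    then have "N \<noteq> {\<zero>\<^bsub>E\<^esub>}" by simp
    note mem = submodule_contains_corner_functionals[OF fg N(1) this t(1)]
    have "h (mu (u m)) = (\<lambda>y\<in>carrier V. t (y m m))"
      using unit_l[OF _ corner] by (auto simp: h_def intro!: restrict_ext)
    moreover have "h (mu (u m)) \<in> h ` carrier ?M" using M unit_closed[of m] by simp
    ultimately have "(\<lambda>y\<in>carrier V. t (y m m)) \<in> N \<inter> h ` carrier ?M" using mem by simp
    then have "(\<lambda>y\<in>carrier V. t (y m m)) = \<zero>\<^bsub>E\<^esub>" unfolding N(2) by simp
    from fun_cong[OF this, of "mu (u m)"] show False
      using mu_V[OF unit_closed] t(2) by simp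
  qed
  show ?thesis
    unfolding injective_envelope_def
    using left_module_idem_Lambda injective_E_right_module h inj essential by blast
qed

end

theorem proposition24:
  fixes K :: "'k ring" and A :: "('k, 'a) module"
    and R :: "'p::{finite, order} \<Rightarrow> 'p \<Rightarrow> 'a set" and u :: "'p \<Rightarrow> 'a" and m :: 'p
  assumes "admissible_system K A R u m"
    and "finite_dimensional K (Lambda A R u)"
  shows "injective_envelope (opposite (Lambda A R u))
           (idem_Lambda A R u m) (E_right_module K A R u m)
       \<and> right_peak_algebra K (Lambda_tilde K A R u m)
       \<and> left_peak_algebra K (Lambda_tilde K A R u m)"
proof -
  interpret admissible_system K A R u m by fact
  have fg: "finitely_generated K L"
    by (rule finite_dimensional_imp_finitely_generated[OF L.left_module assms(2)])
  have "K_algebra K (Lambda_tilde K A R u m)"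
    using triangular_data.K_algebra_triangular[OF triangular_data]
    by (simp add: Lambda_tilde_def E_space_def)
  then show ?thesis
    using injective_envelope_E[OF fg] peak_socle_left[OF fg] peak_socle_right[OF fg]
    by (simp add: right_peak_algebra_def left_peak_algebra_def Lambda_tilde_def E_space_def)
qed

end
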